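(* Let $E$ be one of the spaces listed in the context. For each $n\ge1$, let $(X_{j,n})_{1\le j\le n}$ be a strictly stationary sequence of random variables with values in $E$, such that $\limsup_{n\to\infty}nP(|X_{1,n}|>\varepsilon)<\infty$ for all $\varepsilon>0$. Suppose that there exists a sequence $(r_n)_n$ of positive integers with $k_n=[n/r_n]\to\infty$ such that $$\lim_{n\to\infty}\Big|E\big(e^{-\sum_{j=1}^nf(X_{j,n})}\big)-\big\{E\big(e^{-\sum_{j=1}^{r_n}f(X_{j,n})}\big)\big\}^{k_n}\Big|=0\qquad\text{for all } f\in C_K^+(E).$$ Let $N_n=\sum_{j=1}^n\delta_{X_{j,n}}$ and $N_{r_n,n}=\sum_{j=1}^{r_n}\delta_{X_{j,n}}$. Let $N$ be an infinitely divisible point process on $E$ with canonical measure $\lambda$, such that $N(E\cap\{-\infty,\infty\})=0$ almost surely. Let $D$ be the set of fixed atoms of $N$ and $D'=\{x>0:\ x\in D\ \text{or}\ -x\in D\}$. Then $N_n\stackrel d\to N$ if and only if the following two conditions hold: (a) $k_nP(\max_{j\le r_n}|X_{j,n}|>x)\to\lambda(M_x)$ for every $x>0$ with $x\notin D'$; (b) $k_nP(\max_{j\le r_n}|X_{j,n}|>x,\ N_{r_n,n}\in M)\to\lambda(M\cap M_x)$ for every $x>0$ with $x\notin D'$ and $\lambda(M_x)>0$, and every $M\in\mathcal M_0$ such that $\lambda(\partial M\cap M_x)=0$.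
   Context: The space $E$ is one of: (i) $[-b,-a)\cup(a,b]$, $(a,b]$, or $[-b,-a)$, for some $0\le a<b<\infty$; (ii) $[-\infty,-a)\cup(a,\infty]$, $(a,\infty]$, or $[-\infty,-a)$, for some $0\le a<\infty$; with the topology induced from $\overline{\mathbb R}=\mathbb R\cup\{\pm\infty\}$. $\mathcal B$ is the class of relatively compact Borel subsets of $E$. $M_p(E)$ is the set of Radon measures on $E$ taking values in $\mathbb Z_+$ on sets of $\mathcal B$, endowed with the topology of vague convergence ($\mu_n\to\mu$ iff $\mu_n(f)\to\mu(f)$ for all $f\in C_K^+(E)$, where $\mu(f)=\int f\,d\mu$ and $C_K^+(E)$ is the set of continuous compactly supported $f:E\to[0,\infty)$) and its Borel $\sigma$-field $\mathcal M_p(E)$. A point process on $E$ is a random element of $M_p(E)$; $N_n\stackrel d\to N$ means weak convergence of the laws on $M_p(E)$. A point process $N$ is infinitely divisible if for every $n\ge1$ it is equal in distribution to a sum of $n$ i.i.d. point processes; equivalently, there is a (unique) measure $\lambda$ on $M_p(E)$, called the canonical measure of $N$, with $\lambda(\{o\})=0$ ($o$ the null measure), $\int(1-e^{-\mu(B)})\lambda(d\mu)<\infty$ for all $B\in\mathcal B$, and $E(e^{-N(f)})=\exp\{-\int_{M_p(E)}(1-e^{-\mu(f)})\lambda(d\mu)\}$ for all measurable $f:E\to[0,\infty)$. A point $x$ is a fixed atom of $N$ if $P(N(\{x\})>0)>0$. Notation: $[\cdot]$ in $[n/r_n]$ is the integer part; $M_0=M_p(E)\setminus\{o\}$; $\mathcal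 M_0=\{M\in\mathcal M_p(E): M\subset M_0\}$; for $x>0$, $[-x,x]^c:=\{y\in E:|y|>x\}$ and $M_x=\{\mu\in M_0:\mu([-x,x]^c)>0\}$. $\partial M$ is the topological boundary of $M$. *)

theory Defs
  imports "HOL-Probability.Probability"
begin

section \<open>State space\<close>

text \<open>For \<open>b < \<infinity>\<close> these are the bounded spaces, for \<open>b = \<infinity>\<close> the ones containing infinite points.
  Subsets of the type \<^typ>\<open>ereal\<close> carry the induced topology.\<close>

definition state_space :: "ereal set \<Rightarrow> bool" where
  "state_space E \<longleftrightarrow> (\<exists>(a::real) (b::ereal). 0 \<le> a \<and> ereal a < b \<and>
     E \<in> {{-b ..< - ereal a} \<union> {ereal a <.. b}, {ereal a <.. b}, {-b ..< - ereal a}})"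

abbreviation borel_on :: "ereal set \<Rightarrow> ereal measure" where
  "borel_on E \<equiv> restrict_space borel E"

definition relcompact_borel :: "ereal set \<Rightarrow> ereal set set" where
  "relcompact_borel E = {B \<in> sets (borel_on E). compact ((top_of_set E) closure_of B)}"

text \<open>Functions are total on \<^typ>\<open>ereal\<close>; their values outside \<open>E\<close> play no role.\<close>

definition CK_plus :: "ereal set \<Rightarrow> (ereal \<Rightarrow> real) set" where
  "CK_plus E = {f. continuous_on E f \<and> (\<forall>x\<in>E. 0 \<le> f x) \<and>
     compact ((top_of_set E) closure_of {x \<in> E. f x \<noteq> 0})}"

section \<open>Point measures, vague topology, and point processes\<close>

text \<open>\<open>E\<close> is locally compact with a countable base, so a Borel measure on it is Radon iff it is
  finite on compact sets.\<close>

definition radon_measure_on :: "ereal set \<Rightarrow> ereal measure \<Rightarrow> bool" where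
  "radon_measure_on E \<mu> \<longleftrightarrow> sets \<mu> = sets (borel_on E) \<and>
     (\<forall>K. K \<subseteq> E \<and> compact K \<longrightarrow> emeasure \<mu> K < \<infinity>)"

definition point_measures :: "ereal set \<Rightarrow> ereal measure set" where
  "point_measures E = {\<mu>. radon_measure_on E \<mu> \<and>
     (\<forall>B\<in>relcompact_borel E. emeasure \<mu> B \<in> range of_nat)}"

definition vague_topology :: "ereal set \<Rightarrow> ereal measure topology" where
  "vague_topology E = topology_generated_by
     {{\<mu> \<in> point_measures E. (\<integral>x. f x \<partial>\<mu>) \<in> U} | f U. f \<in> CK_plus E \<and> open (U :: real set)}"

lemma topspace_vague_topology: "topspace (vague_topology E) = point_measures E"
proof -
  have "(\<lambda>_. 0) \<in> CK_plus E" by (simp add: CK_plus_def)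
  then have "point_measures E \<in>
     {{\<mu> \<in> point_measures E. (\<integral>x. f x \<partial>\<mu>) \<in> U} | f U. f \<in> CK_plus E \<and> open (U :: real set)}"
    by (intro CollectI exI[of _ "\<lambda>_. 0"] exI[of _ UNIV]) auto
  then show ?thesis
    unfolding vague_topology_def topology_generated_by_topspace by blast
qed

definition borel_Mp :: "ereal set \<Rightarrow> ereal measure measure" where
  "borel_Mp E = sigma (point_measures E) {U. openin (vague_topology E) U}"

definition point_process :: "ereal set \<Rightarrow> 'b measure \<Rightarrow> ('b \<Rightarrow> ereal measure) \<Rightarrow> bool" where
  "point_process E Q N \<longleftrightarrow> prob_space Q \<and> N \<in> measurable Q (borel_Mp E)"

abbreviation null_pm :: "ereal set \<Rightarrow> ereal measure" where
  "null_pm E \<equiv> null_measure (borel_on E)"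

definition sum_measures :: "ereal set \<Rightarrow> 'i set \<Rightarrow> ('i \<Rightarrow> ereal measure) \<Rightarrow> ereal measure" where
  "sum_measures E I \<mu> = measure_of E (sets (borel_on E)) (\<lambda>B. \<Sum>i\<in>I. emeasure (\<mu> i) B)"

definition sum_diracs :: "ereal set \<Rightarrow> nat \<Rightarrow> (nat \<Rightarrow> ereal) \<Rightarrow> ereal measure" where
  "sum_diracs E m x = sum_measures E {1..m} (\<lambda>j. return (borel_on E) (x j))"

text \<open>The random elements of a sequence may live on different probability spaces.\<close>

definition pp_conv_in_dist ::
  "ereal set \<Rightarrow> (nat \<Rightarrow> 'a measure) \<Rightarrow> (nat \<Rightarrow> 'a \<Rightarrow> ereal measure) \<Rightarrow>
    'b measure \<Rightarrow> ('b \<Rightarrow> ereal measure) \<Rightarrow> bool" where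
  "pp_conv_in_dist E P Ns Q N \<longleftrightarrow>
     (\<forall>g :: ereal measure \<Rightarrow> real.
        continuous_map (vague_topology E) euclideanreal g \<and> bounded (g ` point_measures E) \<longrightarrow>
        (\<lambda>n. \<integral>\<mu>. g \<mu> \<partial>distr (P n) (borel_Mp E) (Ns n))
          \<longlonglongrightarrow> (\<integral>\<mu>. g \<mu> \<partial>distr Q (borel_Mp E) N))"

section \<open>Infinite divisibility\<close>

text \<open>Any \<open>n\<close> i.i.d. point processes have a copy on the space of sequences of measures (as
  coordinates of the product of their laws), so fixing the type of \<open>R\<close> loses no generality.\<close>

definition infinitely_divisible ::
  "ereal set \<Rightarrow> 'b measure \<Rightarrow> ('b \<Rightarrow> ereal measure) \<Rightarrow> bool" where
  "infinitely_divisible E Q N \<longleftrightarrow> point_process E Q N \<and>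
     (\<forall>n\<ge>1. \<exists>(R :: (nat \<Rightarrow> ereal measure) measure)
         (Y :: nat \<Rightarrow> (nat \<Rightarrow> ereal measure) \<Rightarrow> ereal measure).
        (\<forall>i\<in>{1..n}. point_process E R (Y i)) \<and>
        prob_space.indep_vars R (\<lambda>_. borel_Mp E) Y {1..n} \<and>
        (\<forall>i\<in>{1..n}. \<forall>j\<in>{1..n}. distr R (borel_Mp E) (Y i) = distr R (borel_Mp E) (Y j)) \<and>
        distr Q (borel_Mp E) N =
          distr R (borel_Mp E) (\<lambda>\<omega>. sum_measures E {1..n} (\<lambda>i. Y i \<omega>)))"

text \<open>\<open>e\<^sup>-\<^sup>t\<close> for \<open>t \<in> [0, \<infinity>]\<close>, with \<open>e\<^sup>-\<^sup>\<infinity> = 0\<close>; needed since \<open>\<mu>(f)\<close> may be infinite for a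
  measurable \<open>f \<ge> 0\<close>.\<close>

definition exp_neg :: "ennreal \<Rightarrow> real" where
  "exp_neg t = (if t = \<infinity> then 0 else exp (- enn2real t))"

definition canonical_measure ::
  "ereal set \<Rightarrow> 'b measure \<Rightarrow> ('b \<Rightarrow> ereal measure) \<Rightarrow> ereal measure measure \<Rightarrow> bool" where
  "canonical_measure E Q N \<Lambda> \<longleftrightarrow>
     sets \<Lambda> = sets (borel_Mp E) \<and>
     emeasure \<Lambda> {null_pm E} = 0 \<and>
     (\<forall>B\<in>relcompact_borel E. (\<integral>\<^sup>+\<mu>. ennreal (1 - exp_neg (emeasure \<mu> B)) \<partial>\<Lambda>) < \<infinity>) \<and>
     (\<forall>f :: ereal \<Rightarrow> real. f \<in> borel_measurable (borel_on E) \<and> (\<forall>x\<in>E. 0 \<le> f x) \<longrightarrow>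
        (\<integral>\<omega>. exp_neg (\<integral>\<^sup>+x. ennreal (f x) \<partial>N \<omega>) \<partial>Q) =
        exp_neg (\<integral>\<^sup>+\<mu>. ennreal (1 - exp_neg (\<integral>\<^sup>+x. ennreal (f x) \<partial>\<mu>)) \<partial>\<Lambda>))"

definition fixed_atoms :: "ereal set \<Rightarrow> 'b measure \<Rightarrow> ('b \<Rightarrow> ereal measure) \<Rightarrow> ereal set" where
  "fixed_atoms E Q N = {x \<in> E. measure Q {\<omega> \<in> space Q. emeasure (N \<omega>) {x} > 0} > 0}"

definition fixed_atom_radii :: "ereal set \<Rightarrow> 'b measure \<Rightarrow> ('b \<Rightarrow> ereal measure) \<Rightarrow> real set" where
  "fixed_atom_radii E Q N =
     {x. 0 < x \<and> (ereal x \<in> fixed_atoms E Q N \<or> - ereal x \<in> fixed_atoms E Q N)}"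

definition nonnull_pms :: "ereal set \<Rightarrow> ereal measure set" where
  "nonnull_pms E = point_measures E - {null_pm E}"

definition pms_beyond :: "ereal set \<Rightarrow> real \<Rightarrow> ereal measure set" where
  "pms_beyond E x = {\<mu> \<in> nonnull_pms E. emeasure \<mu> {y \<in> E. \<bar>y\<bar> > ereal x} > 0}"

section \<open>Stationarity\<close>

definition strictly_stationary ::
  "'a measure \<Rightarrow> 's measure \<Rightarrow> nat \<Rightarrow> (nat \<Rightarrow> 'a \<Rightarrow> 's) \<Rightarrow> bool" where
  "strictly_stationary P S n X \<longleftrightarrow>
     (\<forall>j\<in>{1..n}. X j \<in> measurable P S) \<and>
     (\<forall>m h. m + h \<le> n \<longrightarrow>
        distr P (PiM {1..m} (\<lambda>_. S)) (\<lambda>\<omega>. \<lambda>j\<in>{1..m}. X j \<omega>) =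
        distr P (PiM {1..m} (\<lambda>_. S)) (\<lambda>\<omega>. \<lambda>j\<in>{1..m}. X (j + h) \<omega>))"

end

theory Submission
  imports Defs
begin

text \<open>The tail condition forces \<open>a = 0\<close>, so a subset of \<open>E\<close> is relatively compact iff it is bounded
  away from \<open>0\<close>. Countably many functionals \<open>\<xi> \<mapsto> exp (- \<xi>(f\<^sub>i))\<close> embed the point measures with the vague
  topology into the compact cube \<open>[0,1]\<^sup>\<nat>\<close>; there the Stone--Weierstrass theorem turns convergence of
  Laplace functionals into weak convergence, without any tightness argument. With the mixing condition,
  \<open>N\<^sub>n \<rightarrow> N\<close> in distribution is thus equivalent to
  \<open>k\<^sub>n E(1 - exp (- N\<^sub>r(f))) \<rightarrow> \<integral>(1 - exp (- \<mu>(f))) \<lambda>(d\<mu>)\<close> for all \<open>f\<close>. This condition says that the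
  measures \<open>(1 - exp (- \<mu>(g))) k\<^sub>n P(N\<^sub>r \<in> d\<mu>)\<close> converge weakly, and for \<open>g \<ge> 1\<close> beyond \<open>x\<close> the weight is
  bounded below on \<open>M\<^sub>x\<close>, which yields (a) and (b); conversely (a) and (b) give the condition by integrating
  over the level sets of \<open>1 - exp (- \<mu>(f))\<close>, all but countably many of which are continuity sets. Radii
  outside \<open>D'\<close> make \<open>M\<^sub>x\<close> itself a continuity set, and \<open>D'\<close> is countable since it consists of jumps of a
  monotone function.\<close>

text \<open>The obstacle is mass near the null measure: \<open>\<Lambda>\<close> may be infinite,
  and the rescaled row law \<open>k n * L n\<close> has total mass \<open>k n\<close>, which tends
  to infinity. The weight \<open>w \<xi> = 1 - exp (- \<xi>(g))\<close> removes this mass and keeps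
  Laplace functionals computable, because \<open>w \<xi> * exp (- \<xi>(f))\<close> is the
  difference of the losses of \<open>g + f\<close> and of \<open>f\<close>. The weight can be
  divided out again because point measures are integer valued: one that charges the set where
  \<open>g \<ge> 1\<close> gives it mass at least 1, so \<open>w \<ge> 1/2\<close> there.
  Compactness of the cube replaces tightness only because the limit measure is given in advance and
  lives on the embedded space. The cube may contain limit points outside the image; lower
  semicontinuous functionals are therefore approximated from below by functions that are continuous
  everywhere, not just on the image. Rows with \<open>k n = 0\<close> have \<open>r n > n\<close>,
  so their block reaches beyond the row. All laws are therefore shifted by an index \<open>m\<close>
  from which on \<open>k n \<ge> 1\<close>.\<close>

section \<open>Borel sets of a topology and semicontinuous functions\<close>

definition borel_of :: "'a topology \<Rightarrow> 'a measure" where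
  "borel_of X = sigma (topspace X) {U. openin X U}"

lemma openin_subset_Pow: "{U. openin X U} \<subseteq> Pow (topspace X)"
  by (auto dest: openin_subset)

lemma space_borel_of: "space (borel_of X) = topspace X"
  by (simp add: borel_of_def openin_subset_Pow)

lemma openin_sets_borel_of: "openin X U \<Longrightarrow> U \<in> sets (borel_of X)"
  by (auto simp: borel_of_def sets_measure_of openin_subset_Pow)

lemma closedin_sets_borel_of: "closedin X C \<Longrightarrow> C \<in> sets (borel_of X)"
proof -
  assume C: "closedin X C"
  then have "topspace X - (topspace X - C) \<in> sets (borel_of X)"
    using openin_sets_borel_of[of X "topspace X - C"] sets.compl_sets[of _ "borel_of X"]
    by (metis closedin_def space_borel_of)
  then show ?thesis
    using closedin_subset[OF C] by (simp add: double_diff)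
qed

lemma lsc_measurable:
  fixes g :: "'a \<Rightarrow> real"
  assumes "sets M = sets (borel_of X)" "\<And>c. openin X {x \<in> topspace X. g x > c}"
  shows "g \<in> borel_measurable M"
proof -
  have "space M = topspace X"
    using sets_eq_imp_space_eq[OF assms(1)] by (simp add: space_borel_of)
  then show ?thesis
    using openin_sets_borel_of[OF assms(2)] by (intro borel_measurableI_greater) (simp add: assms(1))
qed

lemma continuous_map_lsc:
  fixes g :: "'a \<Rightarrow> real"
  assumes "continuous_map X euclideanreal g"
  shows "openin X {x \<in> topspace X. g x > c}"
  using openin_continuous_map_preimage[OF assms, of "{c<..}"] by simp

lemma continuous_map_usc:
  fixes g :: "'a \<Rightarrow> real"
  assumes "continuous_map X euclideanreal g"
  shows "openin X {x \<in> topspace X. g x < c}"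
  using openin_continuous_map_preimage[OF assms, of "{..<c}"] by simp

lemma continuous_map_measurable:
  fixes g :: "'a \<Rightarrow> real"
  assumes "sets M = sets (borel_of X)" "continuous_map X euclideanreal g"
  shows "g \<in> borel_measurable M"
  using assms by (intro lsc_measurable continuous_map_lsc)

section \<open>Weak convergence tested on a multiplicative family\<close>

text \<open>The clause \<open>coord\<close> multiplies by a single coordinate, so the induction in
  \<open>lim_coord_polys\<close> only has to move one factor at a time into the list of the
  monomial; closure under general products is derived afterwards.\<close>

inductive_set coord_polys :: "((nat \<Rightarrow> real) \<Rightarrow> real) set" where
  const: "(\<lambda>_. c) \<in> coord_polys"
| add: "p \<in> coord_polys \<Longrightarrow> q \<in> coord_polys \<Longrightarrow> (\<lambda>u. p u + q u) \<in> coord_polys"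
| coord: "p \<in> coord_polys \<Longrightarrow> (\<lambda>u. u i * p u) \<in> coord_polys"

lemma coord_polys_scale: "p \<in> coord_polys \<Longrightarrow> (\<lambda>u. c * p u) \<in> coord_polys"
proof (induction rule: coord_polys.induct)
  case (coord p i)
  then show ?case using coord_polys.coord[of "\<lambda>u. c * p u" i] by (simp add: mult.left_commute)
qed (auto simp: distrib_left intro: coord_polys.intros)

lemma coord_polys_mult:
  assumes "p \<in> coord_polys" "q \<in> coord_polys"
  shows "(\<lambda>u. p u * q u) \<in> coord_polys"
  using assms
proof (induction rule: coord_polys.induct)
  case (coord p i)
  then show ?case using coord_polys.coord[of "\<lambda>u. p u * q u" i] by (simp add: mult.assoc)
qed (auto simp: distrib_right intro: coord_polys.intros coord_polys_scale)

lemma continuous_on_coord_polys: "p \<in> coord_polys \<Longrightarrow> continuous_on S p"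
  by (induction rule: coord_polys.induct)
    (auto intro!: continuous_intros intro: continuous_on_subset[OF continuous_on_product_coordinates])

lemma compact_unit_cube: "compact {u :: nat \<Rightarrow> real. \<forall>i. u i \<in> {0..1}}"
proof -
  have "compactin (product_topology (\<lambda>_. euclideanreal) UNIV) (PiE UNIV (\<lambda>_::nat. {0..1::real}))"
    by (subst compactin_PiE) auto
  then have "compact (PiE UNIV (\<lambda>_::nat. {0..1::real}))"
    by (simp only: euclidean_product_topology compactin_euclidean_iff)
  moreover have "PiE UNIV (\<lambda>_::nat. {0..1::real}) = {u. \<forall>i. u i \<in> {0..1}}"
    by auto
  ultimately show ?thesis by simp
qed

lemma coord_polys_dense:
  assumes "continuous_on {u. \<forall>i. u i \<in> {0..1}} h" "e > 0"
  obtains p where "p \<in> coord_polys" "\<And>u. \<forall>i. u i \<in> {0..1} \<Longrightarrow> \<bar>h u - p u\<bar> < e"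
proof -
  interpret function_ring_on coord_polys "{u. \<forall>i. u i \<in> {0..1}}"
  proof
    fix x y :: "nat \<Rightarrow> real" assume "x \<noteq> y"
    then obtain i where i: "x i \<noteq> y i" by auto
    have "(\<lambda>u. u i * 1) \<in> coord_polys"
      by (intro coord_polys.intros)
    with i show "\<exists>f\<in>coord_polys. f x \<noteq> f y" by (auto intro!: bexI[of _ "\<lambda>u. u i * 1"])
  qed (use compact_unit_cube coord_polys.const coord_polys.add in
      \<open>auto intro: continuous_on_coord_polys coord_polys_mult\<close>)
  from Stone_Weierstrass_basic[OF assms] that show thesis by force
qed

section \<open>Lower semicontinuity along an embedding into the cube\<close>

text \<open>Each map \<open>u \<mapsto> g x + k * dist u (\<Psi> x)\<close> is
  \<open>k\<close>-Lipschitz, and an infimum of such maps inherits the constant; the bound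
  \<open>- B\<close> makes the real \<open>INF\<close> a genuine infimum. Continuity holds at every
  \<open>u\<close>, also off the image of \<open>\<Psi>\<close>.\<close>

lemma mono_inf_conv_continuous:
  fixes g :: "'a \<Rightarrow> real" and \<Psi> :: "'a \<Rightarrow> 'm::metric_space"
  assumes ne: "A \<noteq> {}" and lb: "\<And>x. x \<in> A \<Longrightarrow> - B \<le> g x" and k: "k \<ge> 0"
  shows "continuous_on S (\<lambda>u. INF x\<in>A. g x + k * dist u (\<Psi> x))"
proof -
  let ?h = "\<lambda>u. INF x\<in>A. g x + k * dist u (\<Psi> x)"
  have bdd: "bdd_below ((\<lambda>x. g x + k * dist u (\<Psi> x)) ` A)" for u
    using lb k by (intro bdd_belowI2[of _ "-B"]) (smt (verit) mult_nonneg_nonneg zero_le_dist)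
  have le: "?h u - k * dist u v \<le> ?h v" for u v
  proof (rule cINF_greatest[OF ne])
    fix x assume x: "x \<in> A"
    have "?h u \<le> g x + k * dist u (\<Psi> x)"
      by (rule cINF_lower[OF bdd x])
    also have "k * dist u (\<Psi> x) \<le> k * (dist u v + dist v (\<Psi> x))"
      using k by (intro mult_left_mono dist_triangle) auto
    finally show "?h u - k * dist u v \<le> g x + k * dist v (\<Psi> x)"
      by (simp add: algebra_simps)
  qed
  have "k-lipschitz_on S ?h"
  proof (rule lipschitz_onI)
    show "dist (?h u) (?h v) \<le> k * dist u v" for u v
      using le[of u v] le[of v u] by (simp add: dist_real_def dist_commute abs_le_iff)
  qed (use k in auto)
  then show ?thesis by (rule lipschitz_on_continuous_on)
qed

text \<open>Together, \<open>cont\<close> and \<open>nbhd\<close> say that the topology of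
  \<open>X\<close> is the one pulled back along \<open>\<Psi>\<close> from the countable product.
  The image of \<open>\<Psi>\<close> may be an arbitrary subset of the cube.\<close>

locale test_family =
  fixes X :: "'a topology" and \<Psi> :: "'a \<Rightarrow> nat \<Rightarrow> real"
  assumes cont: "\<And>i. continuous_map X euclideanreal (\<lambda>x. \<Psi> x i)"
    and unit: "\<And>x i. x \<in> topspace X \<Longrightarrow> \<Psi> x i \<in> {0..1}"
    and nbhd: "\<And>U x. openin X U \<Longrightarrow> x \<in> U \<Longrightarrow>
      \<exists>\<delta>>0. \<forall>y\<in>topspace X. dist (\<Psi> y) (\<Psi> x) < \<delta> \<longrightarrow> y \<in> U"
begin

lemma Psi_measurable:
  assumes "sets M = sets (borel_of X)"
  shows "\<Psi> \<in> borel_measurable M"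
  by (intro measurable_coordinatewise_then_product continuous_map_measurable[OF assms] cont)

text \<open>Every open set of \<open>X\<close> is the preimage under \<open>\<Psi>\<close> of an
  open set \<open>V\<close>, a union of balls, and measurability into the countable product is
  coordinatewise. So the countably many coordinates already generate the Borel sets.\<close>

lemma measurable_into_borel_of:
  assumes "Y \<in> space M \<rightarrow> topspace X" "\<And>i. (\<lambda>\<omega>. \<Psi> (Y \<omega>) i) \<in> borel_measurable M"
  shows "Y \<in> measurable M (borel_of X)"
  unfolding borel_of_def
proof (rule measurable_measure_of[OF openin_subset_Pow assms(1)])
  fix U assume "U \<in> {U. openin X U}"
  then have U: "openin X U" by simp
  define V where "V = \<Union>{ball (\<Psi> x) \<delta> | x \<delta>. x \<in> U \<and> \<delta> > 0 \<and>
    (\<forall>y\<in>topspace X. dist (\<Psi> y) (\<Psi> x) < \<delta> \<longrightarrow> y \<in> U)}"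
  have "open V" unfolding V_def by auto
  moreover have "Y -` U \<inter> space M = (\<lambda>\<omega>. \<Psi> (Y \<omega>)) -` V \<inter> space M"
  proof (intro equalityI subsetI)
    fix \<omega> assume "\<omega> \<in> Y -` U \<inter> space M"
    moreover from this obtain \<delta> where "\<delta> > 0"
      "\<forall>y\<in>topspace X. dist (\<Psi> y) (\<Psi> (Y \<omega>)) < \<delta> \<longrightarrow> y \<in> U"
      using nbhd[OF U, of "Y \<omega>"] by auto
    ultimately have "ball (\<Psi> (Y \<omega>)) \<delta> \<subseteq> V" "\<Psi> (Y \<omega>) \<in> ball (\<Psi> (Y \<omega>)) \<delta>"
      unfolding V_def by auto
    with \<open>\<omega> \<in> Y -` U \<inter> space M\<close> show "\<omega> \<in> (\<lambda>\<omega>. \<Psi> (Y \<omega>)) -` V \<inter> space M"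
      by auto
  next
    fix \<omega> assume "\<omega> \<in> (\<lambda>\<omega>. \<Psi> (Y \<omega>)) -` V \<inter> space M"
    then show "\<omega> \<in> Y -` U \<inter> space M"
      using assms(1) unfolding V_def by (auto simp: dist_commute)
  qed
  moreover have "(\<lambda>\<omega>. \<Psi> (Y \<omega>)) \<in> borel_measurable M"
    by (intro measurable_coordinatewise_then_product assms)
  ultimately show "Y -` U \<inter> space M \<in> sets M"
    by (simp add: measurable_sets_borel borel_open measurable_sets)
qed

end

text \<open>Lists may repeat indices, so the products in \<open>lim\<close> are all monomials in the
  coordinates. The empty list gives convergence of the total masses, which allows finite measures of
  varying mass.\<close>

locale test_convergence = test_family +
  fixes \<nu>s :: "nat \<Rightarrow> 'a measure" and \<nu> :: "'a measure"
  assumes fin: "\<And>n. finite_measure (\<nu>s n)" "finite_measure \<nu>"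
    and sets: "\<And>n. sets (\<nu>s n) = sets (borel_of X)" "sets \<nu> = sets (borel_of X)"
    and lim: "\<And>l. (\<lambda>n. \<integral>x. prod_list (map (\<Psi> x) l) \<partial>\<nu>s n) \<longlonglongrightarrow> (\<integral>x. prod_list (map (\<Psi> x) l) \<partial>\<nu>)"
begin

lemma spaces: "space (\<nu>s n) = topspace X" "space \<nu> = topspace X"
  using sets_eq_imp_space_eq[OF sets(1)] sets_eq_imp_space_eq[OF sets(2)] by (simp_all add: space_borel_of)

lemma mass_lim: "(\<lambda>n. measure (\<nu>s n) (topspace X)) \<longlonglongrightarrow> measure \<nu> (topspace X)"
  using lim[of "[]"] by (simp add: spaces)

lemma integrable_bdd:
  fixes g :: "'a \<Rightarrow> real"
  assumes "finite_measure M" "sets M = sets (borel_of X)" "g \<in> borel_measurable M"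
    "\<And>x. x \<in> topspace X \<Longrightarrow> \<bar>g x\<bar> \<le> B"
  shows "integrable M g"
proof -
  interpret finite_measure M by fact
  have "space M = topspace X"
    using sets_eq_imp_space_eq[OF assms(2)] by (simp add: space_borel_of)
  then show ?thesis using assms by (intro integrable_const_bound[where B=B]) auto
qed

lemma integrable_comp:
  fixes h :: "(nat \<Rightarrow> real) \<Rightarrow> real"
  assumes M: "finite_measure M" "sets M = sets (borel_of X)" and h: "continuous_on UNIV h"
  shows "integrable M (\<lambda>x. h (\<Psi> x))"
proof -
  have "compact (h ` {u :: nat \<Rightarrow> real. \<forall>i. u i \<in> {0..1}})"
    by (intro compact_continuous_image compact_unit_cube continuous_on_subset[OF h]) simp
  then obtain B where "\<And>y. y \<in> h ` {u :: nat \<Rightarrow> real. \<forall>i. u i \<in> {0..1}} \<Longrightarrow> \<bar>y\<bar> \<le> B"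
    using compact_imp_bounded bounded_real by metis
  then have "\<bar>h (\<Psi> x)\<bar> \<le> B" if "x \<in> topspace X" for x
    using unit[OF that] by blast
  then show ?thesis
    using measurable_compose[OF Psi_measurable[OF M(2)] borel_measurable_continuous_onI[OF h]]
    by (intro integrable_bdd M) auto
qed

lemma lim_coord_polys:
  assumes "p \<in> coord_polys"
  shows "(\<lambda>n. \<integral>x. p (\<Psi> x) * prod_list (map (\<Psi> x) l) \<partial>\<nu>s n) \<longlonglongrightarrow>
    (\<integral>x. p (\<Psi> x) * prod_list (map (\<Psi> x) l) \<partial>\<nu>)"
  using assms
proof (induction arbitrary: l rule: coord_polys.induct)
  case (const c)
  show ?case using tendsto_mult[OF tendsto_const lim] by simp
next
  case (add p q)
  have m: "(\<lambda>u::nat\<Rightarrow>real. prod_list (map u l)) \<in> coord_polys"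
  proof (induction l)
    case Nil
    then show ?case using coord_polys.const[of 1] by simp
  next
    case (Cons a l)
    then show ?case using coord_polys.coord[OF Cons, of a] by simp
  qed
  have i: "integrable M (\<lambda>x. r (\<Psi> x) * prod_list (map (\<Psi> x) l))"
    if "finite_measure M" "sets M = sets (borel_of X)" "r \<in> coord_polys" for M r
    using that integrable_comp[OF that(1,2) continuous_on_coord_polys[OF coord_polys_mult[OF that(3) m]]]
    by simp
  show ?case
    using tendsto_add[OF add.IH(1)[of l] add.IH(2)[of l]] add.hyps
    by (simp add: distrib_right i fin sets)
next
  case (coord p i)
  show ?case using coord.IH[of "i # l"] by (simp add: mult_ac)
qed

lemma lim_continuous_cube:
  fixes h :: "(nat \<Rightarrow> real) \<Rightarrow> real"
  assumes h: "continuous_on UNIV h"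
  shows "(\<lambda>n. \<integral>x. h (\<Psi> x) \<partial>\<nu>s n) \<longlonglongrightarrow> (\<integral>x. h (\<Psi> x) \<partial>\<nu>)"
proof (rule tendstoI)
  fix \<epsilon> :: real assume "\<epsilon> > 0"
  \<comment> \<open>The masses of \<open>\<nu>s n\<close> tend to that of \<open>\<nu>\<close>, so
    the summand 1 makes \<open>C\<close> an eventual common bound and one approximation error
    \<open>e\<close> serves all the measures.\<close>
  define C where "C = measure \<nu> (topspace X) + 1"
  have C: "C > 0" unfolding C_def by (simp add: add_nonneg_pos)
  define e where "e = \<epsilon> / (3 * C)"
  have e: "e > 0" using C \<open>\<epsilon> > 0\<close> unfolding e_def by simp
  obtain p where p: "p \<in> coord_polys" and hp: "\<And>u. \<forall>i. u i \<in> {0..1} \<Longrightarrow> \<bar>h u - p u\<bar> < e"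
    using coord_polys_dense[OF continuous_on_subset[OF h] e] by auto
  have near: "\<bar>(\<integral>x. h (\<Psi> x) \<partial>M) - (\<integral>x. p (\<Psi> x) \<partial>M)\<bar> \<le> \<epsilon> / 3"
    if M: "finite_measure M" "sets M = sets (borel_of X)" and m: "measure M (topspace X) \<le> C" for M
  proof -
    interpret finite_measure M by fact
    have sp: "space M = topspace X"
      using sets_eq_imp_space_eq[OF M(2)] by (simp add: space_borel_of)
    have "\<bar>(\<integral>x. h (\<Psi> x) \<partial>M) - (\<integral>x. p (\<Psi> x) \<partial>M)\<bar> = \<bar>\<integral>x. h (\<Psi> x) - p (\<Psi> x) \<partial>M\<bar>"
      by (subst Bochner_Integration.integral_diff)
        (intro integrable_comp M h continuous_on_coord_polys p refl)+
    also have "\<dots> \<le> (\<integral>x. \<bar>h (\<Psi> x) - p (\<Psi> x)\<bar> \<partial>M)"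
      by (rule integral_abs_bound)
    also have "\<dots> \<le> (\<integral>x. e \<partial>M)"
    proof (rule integral_mono)
      show "integrable M (\<lambda>x. \<bar>h (\<Psi> x) - p (\<Psi> x)\<bar>)"
        by (intro integrable_abs Bochner_Integration.integrable_diff integrable_comp M h
            continuous_on_coord_polys p)
      show "\<bar>h (\<Psi> x) - p (\<Psi> x)\<bar> \<le> e" if "x \<in> space M" for x
        using hp[of "\<Psi> x"] unit[of x] that by (auto simp: sp intro!: less_imp_le)
    qed simp
    also have "\<dots> = e * measure M (topspace X)" by (simp add: sp)
    also have "\<dots> \<le> e * C" using m e by (intro mult_left_mono) auto
    also have "\<dots> = \<epsilon> / 3" using C by (simp add: e_def)
    finally show ?thesis .
  qed
  have "eventually (\<lambda>n. measure (\<nu>s n) (topspace X) < C) sequentially"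
    using order_tendstoD(2)[OF mass_lim] by (simp add: C_def)
  moreover have "eventually (\<lambda>n. dist (\<integral>x. p (\<Psi> x) \<partial>\<nu>s n) (\<integral>x. p (\<Psi> x) \<partial>\<nu>) < \<epsilon> / 3) sequentially"
    using tendstoD[OF lim_coord_polys[OF p, of "[]"], of "\<epsilon> / 3"] \<open>\<epsilon> > 0\<close> by simp
  ultimately show "eventually (\<lambda>n. dist (\<integral>x. h (\<Psi> x) \<partial>\<nu>s n) (\<integral>x. h (\<Psi> x) \<partial>\<nu>) < \<epsilon>) sequentially"
  proof eventually_elim
    case (elim n)
    have "\<bar>(\<integral>x. h (\<Psi> x) \<partial>\<nu>s n) - (\<integral>x. p (\<Psi> x) \<partial>\<nu>s n)\<bar> \<le> \<epsilon> / 3"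
      using elim by (intro near fin sets) auto
    moreover have "\<bar>(\<integral>x. h (\<Psi> x) \<partial>\<nu>) - (\<integral>x. p (\<Psi> x) \<partial>\<nu>)\<bar> \<le> \<epsilon> / 3"
      by (intro near fin sets) (simp add: C_def)
    ultimately show ?case using elim(2) unfolding dist_real_def by linarith
  qed
qed

text \<open>The inf-convolutions \<open>u \<mapsto> INF x. g x + k * dist u (\<Psi> x)\<close> are continuous on the cube and
  increase to \<open>g\<close> along \<open>\<Psi>\<close>.\<close>

lemma lsc_liminf:
  fixes g :: "'a \<Rightarrow> real"
  assumes lsc: "\<And>c. openin X {x \<in> topspace X. g x > c}"
    and bdd: "\<And>x. x \<in> topspace X \<Longrightarrow> \<bar>g x\<bar> \<le> B" and "\<epsilon> > 0"
  shows "eventually (\<lambda>n. (\<integral>x. g x \<partial>\<nu>s n) > (\<integral>x. g x \<partial>\<nu>) - \<epsilon>) sequentially"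
proof (cases "topspace X = {}")
  \<comment> \<open>An \<open>INF\<close> over the empty set would carry no information; on an empty
    space every integral is 0.\<close>
  case True
  then have "space (\<nu>s n) = {}" "space \<nu> = {}" for n
    by (simp_all add: spaces)
  then have "(\<integral>x. g x \<partial>\<nu>s n) = (\<integral>x. 0 \<partial>\<nu>s n)" "(\<integral>x. g x \<partial>\<nu>) = (\<integral>x. 0 \<partial>\<nu>)" for n
    by (intro Bochner_Integration.integral_cong refl; simp)+
  then show ?thesis using \<open>\<epsilon> > 0\<close> by simp
next
  case False
  define h where "h = (\<lambda>(k::nat) u. INF x\<in>topspace X. g x + real k * dist u (\<Psi> x))"
  have B: "B \<ge> 0" using False bdd by (metis abs_ge_zero all_not_in_conv order_trans)
  have bddb: "bdd_below ((\<lambda>x. g x + real k * dist u (\<Psi> x)) ` topspace X)" for u k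
    using bdd by (intro bdd_belowI2[of _ "-B"])
      (smt (verit) mult_nonneg_nonneg zero_le_dist of_nat_0_le_iff)
  have h_cont: "continuous_on UNIV (h k)" for k
    unfolding h_def using False bdd by (intro mono_inf_conv_continuous[where B=B]) (auto simp: abs_le_iff minus_le_iff)
  have h_le: "h k (\<Psi> x) \<le> g x" if "x \<in> topspace X" for k x
    unfolding h_def using cINF_lower[OF bddb that, of k "\<Psi> x"] by simp
  have h_ge: "- B \<le> h k u" for k u
    unfolding h_def
  proof (rule cINF_greatest[OF False])
    fix x assume "x \<in> topspace X"
    then show "- B \<le> g x + real k * dist u (\<Psi> x)"
      using bdd[of x] by (smt (verit) mult_nonneg_nonneg zero_le_dist of_nat_0_le_iff)
  qed
  have h_lim: "(\<lambda>k. h k (\<Psi> x)) \<longlonglongrightarrow> g x" if x: "x \<in> topspace X" for x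
  proof (rule tendstoI)
    fix e :: real assume e: "e > 0"
    have "openin X {y \<in> topspace X. g y > g x - e/2}" by (rule lsc)
    from nbhd[OF this, of x] x e obtain d where d: "d > 0"
      and dU: "\<And>y. y \<in> topspace X \<Longrightarrow> dist (\<Psi> y) (\<Psi> x) < d \<Longrightarrow> g y > g x - e/2" by auto
    \<comment> \<open>Outside the ball of radius \<open>d\<close> the penalty
      \<open>k * dist\<close> exceeds \<open>2 * B\<close>, the largest possible oscillation of
      \<open>g\<close>, so only points inside the ball can bring the infimum near or below
      \<open>g x\<close>.\<close>
    obtain K :: nat where K: "real K \<ge> 2 * B / d" using real_arch_simple by blast
    show "eventually (\<lambda>k. dist (h k (\<Psi> x)) (g x) < e) sequentially"
    proof (rule eventually_sequentiallyI[of K])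
      fix k assume "K \<le> k"
      then have k: "real k * d \<ge> 2 * B"
        using K d by (metis mult.commute mult_left_mono of_nat_le_iff order_trans pos_divide_le_eq)
      have "g x - e/2 \<le> h k (\<Psi> x)"
        unfolding h_def
      proof (rule cINF_greatest[OF False])
        fix y assume y: "y \<in> topspace X"
        show "g x - e/2 \<le> g y + real k * dist (\<Psi> x) (\<Psi> y)"
        proof (cases "dist (\<Psi> y) (\<Psi> x) < d")
          case True
          then show ?thesis using dU[OF y True]
            by (smt (verit) mult_nonneg_nonneg zero_le_dist of_nat_0_le_iff)
        next
          case False
          then have "real k * d \<le> real k * dist (\<Psi> x) (\<Psi> y)"
            by (intro mult_left_mono) (auto simp: dist_commute)
          then show ?thesis using bdd[OF x] bdd[OF y] k e by linarith
        qed
      qed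
      then show "dist (h k (\<Psi> x)) (g x) < e"
        using h_le[OF x, of k] e by (simp add: dist_real_def)
    qed
  qed
  have g_int: "integrable M g" if "finite_measure M" "sets M = sets (borel_of X)" for M
    by (rule integrable_bdd[OF that lsc_measurable[OF that(2) lsc] bdd])
  have "(\<lambda>k. \<integral>x. h k (\<Psi> x) \<partial>\<nu>) \<longlonglongrightarrow> (\<integral>x. g x \<partial>\<nu>)"
  proof (rule integral_dominated_convergence[where w="\<lambda>_. B"])
    show "integrable \<nu> (\<lambda>_. B)" using finite_measure.integrable_const[OF fin(2)] by blast
    show "AE x in \<nu>. norm (h k (\<Psi> x)) \<le> B" for k
      using h_ge[of k] order_trans[OF h_le[of _ k] abs_le_D1[OF bdd]]
      by (intro AE_I2) (auto simp: spaces abs_le_iff minus_le_iff)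
    show "(\<lambda>x. h k (\<Psi> x)) \<in> borel_measurable \<nu>" for k
      using integrable_comp[OF fin(2) sets(2) h_cont] by blast
  qed (use g_int fin sets h_lim in \<open>auto simp: spaces\<close>)
  \<comment> \<open>The index \<open>k\<close> is fixed through the limit measure alone; for the
    measures \<open>\<nu>s n\<close> the comparison \<open>h k \<le> g\<close> then
    suffices.\<close>
  then obtain k where k: "(\<integral>x. h k (\<Psi> x) \<partial>\<nu>) > (\<integral>x. g x \<partial>\<nu>) - \<epsilon>"
    using order_tendstoD(1)[of _ "\<integral>x. g x \<partial>\<nu>" sequentially "(\<integral>x. g x \<partial>\<nu>) - \<epsilon>"] \<open>\<epsilon> > 0\<close>
      eventually_happens'[OF sequentially_bot] by (metis (no_types, lifting) diff_less_eq less_add_same_cancel1)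
  have "eventually (\<lambda>n. (\<integral>x. h k (\<Psi> x) \<partial>\<nu>s n) > (\<integral>x. g x \<partial>\<nu>) - \<epsilon>) sequentially"
    using order_tendstoD(1)[OF lim_continuous_cube[OF h_cont] k] .
  then show ?thesis
  proof eventually_elim
    case (elim n)
    also have "(\<integral>x. h k (\<Psi> x) \<partial>\<nu>s n) \<le> (\<integral>x. g x \<partial>\<nu>s n)"
      by (intro integral_mono integrable_comp fin sets h_cont g_int h_le) (simp add: spaces)
    finally show ?case .
  qed
qed

lemma lim_continuous:
  fixes g :: "'a \<Rightarrow> real"
  assumes "continuous_map X euclideanreal g" "\<And>x. x \<in> topspace X \<Longrightarrow> \<bar>g x\<bar> \<le> B"
  shows "(\<lambda>n. \<integral>x. g x \<partial>\<nu>s n) \<longlonglongrightarrow> (\<integral>x. g x \<partial>\<nu>)"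
proof (rule order_tendstoI)
  fix c assume "c < (\<integral>x. g x \<partial>\<nu>)"
  then show "eventually (\<lambda>n. c < (\<integral>x. g x \<partial>\<nu>s n)) sequentially"
    using lsc_liminf[of g B "(\<integral>x. g x \<partial>\<nu>) - c"] assms continuous_map_lsc[OF assms(1)] by simp
next
  fix c assume "(\<integral>x. g x \<partial>\<nu>) < c"
  moreover have "openin X {x \<in> topspace X. - g x > d}" for d
    using continuous_map_usc[OF assms(1), of "-d"] by (simp add: less_minus_iff)
  ultimately show "eventually (\<lambda>n. (\<integral>x. g x \<partial>\<nu>s n) < c) sequentially"
    using lsc_liminf[of "\<lambda>x. - g x" B "c - (\<integral>x. g x \<partial>\<nu>)"] assms by simp
qed

text \<open>The portmanteau theorem with a continuous weight. Since \<open>\<kappa> \<ge> 0\<close>,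
  the weight restricted to the interior of \<open>A\<close> is lower semicontinuous and the weight
  restricted to the closure is upper semicontinuous; both have the same
  \<open>\<nu>\<close>-integral as on \<open>A\<close>, because the frontier is null. In
  \<open>set_limit\<close> the weight cancels a density.\<close>

lemma lim_continuity_set:
  fixes \<kappa> :: "'a \<Rightarrow> real"
  assumes \<kappa>: "continuous_map X euclideanreal \<kappa>" "\<And>x. x \<in> topspace X \<Longrightarrow> 0 \<le> \<kappa> x"
      "\<And>x. x \<in> topspace X \<Longrightarrow> \<kappa> x \<le> B"
    and A: "A \<subseteq> topspace X" "A \<in> sets (borel_of X)" and null: "emeasure \<nu> (X frontier_of A) = 0"
  shows "(\<lambda>n. \<integral>x. indicator A x * \<kappa> x \<partial>\<nu>s n) \<longlonglongrightarrow> (\<integral>x. indicator A x * \<kappa> x \<partial>\<nu>)"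
proof -
  let ?I = "X interior_of A" and ?C = "X closure_of A"
  have IA: "?I \<subseteq> A" and AC: "A \<subseteq> ?C"
    by (simp_all add: interior_of_subset closure_of_subset A)
  have ms: "?I \<in> sets M" "?C \<in> sets M" "A \<in> sets M" "X frontier_of A \<in> sets M" "\<kappa> \<in> borel_measurable M"
    if "sets M = sets (borel_of X)" for M
    using that A continuous_map_measurable[OF that \<kappa>(1)]
    by (auto intro: openin_sets_borel_of closedin_sets_borel_of closedin_frontier_of)
  have AEeq: "AE x in \<nu>. x \<notin> X frontier_of A"
    using null ms(4)[OF sets(2)] by (intro AE_not_in) (auto simp: null_sets_def)
  have int: "integrable M (\<lambda>x. indicator S x * \<kappa> x)"
    if "finite_measure M" "sets M = sets (borel_of X)" "S \<in> sets M" for M S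
    using that ms(5)[OF that(2)] \<kappa>
    by (intro integrable_bdd[where B=B]) (auto simp: indicator_def intro: order_trans)
  have eqI: "(\<integral>x. indicator ?I x * \<kappa> x \<partial>\<nu>) = (\<integral>x. indicator A x * \<kappa> x \<partial>\<nu>)"
    using AEeq IA AC ms[OF sets(2)]
    by (intro integral_cong_AE) (auto simp: frontier_of_def indicator_def)
  have eqC: "(\<integral>x. indicator ?C x * \<kappa> x \<partial>\<nu>) = (\<integral>x. indicator A x * \<kappa> x \<partial>\<nu>)"
    using AEeq IA AC ms[OF sets(2)]
    by (intro integral_cong_AE) (auto simp: frontier_of_def indicator_def)
  have lscI: "openin X {x \<in> topspace X. indicator ?I x * \<kappa> x > c}" for c
  proof (cases "c < 0")
    case True
    then have "{x \<in> topspace X. indicator ?I x * \<kappa> x > c} = topspace X"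
      using \<kappa>(2) by (auto simp: indicator_def intro: less_le_trans)
    then show ?thesis by simp
  next
    case False
    then have "{x \<in> topspace X. indicator ?I x * \<kappa> x > c} = ?I \<inter> {x \<in> topspace X. \<kappa> x > c}"
      by (auto simp: indicator_def split: if_splits)
    then show ?thesis using continuous_map_lsc[OF \<kappa>(1)] by auto
  qed
  have lscC: "openin X {x \<in> topspace X. - (indicator ?C x * \<kappa> x) > c}" for c
  proof (cases "c < 0")
    case True
    then have "{x \<in> topspace X. - (indicator ?C x * \<kappa> x) > c} =
        (topspace X - ?C) \<union> {x \<in> topspace X. \<kappa> x < - c}"
      by (auto simp: indicator_def split: if_splits)
    moreover have "openin X (topspace X - ?C)"
      by (simp add: openin_diff)
    ultimately show ?thesis using openin_Un continuous_map_usc[OF \<kappa>(1)] by metis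
  next
    case False
    then have "{x \<in> topspace X. - (indicator ?C x * \<kappa> x) > c} = {}"
      using \<kappa>(2) by (force simp: indicator_def)
    then show ?thesis by (metis openin_empty)
  qed
  have bd: "\<bar>indicator S x * \<kappa> x\<bar> \<le> B" if "x \<in> topspace X" for S x
    using \<kappa>(2,3)[OF that] by (auto simp: indicator_def)
  show ?thesis
  proof (rule order_tendstoI)
    fix c assume "c < (\<integral>x. indicator A x * \<kappa> x \<partial>\<nu>)"
    then have "eventually (\<lambda>n. c < (\<integral>x. indicator ?I x * \<kappa> x \<partial>\<nu>s n)) sequentially"
      using lsc_liminf[OF lscI bd, of "(\<integral>x. indicator A x * \<kappa> x \<partial>\<nu>) - c"] by (simp add: eqI)
    then show "eventually (\<lambda>n. c < (\<integral>x. indicator A x * \<kappa> x \<partial>\<nu>s n)) sequentially"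
    proof eventually_elim
      case (elim n)
      also have "(\<integral>x. indicator ?I x * \<kappa> x \<partial>\<nu>s n) \<le> (\<integral>x. indicator A x * \<kappa> x \<partial>\<nu>s n)"
        using IA \<kappa> by (intro integral_mono int fin sets ms) (auto simp: indicator_def spaces)
      finally show ?case .
    qed
  next
    fix c assume "(\<integral>x. indicator A x * \<kappa> x \<partial>\<nu>) < c"
    then have "eventually (\<lambda>n. (\<integral>x. indicator ?C x * \<kappa> x \<partial>\<nu>s n) < c) sequentially"
      using lsc_liminf[OF lscC, of B "c - (\<integral>x. indicator A x * \<kappa> x \<partial>\<nu>)"] bd by (simp add: eqC)
    then show "eventually (\<lambda>n. (\<integral>x. indicator A x * \<kappa> x \<partial>\<nu>s n) < c) sequentially"
    proof eventually_elim
      case (elim n)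
      have "(\<integral>x. indicator A x * \<kappa> x \<partial>\<nu>s n) \<le> (\<integral>x. indicator ?C x * \<kappa> x \<partial>\<nu>s n)"
        using AC \<kappa> by (intro integral_mono int fin sets ms) (auto simp: indicator_def spaces)
      with elim show ?case by simp
    qed
  qed
qed

end

section \<open>Continuous functions on the state space\<close>

text \<open>A strictly increasing continuous map of the extended line into \<open>[0,1]\<close>. It
  supplies a real-valued injective function for Stone-Weierstrass and a finite notion of distance
  that also covers \<infinity> and -\<infinity>.\<close>

definition squash :: "ereal \<Rightarrow> real" where
  "squash y = (if y = \<infinity> then 1 else if y = -\<infinity> then 0 else 1/2 + arctan (real_of_ereal y) / pi)"

lemma squash_ereal [simp]: "squash (ereal t) = 1/2 + arctan t / pi"
  and squash_PInf [simp]: "squash \<infinity> = 1"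
  and squash_MInf [simp]: "squash (-\<infinity>) = 0"
  by (simp_all add: squash_def)

lemma squash_ereal_bounds: "0 < squash (ereal t)" "squash (ereal t) < 1"
  using arctan_lbound[of t] arctan_ubound[of t] by (simp_all add: field_simps)

lemma squash_bounds: "0 \<le> squash y" "squash y \<le> 1"
  using squash_ereal_bounds by (cases y; force simp del: squash_ereal simp: less_imp_le)+

lemma squash_strict_mono: "y < z \<Longrightarrow> squash y < squash z"
proof (cases y; cases z)
  fix s t assume "y < z" "y = ereal s" "z = ereal t"
  then show ?thesis using arctan_monotone[of s t] by (simp add: divide_strict_right_mono)
qed (use squash_ereal_bounds in \<open>auto simp del: squash_ereal\<close>)

lemma squash_less_iff: "squash y < squash z \<longleftrightarrow> y < z"
  using squash_strict_mono by (metis less_asym linorder_less_linear)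

lemma squash_le_iff: "squash y \<le> squash z \<longleftrightarrow> y \<le> z"
  using squash_less_iff by (metis linorder_not_le)

lemma squash_eq_iff: "squash y = squash z \<longleftrightarrow> y = z"
  by (metis squash_le_iff antisym order_refl)

lemma continuous_on_squash: "continuous_on S squash"
proof -
  have at_real: "isCont squash (ereal t)" for t
  proof -
    have "((\<lambda>s. squash (ereal s)) \<longlongrightarrow> squash (ereal t)) (at t)"
      unfolding squash_ereal by (intro tendsto_intros) simp
    then show ?thesis
      unfolding isCont_def by (simp add: at_ereal filterlim_filtermap)
  qed
  have "((\<lambda>s. squash (ereal s)) \<longlongrightarrow> 1/2 + (pi/2) / pi) at_top"
    unfolding squash_ereal by (intro tendsto_intros tendsto_arctan_at_top) simp
  then have PInf: "isCont squash \<infinity>"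
    unfolding isCont_def by (simp add: at_infty_ereal_eq_at_top filterlim_filtermap)
  have "((\<lambda>s. squash (ereal s)) \<longlongrightarrow> 1/2 + (-(pi/2)) / pi) at_bot"
    unfolding squash_ereal by (intro tendsto_intros tendsto_arctan_at_bot) simp
  then have "(squash \<longlongrightarrow> squash (-\<infinity>)) (at_right (-\<infinity>))"
    by (simp add: at_right_MInf filterlim_filtermap)
  \<comment> \<open>No point lies below -\<infinity>, so only the right limit has to be checked
    there.\<close>
  moreover have "at_left (-\<infinity> :: ereal) = bot"
    using trivial_limit_at_left_bot[where 'a=ereal] by (simp add: bot_ereal_def)
  ultimately have "(squash \<longlongrightarrow> squash (-\<infinity>)) (at (-\<infinity>))"
    by (simp only: at_eq_sup_left_right[of "-\<infinity>"] sup_bot_left)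
  then have "isCont squash (-\<infinity>)"
    by (simp only: isCont_def)
  with PInf have "isCont squash y" for y
    using at_real by (cases y) auto
  then show ?thesis by (simp add: continuous_at_imp_continuous_on)
qed

text \<open>The ramp is linear on the \<open>squash\<close> scale, so infinite \<open>y\<close> need
  no separate case.\<close>

definition cutoff :: "ereal \<Rightarrow> ereal \<Rightarrow> ereal \<Rightarrow> real" where
  "cutoff s t y = min 1 (max 0 ((squash \<bar>y\<bar> - squash s) / (squash t - squash s)))"

lemma continuous_on_abs_ereal: "continuous_on S (\<lambda>y::ereal. \<bar>y\<bar>)"
proof -
  have "(\<lambda>y::ereal. \<bar>y\<bar>) = (\<lambda>y. max y (- y))"
  proof
    show "\<bar>y\<bar> = max y (- y)" for y :: ereal
      by (cases y) (auto simp: max_def)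
  qed
  then show ?thesis by (auto intro!: continuous_intros)
qed

lemma continuous_on_squash_abs: "continuous_on S (\<lambda>y. squash \<bar>y\<bar>)"
  using continuous_on_compose2[OF continuous_on_squash continuous_on_abs_ereal subset_UNIV] .

lemma continuous_on_cutoff: "s < t \<Longrightarrow> continuous_on S (cutoff s t)"
  unfolding cutoff_def using squash_strict_mono[of s t]
  by (auto intro!: continuous_intros continuous_on_squash_abs)

lemma cutoff_bounds: "0 \<le> cutoff s t y" "cutoff s t y \<le> 1"
  by (auto simp: cutoff_def)

lemma cutoff_0: "s < t \<Longrightarrow> cutoff s t y = 0 \<longleftrightarrow> \<bar>y\<bar> \<le> s"
  using squash_strict_mono[of s t] squash_le_iff[of "\<bar>y\<bar>" s]
  by (auto simp: cutoff_def min_def max_def field_simps split: if_splits)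

lemma cutoff_1: "s < t \<Longrightarrow> cutoff s t y = 1 \<longleftrightarrow> t \<le> \<bar>y\<bar>"
  using squash_strict_mono[of s t] squash_le_iff[of t "\<bar>y\<bar>"]
  by (auto simp: cutoff_def min_def max_def field_simps split: if_splits)

section \<open>State spaces in which compactness means distance from zero\<close>

text \<open>These two properties carry everything that the vague-topology arguments use about the
  shape of \<open>E\<close>: the one-sided and two-sided spaces, with finite or infinite endpoint,
  are treated at once.\<close>

locale punctured =
  fixes E :: "ereal set"
  assumes zero_notin: "0 \<notin> E"
    and compact_far: "\<And>x::real. 0 < x \<Longrightarrow> compact {y \<in> E. ereal x \<le> \<bar>y\<bar>}"
begin

abbreviation far :: "real \<Rightarrow> ereal set" where
  "far x \<equiv> {y \<in> E. ereal x \<le> \<bar>y\<bar>}"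

lemma pos_abs: "y \<in> E \<Longrightarrow> 0 < \<bar>y\<bar>"
  using zero_notin by (cases y) (auto simp: zero_ereal_def)

lemma E_Union_far: "E = (\<Union>n. far (1 / Suc n))"
proof (intro equalityI subsetI)
  fix y assume y: "y \<in> E"
  obtain t where t: "0 < t" "ereal t < \<bar>y\<bar>"
    using ereal_dense2[OF pos_abs[OF y]] by (metis ereal_less(2))
  then obtain n where "inverse (Suc n) < t" using reals_Archimedean by blast
  then have "ereal (1 / Suc n) \<le> \<bar>y\<bar>"
    using t(2) by (metis ereal_less_eq(3) inverse_eq_divide less_imp_le order_trans)
  then show "y \<in> (\<Union>n. far (1 / Suc n))" using y by blast
qed auto

lemma E_borel [measurable]: "E \<in> sets borel"
proof -
  have "(\<Union>n. far (1 / Suc n)) \<in> sets borel"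
    using compact_far by (intro sets.countable_UN) (auto intro: borel_compact)
  then show ?thesis using E_Union_far by simp
qed

lemma space_borel_on [simp]: "space (borel_on E) = E"
  by (simp add: space_restrict_space)

lemma sets_borel_on: "B \<in> sets (borel_on E) \<longleftrightarrow> B \<subseteq> E \<and> B \<in> sets borel"
  by (auto simp: sets_restrict_space_iff)

lemma compact_sets: "compact K \<Longrightarrow> K \<subseteq> E \<Longrightarrow> K \<in> sets (borel_on E)"
  by (auto simp: sets_borel_on intro: borel_compact)

lemma compact_far_bound:
  assumes K: "compact K" "K \<subseteq> E"
  obtains x where "0 < x" "K \<subseteq> far x"
proof (cases "K = {}")
  case True
  then show thesis using that[of 1] by simp
next
  case False
  then obtain y where y: "y \<in> K" "\<And>z. z \<in> K \<Longrightarrow> \<bar>y\<bar> \<le> \<bar>z\<bar>"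
    using continuous_attains_inf[OF K(1) False continuous_on_abs_ereal] by blast
  obtain t where t: "0 < t" "ereal t < \<bar>y\<bar>"
    using ereal_dense2[OF pos_abs, of y] y(1) K(2) by (metis ereal_less(2) subsetD)
  show thesis
    using t y K(2) by (intro that[of t]) (auto intro: less_imp_le less_le_trans)
qed

lemma CK_plus_iff:
  "f \<in> CK_plus E \<longleftrightarrow> continuous_on E f \<and> (\<forall>y\<in>E. 0 \<le> f y) \<and>
    (\<exists>x>0. \<forall>y\<in>E. f y \<noteq> 0 \<longrightarrow> ereal x \<le> \<bar>y\<bar>)"
proof -
  let ?S = "{y \<in> E. f y \<noteq> 0}"
  have "compact ((top_of_set E) closure_of ?S)" if "x > 0" "\<forall>y\<in>E. f y \<noteq> 0 \<longrightarrow> ereal x \<le> \<bar>y\<bar>" for x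
  proof -
    have c: "compact (far x)" using compact_far[OF that(1)] .
    have "closedin (top_of_set E) (far x)"
      using c by (intro closed_subset compact_imp_closed) auto
    then have "(top_of_set E) closure_of ?S \<subseteq> far x"
      using that(2) by (intro closure_of_minimal) auto
    then have "closedin (top_of_set (far x)) ((top_of_set E) closure_of ?S)"
      by (intro closedin_subset_trans[OF closedin_closure_of]) auto
    then show ?thesis using closedin_compact[OF c] by blast
  qed
  moreover have "\<exists>x>0. \<forall>y\<in>E. f y \<noteq> 0 \<longrightarrow> ereal x \<le> \<bar>y\<bar>"
    if "compact ((top_of_set E) closure_of ?S)"
  proof -
    have "(top_of_set E) closure_of ?S \<subseteq> E"
      using closure_of_subset_topspace[of "top_of_set E" ?S] by simp
    from compact_far_bound[OF that this] obtain x where x: "0 < x" "(top_of_set E) closure_of ?S \<subseteq> far x" .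
    moreover have "?S \<subseteq> (top_of_set E) closure_of ?S" by (intro closure_of_subset) auto
    ultimately show ?thesis by blast
  qed
  ultimately show ?thesis unfolding CK_plus_def by blast
qed

lemma compact_relcompact: "compact K \<Longrightarrow> K \<subseteq> E \<Longrightarrow> K \<in> relcompact_borel E"
proof -
  assume K: "compact K" "K \<subseteq> E"
  then have "closedin (top_of_set E) K" by (intro closed_subset compact_imp_closed)
  then show ?thesis using K by (simp add: relcompact_borel_def compact_sets closure_of_eq[THEN iffD2])
qed

lemma CK_plus_nonneg: "f \<in> CK_plus E \<Longrightarrow> y \<in> E \<Longrightarrow> 0 \<le> f y"
  by (simp add: CK_plus_iff)

lemma CK_plus_measurable: "f \<in> CK_plus E \<Longrightarrow> f \<in> borel_measurable (borel_on E)"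
  by (simp add: CK_plus_iff borel_measurable_continuous_on_restrict)



lemma CK_plus_mult:
  "f \<in> CK_plus E \<Longrightarrow> continuous_on E h \<Longrightarrow> (\<And>y. y \<in> E \<Longrightarrow> 0 \<le> h y) \<Longrightarrow> (\<lambda>y. f y * h y) \<in> CK_plus E"
  unfolding CK_plus_iff by (auto intro!: continuous_intros)

lemma CK_plus_add: 
  assumes "f \<in> CK_plus E" "g \<in> CK_plus E"
  shows "(\<lambda>y. f y + g y) \<in> CK_plus E"
proof -
  from assms obtain s t where st: "s > 0" "t > 0" "\<forall>y\<in>E. f y \<noteq> 0 \<longrightarrow> ereal s \<le> \<bar>y\<bar>"
    "\<forall>y\<in>E. g y \<noteq> 0 \<longrightarrow> ereal t \<le> \<bar>y\<bar>"
    unfolding CK_plus_iff by blast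
  have "ereal (min s t) \<le> \<bar>y\<bar>" if "y \<in> E" "f y + g y \<noteq> 0" for y
  proof (cases "f y = 0")
    case True
    then have "ereal t \<le> \<bar>y\<bar>" using that st by auto
    then show ?thesis by (metis ereal_less_eq(3) min.cobounded2 order_trans)
  next
    case False
    then have "ereal s \<le> \<bar>y\<bar>" using that st by auto
    then show ?thesis by (metis ereal_less_eq(3) min.cobounded1 order_trans)
  qed
  moreover have "min s t > 0" using st by simp
  ultimately have "\<exists>x>0. \<forall>y\<in>E. f y + g y \<noteq> 0 \<longrightarrow> ereal x \<le> \<bar>y\<bar>" by blast
  then show ?thesis using assms unfolding CK_plus_iff
    by (auto intro!: continuous_intros)
qed

lemma CK_plus_zero: "(\<lambda>_. 0) \<in> CK_plus E"
  unfolding CK_plus_iff by (auto intro!: exI[of _ 1])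

lemma CK_plus_sum_list:
  "(\<And>i. i \<in> set l \<Longrightarrow> h i \<in> CK_plus E) \<Longrightarrow> (\<lambda>y. \<Sum>i\<leftarrow>l. h i y) \<in> CK_plus E"
  by (induction l) (auto intro: CK_plus_add CK_plus_zero)

lemma cutoff_CK_plus: "0 < s \<Longrightarrow> s < t \<Longrightarrow> cutoff (ereal s) (ereal t) \<in> CK_plus E"
  unfolding CK_plus_iff by (auto intro!: exI[of _ s] continuous_on_cutoff simp: cutoff_0 cutoff_bounds)

text \<open>A countable exhaustion: every compact subset of \<open>E\<close> lies in the plateau of
  some \<open>bump m\<close>, which is what makes a countable family of test functions
  possible.\<close>

definition bump :: "nat \<Rightarrow> ereal \<Rightarrow> real" where
  "bump m = cutoff (ereal (1 / Suc (Suc m))) (ereal (1 / Suc m))"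

lemma bump_less: "1 / real (Suc (Suc m)) < 1 / real (Suc m)"
  by (simp add: field_simps)

lemma bump_CK_plus: "bump m \<in> CK_plus E"
  unfolding bump_def by (rule cutoff_CK_plus[OF _ bump_less]) simp

lemma bump_bounds: "0 \<le> bump m y" "bump m y \<le> 1"
  by (simp_all add: bump_def cutoff_bounds)

lemma bump_eq_1: "ereal (1 / Suc m) \<le> \<bar>y\<bar> \<Longrightarrow> bump m y = 1"
  unfolding bump_def using bump_less[of m] by (subst cutoff_1) simp_all

lemma bump_nonzero: "bump m y \<noteq> 0 \<Longrightarrow> ereal (1 / Suc (Suc m)) \<le> \<bar>y\<bar>"
  unfolding bump_def using bump_less[of m] by (subst (asm) cutoff_0) simp_all

lemma bump_1_far:
  assumes "0 < x"
  obtains m where "\<And>y. ereal x \<le> \<bar>y\<bar> \<Longrightarrow> bump m y = 1"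
proof -
  obtain m where "inverse (Suc m) < x" using reals_Archimedean[OF assms] by blast
  then have "ereal (1 / Suc m) \<le> \<bar>y\<bar>" if "ereal x \<le> \<bar>y\<bar>" for y
    using that by (metis ereal_less_eq(3) inverse_eq_divide less_imp_le order_trans)
  then show thesis using bump_eq_1 that by blast
qed

lemma CK_plus_bump:
  assumes "f \<in> CK_plus E"
  obtains m where "\<And>y. y \<in> E \<Longrightarrow> f y \<noteq> 0 \<Longrightarrow> bump m y = 1"
  using assms bump_1_far unfolding CK_plus_iff by metis

text \<open>Cutoffs times powers of the injective function \<^const>\<open>squash\<close>: a countable family that
  determines the vague topology.\<close>

definition probe :: "nat \<Rightarrow> ereal \<Rightarrow> real" where
  "probe i y = (case prod_decode i of (m, j) \<Rightarrow> bump m y * squash y ^ j)"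

lemma probe_encode: "probe (prod_encode (m, j)) = (\<lambda>y. bump m y * squash y ^ j)"
  by (simp add: probe_def fun_eq_iff)

lemma probe_CK_plus: "probe i \<in> CK_plus E"
proof -
  obtain m j where "prod_decode i = (m, j)" by fastforce
  moreover have "(\<lambda>y. bump m y * squash y ^ j) \<in> CK_plus E"
    by (intro CK_plus_mult bump_CK_plus) (auto intro!: continuous_intros continuous_on_squash simp: squash_bounds)
  ultimately show ?thesis by (simp add: probe_def[abs_def])
qed

text \<open>Stone-Weierstrass approximates \<open>f\<close> by polynomials in \<open>squash\<close>
  on the compact set carrying \<open>bump m\<close>; multiplying by \<open>bump m\<close> extends
  this to \<open>E\<close>. The error has to be a multiple of \<open>bump m\<close> and not a
  constant, since a point measure may have infinite total mass while it integrates
  \<open>bump m\<close>.\<close>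

lemma probe_dense:
  assumes f: "f \<in> CK_plus E"
  obtains m where "\<And>\<epsilon>. \<epsilon> > 0 \<Longrightarrow> \<exists>(c::nat\<Rightarrow>real) d. \<forall>y\<in>E.
    \<bar>f y - (\<Sum>j\<le>d. c j * probe (prod_encode (m, j)) y)\<bar> \<le> \<epsilon> * bump m y"
proof -
  obtain m where m: "\<And>y. y \<in> E \<Longrightarrow> f y \<noteq> 0 \<Longrightarrow> bump m y = 1"
    using CK_plus_bump[OF f] by blast
  define K where "K = far (1 / Suc (Suc m))"
  have K: "compact K" unfolding K_def by (intro compact_far) simp
  interpret function_ring_on "(\<lambda>p. \<lambda>y. p (squash y)) ` {p :: real \<Rightarrow> real. real_polynomial_function p}" K
  proof
    fix f g assume "f \<in> (\<lambda>p. \<lambda>y. p (squash y)) ` {p :: real \<Rightarrow> real. real_polynomial_function p}"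
      "g \<in> (\<lambda>p. \<lambda>y. p (squash y)) ` {p :: real \<Rightarrow> real. real_polynomial_function p}"
    then obtain p q where "f = (\<lambda>y. p (squash y))" "g = (\<lambda>y. q (squash y))"
      "real_polynomial_function p" "real_polynomial_function q" by auto
    then show "(\<lambda>x. f x + g x) \<in> (\<lambda>p. \<lambda>y. p (squash y)) ` {p :: real \<Rightarrow> real. real_polynomial_function p}"
      "(\<lambda>x. f x * g x) \<in> (\<lambda>p. \<lambda>y. p (squash y)) ` {p :: real \<Rightarrow> real. real_polynomial_function p}"
      by (intro image_eqI[where x="\<lambda>t. p t + q t"] image_eqI[where x="\<lambda>t. p t * q t"];
          simp add: real_polynomial_function.intros)+
  next
    fix x y :: ereal assume "x \<noteq> y"
    then show "\<exists>f\<in>(\<lambda>p. \<lambda>y. p (squash y)) ` {p :: real \<Rightarrow> real. real_polynomial_function p}. f x \<noteq> f y"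
      by (auto intro!: bexI[where x="\<lambda>t. t"] real_polynomial_function.intros bounded_linear_ident simp: squash_eq_iff)
  next
    fix f assume "f \<in> (\<lambda>p. \<lambda>y. p (squash y)) ` {p :: real \<Rightarrow> real. real_polynomial_function p}"
    then obtain p where f: "f = (\<lambda>y. p (squash y))" and "real_polynomial_function p" by auto
    then have "continuous_on UNIV p"
      by (intro continuous_at_imp_continuous_on ballI continuous_real_polymonial_function)
    then show "continuous_on K f"
      unfolding f by (rule continuous_on_compose2[OF _ continuous_on_squash subset_UNIV])
  qed (use K in \<open>auto intro!: image_eqI[where x="\<lambda>_. _"] real_polynomial_function.intros\<close>)
  have "\<exists>(c::nat\<Rightarrow>real) d. \<forall>y\<in>E.
    \<bar>f y - (\<Sum>j\<le>d. c j * probe (prod_encode (m, j)) y)\<bar> \<le> \<epsilon> * bump m y" if "\<epsilon> > 0" for \<epsilon>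
  proof -
    have "continuous_on K f"
      using f continuous_on_subset[of E f K] by (auto simp: CK_plus_iff K_def)
    from Stone_Weierstrass_basic[OF this \<open>\<epsilon> > 0\<close>] obtain p :: "real \<Rightarrow> real"
      where p: "real_polynomial_function p" "\<And>y. y \<in> K \<Longrightarrow> \<bar>f y - p (squash y)\<bar> < \<epsilon>" by auto
    then obtain c d where cd: "p = (\<lambda>t. \<Sum>j\<le>(d::nat). c j * t ^ j)"
      using real_polynomial_function_iff_sum by auto
    have "\<bar>f y - (\<Sum>j\<le>d. c j * probe (prod_encode (m, j)) y)\<bar> \<le> \<epsilon> * bump m y" if y: "y \<in> E" for y
    proof -
      have "(\<Sum>j\<le>d. c j * probe (prod_encode (m, j)) y) = bump m y * p (squash y)"
        by (simp add: probe_encode cd sum_distrib_left mult_ac)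
      \<comment> \<open>The index \<open>m\<close> was chosen so that \<open>bump m\<close> is 1
        wherever \<open>f\<close> is nonzero; multiplying by it leaves \<open>f\<close> unchanged
        but cuts off the polynomial.\<close>
      moreover have "f y = bump m y * f y" using m[OF y] by (cases "f y = 0") auto
      ultimately have eq: "\<bar>f y - (\<Sum>j\<le>d. c j * probe (prod_encode (m, j)) y)\<bar> =
          bump m y * \<bar>f y - p (squash y)\<bar>"
        using bump_bounds[of m y] by (metis abs_mult abs_of_nonneg right_diff_distrib)
      show ?thesis
      proof (cases "bump m y = 0")
        case False
        then have "y \<in> K" using bump_nonzero y by (simp add: K_def)
        from p(2)[OF this] show ?thesis
          unfolding eq using bump_bounds[of m y] mult_left_mono[of "\<bar>f y - p (squash y)\<bar>" \<epsilon> "bump m y"]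
          by (simp add: mult.commute)
      qed (simp add: eq)
    qed
    then show ?thesis by blast
  qed
  then show thesis using that by blast
qed

end

section \<open>Point measures and the vague topology\<close>

lemma borel_Mp_eq: "borel_Mp E = borel_of (vague_topology E)"
  by (simp add: borel_Mp_def borel_of_def topspace_vague_topology)

lemma space_borel_Mp: "space (borel_Mp E) = point_measures E"
  by (simp add: borel_Mp_eq space_borel_of topspace_vague_topology)

lemma CK_integral_continuous:
  assumes "f \<in> CK_plus E"
  shows "continuous_map (vague_topology E) euclideanreal (\<lambda>\<xi>. \<integral>x. f x \<partial>\<xi>)"
  unfolding continuous_map_def
proof (intro conjI allI impI)
  fix U :: "real set" assume "openin euclideanreal U"
  then have "openin (vague_topology E) {\<mu> \<in> point_measures E. (\<integral>x. f x \<partial>\<mu>) \<in> U}"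
    using assms unfolding vague_topology_def by (intro topology_generated_by_Basis) auto
  then show "openin (vague_topology E) {\<xi> \<in> topspace (vague_topology E). (\<integral>x. f x \<partial>\<xi>) \<in> U}"
    by (simp add: topspace_vague_topology)
qed simp

context punctured
begin

lemma PM_sets: "\<xi> \<in> point_measures E \<Longrightarrow> sets \<xi> = sets (borel_on E)"
  by (simp add: point_measures_def radon_measure_on_def)

lemma PM_space: "\<xi> \<in> point_measures E \<Longrightarrow> space \<xi> = E"
  using sets_eq_imp_space_eq[OF PM_sets] by simp

lemma PM_compact:
  assumes "\<xi> \<in> point_measures E" "compact K" "K \<subseteq> E"
  obtains n :: nat where "emeasure \<xi> K = of_nat n" "measure \<xi> K = n"
proof -
  obtain n :: nat where "emeasure \<xi> K = of_nat n"
    using assms compact_relcompact[of K] by (auto simp: point_measures_def)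
  then show thesis
    using that by (simp add: measure_def)
qed

lemma PM_compact_finite:
  "\<xi> \<in> point_measures E \<Longrightarrow> compact K \<Longrightarrow> K \<subseteq> E \<Longrightarrow> emeasure \<xi> K < \<infinity>"
  by (simp add: point_measures_def radon_measure_on_def)

lemma PM_measurable: "\<xi> \<in> point_measures E \<Longrightarrow> f \<in> CK_plus E \<Longrightarrow> f \<in> borel_measurable \<xi>"
  using CK_plus_measurable measurable_cong_sets[OF PM_sets refl] by blast

lemma CK_integrable:
  assumes \<xi>: "\<xi> \<in> point_measures E" and f: "f \<in> CK_plus E"
  shows "integrable \<xi> f"
proof -
  obtain x where x: "x > 0" "\<And>y. y \<in> E \<Longrightarrow> f y \<noteq> 0 \<Longrightarrow> ereal x \<le> \<bar>y\<bar>" and c: "continuous_on E f"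
    using f unfolding CK_plus_iff by blast
  have "compact (f ` far x)"
    by (intro compact_continuous_image compact_far x continuous_on_subset[OF c]) auto
  then obtain B where B: "\<And>y. y \<in> far x \<Longrightarrow> \<bar>f y\<bar> \<le> B"
    using compact_imp_bounded bounded_real by (metis imageI)
  show ?thesis
  proof (rule integrableI_bounded_set[where A="far x" and B=B])
    show "far x \<in> sets \<xi>"
      using PM_sets[OF \<xi>] compact_sets[OF compact_far[OF x(1)]] by auto
    show "emeasure \<xi> (far x) < \<infinity>"
      by (intro PM_compact_finite[OF \<xi>] compact_far x) auto
  qed (use PM_measurable[OF \<xi> f] B x PM_space[OF \<xi>] in auto)
qed

lemma CK_integral_nonneg:
  "\<xi> \<in> point_measures E \<Longrightarrow> f \<in> CK_plus E \<Longrightarrow> 0 \<le> (\<integral>x. f x \<partial>\<xi>)"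
  by (intro integral_nonneg_AE AE_I2) (simp add: PM_space CK_plus_nonneg)

lemma CK_nn_integral:
  assumes "\<xi> \<in> point_measures E" "f \<in> CK_plus E"
  shows "(\<integral>\<^sup>+x. ennreal (f x) \<partial>\<xi>) = ennreal (\<integral>x. f x \<partial>\<xi>)"
  using assms by (intro nn_integral_eq_integral CK_integrable AE_I2) (simp_all add: PM_space CK_plus_nonneg)

lemma CK_exp_neg:
  assumes "\<xi> \<in> point_measures E" "f \<in> CK_plus E"
  shows "exp_neg (\<integral>\<^sup>+x. ennreal (f x) \<partial>\<xi>) = exp (- (\<integral>x. f x \<partial>\<xi>))"
  using assms by (simp add: CK_nn_integral exp_neg_def CK_integral_nonneg)

text \<open>The function \<open>bump m\<close> is itself the probe with exponent 0. Its integrals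
  therefore converge and are eventually below \<open>C\<close>, which turns the pointwise error
  \<open>\<epsilon> * bump m\<close> into a uniform error of the integrals.\<close>

lemma probe_determines:
  assumes \<xi>s: "\<And>n. \<xi>s n \<in> point_measures E" and \<xi>: "\<xi> \<in> point_measures E"
    and lim: "\<And>i. (\<lambda>n. \<integral>x. probe i x \<partial>\<xi>s n) \<longlonglongrightarrow> (\<integral>x. probe i x \<partial>\<xi>)"
    and f: "f \<in> CK_plus E"
  shows "(\<lambda>n. \<integral>x. f x \<partial>\<xi>s n) \<longlonglongrightarrow> (\<integral>x. f x \<partial>\<xi>)"
proof (rule tendstoI)
  fix e :: real assume e: "e > 0"
  obtain m where m: "\<And>\<epsilon>. \<epsilon> > 0 \<Longrightarrow> \<exists>(c::nat\<Rightarrow>real) d. \<forall>y\<in>E.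
    \<bar>f y - (\<Sum>j\<le>d. c j * probe (prod_encode (m, j)) y)\<bar> \<le> \<epsilon> * bump m y"
    using probe_dense[OF f] by blast
  define C where "C = (\<integral>x. bump m x \<partial>\<xi>) + 1"
  have C: "C > 0" unfolding C_def using CK_integral_nonneg[OF \<xi> bump_CK_plus, of m] by simp
  define \<epsilon> where "\<epsilon> = e / (3 * C)"
  have "\<epsilon> > 0" unfolding \<epsilon>_def using e C by simp
  from m[OF this] obtain c :: "nat \<Rightarrow> real" and d where cd: "\<And>y. y \<in> E \<Longrightarrow>
    \<bar>f y - (\<Sum>j\<le>d. c j * probe (prod_encode (m, j)) y)\<bar> \<le> \<epsilon> * bump m y" by blast
  let ?S = "\<lambda>\<eta>. \<Sum>j\<le>d. c j * (\<integral>x. probe (prod_encode (m, j)) x \<partial>\<eta>)"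
  have near: "\<bar>(\<integral>x. f x \<partial>\<eta>) - ?S \<eta>\<bar> \<le> e / 3"
    if \<eta>: "\<eta> \<in> point_measures E" and b: "(\<integral>x. bump m x \<partial>\<eta>) \<le> C" for \<eta>
  proof -
    note ints = CK_integrable[OF \<eta> f] CK_integrable[OF \<eta> probe_CK_plus] CK_integrable[OF \<eta> bump_CK_plus]
    have "?S \<eta> = (\<integral>x. (\<Sum>j\<le>d. c j * probe (prod_encode (m, j)) x) \<partial>\<eta>)"
      using ints by (subst Bochner_Integration.integral_sum) auto
    then have "\<bar>(\<integral>x. f x \<partial>\<eta>) - ?S \<eta>\<bar> = \<bar>\<integral>x. f x - (\<Sum>j\<le>d. c j * probe (prod_encode (m, j)) x) \<partial>\<eta>\<bar>"
      using ints by (subst Bochner_Integration.integral_diff) auto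
    also have "\<dots> \<le> (\<integral>x. \<bar>f x - (\<Sum>j\<le>d. c j * probe (prod_encode (m, j)) x)\<bar> \<partial>\<eta>)"
      by (rule integral_abs_bound)
    also have "\<dots> \<le> (\<integral>x. \<epsilon> * bump m x \<partial>\<eta>)"
      using ints cd by (intro integral_mono) (auto simp: PM_space[OF \<eta>])
    also have "\<dots> = \<epsilon> * (\<integral>x. bump m x \<partial>\<eta>)" by simp
    also have "\<dots> \<le> \<epsilon> * C" using b \<open>\<epsilon> > 0\<close> by simp
    also have "\<dots> = e / 3" using C by (simp add: \<epsilon>_def)
    finally show ?thesis .
  qed
  have b0: "bump m = probe (prod_encode (m, 0))" by (simp add: probe_encode)
  have "eventually (\<lambda>n. (\<integral>x. bump m x \<partial>\<xi>s n) < C) sequentially"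
    unfolding C_def b0 by (rule order_tendstoD(2)[OF lim]) simp
  moreover have "(\<lambda>n. ?S (\<xi>s n)) \<longlonglongrightarrow> ?S \<xi>"
    by (intro tendsto_intros lim)
  then have "eventually (\<lambda>n. dist (?S (\<xi>s n)) (?S \<xi>) < e / 3) sequentially"
    by (rule tendstoD) (use e in simp)
  ultimately show "eventually (\<lambda>n. dist (\<integral>x. f x \<partial>\<xi>s n) (\<integral>x. f x \<partial>\<xi>) < e) sequentially"
  proof eventually_elim
    case (elim n)
    show ?case
      using near[OF \<xi>s, of n] near[OF \<xi>] elim unfolding C_def dist_real_def by linarith
  qed
qed

text \<open>Only \<open>nbhd\<close> has content. If no radius worked for \<open>U\<close>, some
  sequence outside \<open>U\<close> would have images converging to that of \<open>\<xi>\<close>; by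
  \<open>probe_determines\<close> all its test integrals converge, and this forces it into
  \<open>U\<close>. Sequences suffice because the target space is metric.\<close>

sublocale vague: test_family "vague_topology E" "\<lambda>\<xi> i. exp (- (\<integral>x. probe i x \<partial>\<xi>))"
proof
  fix i
  show "continuous_map (vague_topology E) euclideanreal (\<lambda>\<xi>. exp (- (\<integral>x. probe i x \<partial>\<xi>)))"
    using continuous_map_compose[OF CK_integral_continuous[OF probe_CK_plus[of i]], of euclideanreal "\<lambda>t. exp (- t)"]
    by (simp add: o_def continuous_intros)
next
  fix \<xi> i assume "\<xi> \<in> topspace (vague_topology E)"
  then show "exp (- (\<integral>x. probe i x \<partial>\<xi>)) \<in> {0..1}"
    using CK_integral_nonneg[OF _ probe_CK_plus] by (simp add: topspace_vague_topology)
next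
  fix U \<xi> assume U: "openin (vague_topology E) U" and \<xi>: "\<xi> \<in> U"
  let ?\<Psi> = "\<lambda>\<xi> i. exp (- (\<integral>x. probe i x \<partial>\<xi>))"
  have \<xi>': "\<xi> \<in> point_measures E"
    using openin_subset[OF U] \<xi> by (auto simp: topspace_vague_topology)
  show "\<exists>\<delta>>0. \<forall>\<eta>\<in>topspace (vague_topology E). dist (?\<Psi> \<eta>) (?\<Psi> \<xi>) < \<delta> \<longrightarrow> \<eta> \<in> U"
  proof (rule ccontr)
    assume "\<not> ?thesis"
    then have H: "\<exists>\<eta>. \<eta> \<in> point_measures E \<and> dist (?\<Psi> \<eta>) (?\<Psi> \<xi>) < \<delta> \<and> \<eta> \<notin> U" if "\<delta> > 0" for \<delta>
      using that by (force simp: topspace_vague_topology)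
    have "\<forall>n. \<exists>\<eta>. \<eta> \<in> point_measures E \<and> dist (?\<Psi> \<eta>) (?\<Psi> \<xi>) < inverse (Suc n) \<and> \<eta> \<notin> U"
      by (intro allI H) simp
    then obtain \<xi>s where \<xi>s: "\<And>n. \<xi>s n \<in> point_measures E" "\<And>n. \<xi>s n \<notin> U"
      "\<And>n. dist (?\<Psi> (\<xi>s n)) (?\<Psi> \<xi>) < inverse (Suc n)" by metis
    have "(\<lambda>n. ?\<Psi> (\<xi>s n)) \<longlonglongrightarrow> ?\<Psi> \<xi>"
      by (rule metric_tendsto_imp_tendsto[OF LIMSEQ_inverse_real_of_nat])
        (use \<xi>s(3) in \<open>auto simp: less_imp_le intro!: always_eventually\<close>)
    then have "(\<lambda>n. ?\<Psi> (\<xi>s n) i) \<longlonglongrightarrow> ?\<Psi> \<xi> i" for i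
      using continuous_on_tendsto_compose[OF continuous_on_product_coordinates[of i], of "\<lambda>n. ?\<Psi> (\<xi>s n)" "?\<Psi> \<xi>"] by simp
    then have "(\<lambda>n. - ln (?\<Psi> (\<xi>s n) i)) \<longlonglongrightarrow> - ln (?\<Psi> \<xi> i)" for i
      by (intro tendsto_minus tendsto_ln) auto
    then have "(\<lambda>n. \<integral>x. probe i x \<partial>\<xi>s n) \<longlonglongrightarrow> (\<integral>x. probe i x \<partial>\<xi>)" for i
      by simp
    from probe_determines[OF \<xi>s(1) \<xi>' this]
    have lim: "(\<lambda>n. \<integral>x. f x \<partial>\<xi>s n) \<longlonglongrightarrow> (\<integral>x. f x \<partial>\<xi>)" if "f \<in> CK_plus E" for f
      using that by blast
    \<comment> \<open>The vague topology is given by a subbase only, so entering \<open>U\<close> is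
      proved by induction on how \<open>U\<close> is generated.\<close>
    have "generate_topology_on {{\<mu> \<in> point_measures E. (\<integral>x. f x \<partial>\<mu>) \<in> U} | f U. f \<in> CK_plus E \<and> open (U :: real set)} U"
      using U unfolding vague_topology_def openin_topology_generated_by_iff .
    then have "\<xi> \<in> U \<longrightarrow> eventually (\<lambda>n. \<xi>s n \<in> U) sequentially"
    proof induction
      case (UN \<K>)
      show ?case
      proof
        assume "\<xi> \<in> \<Union>\<K>"
        then obtain k where "k \<in> \<K>" "\<xi> \<in> k" by blast
        with UN.IH have "eventually (\<lambda>n. \<xi>s n \<in> k) sequentially" by blast
        then show "eventually (\<lambda>n. \<xi>s n \<in> \<Union>\<K>) sequentially"
          by (rule eventually_mono) (use \<open>k \<in> \<K>\<close> in blast)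
      qed
    next
      case (Basis S)
      then obtain f V where "S = {\<mu> \<in> point_measures E. (\<integral>x. f x \<partial>\<mu>) \<in> V}" "f \<in> CK_plus E" "open (V :: real set)"
        by blast
      then show ?case using topological_tendstoD[OF lim, of f V] \<xi>s(1) by simp
    qed (auto intro: eventually_conj)
    then show False using \<xi> \<xi>s(2) by simp
  qed
qed

lemma exp_integral_continuous:
  assumes "f \<in> CK_plus E"
  shows "continuous_map (vague_topology E) euclideanreal (\<lambda>\<xi>. exp (- (\<integral>x. f x \<partial>\<xi>)))"
  using continuous_map_compose[OF CK_integral_continuous[OF assms], of euclideanreal "\<lambda>t. exp (- t)"]
  by (simp add: o_def continuous_intros)

lemma CK_integral_measurable:
  "f \<in> CK_plus E \<Longrightarrow> (\<lambda>\<xi>. \<integral>x. f x \<partial>\<xi>) \<in> borel_measurable (borel_Mp E)"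
  by (intro continuous_map_measurable[OF _ CK_integral_continuous]) (simp add: borel_Mp_eq)

lemma measurable_borel_Mp:
  assumes "\<And>\<omega>. \<omega> \<in> space M \<Longrightarrow> Y \<omega> \<in> point_measures E"
    "\<And>f. f \<in> CK_plus E \<Longrightarrow> (\<lambda>\<omega>. \<integral>x. f x \<partial>Y \<omega>) \<in> borel_measurable M"
  shows "Y \<in> measurable M (borel_Mp E)"
  unfolding borel_Mp_eq
  using assms(1) assms(2)[OF probe_CK_plus]
  by (intro vague.measurable_into_borel_of) (auto simp: topspace_vague_topology)

lemma integral_CK_sum_list:
  assumes "\<xi> \<in> point_measures E" "\<And>i. i \<in> set l \<Longrightarrow> h i \<in> CK_plus E"
  shows "(\<integral>x. (\<Sum>i\<leftarrow>l. h i x) \<partial>\<xi>) = (\<Sum>i\<leftarrow>l. \<integral>x. h i x \<partial>\<xi>)"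
  using assms(2)
proof (induction l)
  case (Cons a l)
  then show ?case
    using CK_integrable[OF assms(1) Cons.prems] CK_integrable[OF assms(1) CK_plus_sum_list[of l h]] by simp
qed simp

lemma prod_list_probe:
  assumes "\<xi> \<in> point_measures E"
  shows "prod_list (map (\<lambda>i. exp (- (\<integral>x. probe i x \<partial>\<xi>))) l) = exp (- (\<integral>x. (\<Sum>i\<leftarrow>l. probe i x) \<partial>\<xi>))"
proof (subst integral_CK_sum_list[OF assms probe_CK_plus], induction l)
  case (Cons a l)
  then show ?case by (simp add: mult_exp_exp)
qed simp

text \<open>On a compact set the approximating functions are \<open>\<ge> 1\<close>, so integer-valuedness turns
  \<open>\<xi>(f n) < 1\<close> into \<open>\<xi>(K) = 0\<close>.\<close>

lemma compact_approx:
  assumes K: "compact K" "K \<subseteq> E"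
  obtains f where "\<forall>n::nat. f n \<in> CK_plus E"
    "\<forall>\<xi>\<in>point_measures E. (\<lambda>n. \<integral>x. f n x \<partial>\<xi>) \<longlonglongrightarrow> measure \<xi> K"
    "\<forall>\<xi>\<in>point_measures E. \<forall>n. measure \<xi> K \<le> (\<integral>x. f n x \<partial>\<xi>)"
proof (cases "K = {}")
  \<comment> \<open>\<open>infdist\<close> to the empty set is 0 by convention, so the construction
    below would not vanish away from \<open>K\<close>.\<close>
  case True
  show thesis
    by (rule that[of "\<lambda>_ _. 0"]) (simp_all add: True CK_plus_zero)
next
  case False
  obtain s where s: "s > 0" "K \<subseteq> far s" using compact_far_bound[OF K] .
  obtain m where m: "\<And>y. ereal s \<le> \<bar>y\<bar> \<Longrightarrow> bump m y = 1" using bump_1_far[OF s(1)] by blast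
  \<comment> \<open>Distances are taken between \<open>squash\<close> images and are finite even at
    infinite points. The functions \<open>f n\<close> equal 1 on \<open>K\<close> and decrease to
    its indicator, dominated by the integrable \<open>bump m\<close>.\<close>
  define d where "d y = infdist (squash y) (squash ` K)" for y
  define f where "f n y = bump m y * max 0 (1 - real n * d y)" for n y
  have d_cont: "continuous_on E d"
    unfolding d_def by (intro continuous_on_infdist continuous_on_squash)
  have "closed (squash ` K)"
    by (intro compact_imp_closed compact_continuous_image continuous_on_squash K)
  then have d0: "d y = 0 \<longleftrightarrow> y \<in> K" for y
    unfolding d_def using False in_closed_iff_infdist_zero[of "squash ` K" "squash y"]
    by (auto simp: squash_eq_iff)
  have d_nn: "d y \<ge> 0" for y unfolding d_def by (rule infdist_nonneg)
  have fCK: "f n \<in> CK_plus E" for n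
    unfolding f_def[abs_def] by (intro CK_plus_mult bump_CK_plus) (auto intro!: continuous_intros d_cont)
  have f1: "f n y = 1" if "y \<in> K" for n y
    using that s m[of y] d0[of y] by (auto simp: f_def)
  have f_lim: "(\<lambda>n. f n y) \<longlonglongrightarrow> indicator K y" for y
  proof (cases "y \<in> K")
    case True
    then show ?thesis by (simp add: f1)
  next
    case False
    then have "d y > 0" using d0 d_nn by (simp add: order_less_le)
    then obtain n0 :: nat where n0: "1 / d y \<le> n0" using real_arch_simple by blast
    have "f n y = 0" if "n0 \<le> n" for n
    proof -
      have "1 / d y \<le> n" using n0 that by linarith
      then have "1 \<le> real n * d y" using \<open>d y > 0\<close> by (simp add: field_simps)
      then show ?thesis by (simp add: f_def)
    qed
    then have "eventually (\<lambda>n. f n y = 0) sequentially"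
      by (auto simp: eventually_sequentially)
    then show ?thesis using False by (simp add: tendsto_eventually)
  qed
  show thesis
  proof (rule that[of f]; intro allI ballI fCK)
    fix \<xi> assume \<xi>: "\<xi> \<in> point_measures E"
    have Ks: "K \<in> sets \<xi>" using PM_sets[OF \<xi>] compact_sets[OF K] by simp
    have "(\<lambda>n. \<integral>x. f n x \<partial>\<xi>) \<longlonglongrightarrow> (\<integral>x. indicator K x \<partial>\<xi>)"
    proof (rule integral_dominated_convergence[where w="bump m"])
      show "AE x in \<xi>. norm (f n x) \<le> bump m x" for n
        using bump_bounds d_nn by (auto simp: f_def abs_mult max_def intro!: AE_I2 mult_left_le)
    qed (use Ks f_lim PM_measurable[OF \<xi> fCK] CK_integrable[OF \<xi> bump_CK_plus] in auto)
    then show "(\<lambda>n. \<integral>x. f n x \<partial>\<xi>) \<longlonglongrightarrow> measure \<xi> K"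
      using Ks by simp
  next
    fix \<xi> n assume \<xi>: "\<xi> \<in> point_measures E"
    have Ks: "K \<in> sets \<xi>" using PM_sets[OF \<xi>] compact_sets[OF K] by simp
    have Kfin: "emeasure \<xi> K < \<infinity>" by (rule PM_compact_finite[OF \<xi> K])
    show "measure \<xi> K \<le> (\<integral>x. f n x \<partial>\<xi>)"
    proof -
      have "(\<integral>x. indicator K x \<partial>\<xi>) \<le> (\<integral>x. f n x \<partial>\<xi>)"
        using CK_integrable[OF \<xi> fCK] Ks Kfin f1 CK_plus_nonneg[OF fCK]
        by (intro integral_mono integrable_real_indicator) (auto simp: indicator_def PM_space[OF \<xi>])
      then show ?thesis using Ks by simp
    qed
  qed
qed

text \<open>The mass of a compact set is in general not vaguely continuous, but it is a pointwise
  limit of continuous functionals.\<close>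

lemma measure_compact_measurable:
  assumes "compact K" "K \<subseteq> E"
  shows "(\<lambda>\<xi>. measure \<xi> K) \<in> borel_measurable (borel_Mp E)"
proof -
  obtain f where f: "\<forall>n::nat. f n \<in> CK_plus E"
    "\<forall>\<xi>\<in>point_measures E. (\<lambda>n. \<integral>x. f n x \<partial>\<xi>) \<longlonglongrightarrow> measure \<xi> K"
    "\<forall>\<xi>\<in>point_measures E. \<forall>n. measure \<xi> K \<le> (\<integral>x. f n x \<partial>\<xi>)"
    by (rule compact_approx[OF assms])
  show ?thesis
  proof (rule borel_measurable_LIMSEQ_real)
    show "(\<lambda>n. \<integral>x. f n x \<partial>\<xi>) \<longlonglongrightarrow> measure \<xi> K" if "\<xi> \<in> space (borel_Mp E)" for \<xi>
      using that f(2) by (simp add: space_borel_Mp)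
    show "(\<lambda>\<xi>. \<integral>x. f n x \<partial>\<xi>) \<in> borel_measurable (borel_Mp E)" for n
      using f(1) by (intro CK_integral_measurable) blast
  qed
qed

lemma emeasure_compact:
  assumes "\<xi> \<in> point_measures E" "compact K" "K \<subseteq> E"
  shows "emeasure \<xi> K = ennreal (measure \<xi> K)"
  using PM_compact_finite[OF assms] by (simp add: emeasure_eq_ennreal_measure)

lemma measure_compact_lt_1:
  assumes "\<xi> \<in> point_measures E" "compact K" "K \<subseteq> E" "measure \<xi> K < 1"
  shows "measure \<xi> K = 0"
proof -
  obtain n :: nat where "measure \<xi> K = n" using PM_compact[OF assms(1-3)] by blast
  then show ?thesis using assms(4) by simp
qed

lemma openin_void:
  assumes K: "compact K" "K \<subseteq> E"
  shows "openin (vague_topology E) {\<xi> \<in> point_measures E. emeasure \<xi> K = 0}"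
proof -
  obtain f where f: "\<forall>n::nat. f n \<in> CK_plus E"
    "\<forall>\<xi>\<in>point_measures E. (\<lambda>n. \<integral>x. f n x \<partial>\<xi>) \<longlonglongrightarrow> measure \<xi> K"
    "\<forall>\<xi>\<in>point_measures E. \<forall>n. measure \<xi> K \<le> (\<integral>x. f n x \<partial>\<xi>)"
    by (rule compact_approx[OF K])
  have "{\<xi> \<in> point_measures E. emeasure \<xi> K = 0} =
      (\<Union>n. {\<xi> \<in> topspace (vague_topology E). (\<integral>x. f n x \<partial>\<xi>) < 1})"
  proof (intro equalityI subsetI)
    fix \<xi> assume "\<xi> \<in> {\<xi> \<in> point_measures E. emeasure \<xi> K = 0}"
    then have \<xi>: "\<xi> \<in> point_measures E" and "measure \<xi> K = 0" by (auto simp: measure_def)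
    with bspec[OF f(2) \<xi>] have "eventually (\<lambda>n. (\<integral>x. f n x \<partial>\<xi>) < 1) sequentially"
      using order_tendstoD(2) by fastforce
    then obtain n where "(\<integral>x. f n x \<partial>\<xi>) < 1" using eventually_happens'[OF sequentially_bot] by blast
    then show "\<xi> \<in> (\<Union>n. {\<xi> \<in> topspace (vague_topology E). (\<integral>x. f n x \<partial>\<xi>) < 1})"
      using \<xi> by (auto simp: topspace_vague_topology)
  next
    fix \<xi> assume "\<xi> \<in> (\<Union>n. {\<xi> \<in> topspace (vague_topology E). (\<integral>x. f n x \<partial>\<xi>) < 1})"
    then obtain n where \<xi>: "\<xi> \<in> point_measures E" and "(\<integral>x. f n x \<partial>\<xi>) < 1"
      by (auto simp: topspace_vague_topology)
    then have "measure \<xi> K < 1" using bspec[OF f(3) \<xi>] by (meson le_less_trans)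
    then have "measure \<xi> K = 0" using measure_compact_lt_1[OF \<xi> K] by simp
    then show "\<xi> \<in> {\<xi> \<in> point_measures E. emeasure \<xi> K = 0}"
      using \<xi> emeasure_compact[OF \<xi> K] by simp
  qed
  moreover have "openin (vague_topology E) {\<xi> \<in> topspace (vague_topology E). (\<integral>x. f n x \<partial>\<xi>) < 1}" for n
    by (intro continuous_map_usc CK_integral_continuous f(1)[rule_format])
  ultimately show ?thesis by auto
qed

section \<open>Measures charging the region beyond a radius\<close>

text \<open>A continuous function that is positive exactly beyond \<open>x\<close>; through it
  \<open>pms_beyond E x\<close> becomes a strict superlevel set of one vaguely continuous
  functional, hence open.\<close>

definition excess :: "real \<Rightarrow> ereal \<Rightarrow> real" where
  "excess x y = max 0 (squash \<bar>y\<bar> - squash (ereal x))"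

lemma excess_pos: "0 < excess x y \<longleftrightarrow> ereal x < \<bar>y\<bar>"
  using squash_less_iff[of "ereal x" "\<bar>y\<bar>"] by (auto simp: excess_def)

lemma excess_nonneg: "0 \<le> excess x y"
  by (simp add: excess_def)

lemma excess_CK_plus: "0 < x \<Longrightarrow> excess x \<in> CK_plus E"
  unfolding CK_plus_iff
proof (intro conjI exI[of _ x])
  show "continuous_on E (excess x)"
    unfolding excess_def[abs_def] by (intro continuous_intros continuous_on_squash_abs)
  show "\<forall>y\<in>E. excess x y \<noteq> 0 \<longrightarrow> ereal x \<le> \<bar>y\<bar>"
    using excess_pos[of x] excess_nonneg[of x] by (metis order_less_le less_imp_le)
qed (auto simp: excess_def)

lemma beyond_sets: "{y \<in> E. \<bar>y\<bar> > ereal x} \<in> sets (borel_on E)"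
proof -
  have "open {y :: ereal. ereal x < \<bar>y\<bar>}"
    by (intro open_Collect_less continuous_on_const continuous_on_abs_ereal)
  then have "{y :: ereal. ereal x < \<bar>y\<bar>} \<inter> E \<in> sets borel" by auto
  then show ?thesis by (simp add: sets_borel_on Int_def conj_commute)
qed

lemma beyond_pos_iff:
  assumes "0 < x" "\<xi> \<in> point_measures E"
  shows "0 < emeasure \<xi> {y \<in> E. \<bar>y\<bar> > ereal x} \<longleftrightarrow> 0 < (\<integral>y. excess x y \<partial>\<xi>)"
proof -
  note ck = excess_CK_plus[OF assms(1)]
  have "(\<integral>y. excess x y \<partial>\<xi>) = 0 \<longleftrightarrow> (AE y in \<xi>. excess x y = 0)"
    using CK_integrable[OF assms(2) ck] CK_plus_nonneg[OF ck]
    by (intro integral_nonneg_eq_0_iff_AE) (auto simp: PM_space[OF assms(2)])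
  also have "\<dots> \<longleftrightarrow> (AE y in \<xi>. \<not> ereal x < \<bar>y\<bar>)"
    using excess_pos[of x] excess_nonneg[of x] by (intro AE_cong) (metis order_less_le)
  also have "\<dots> \<longleftrightarrow> emeasure \<xi> {y \<in> E. \<bar>y\<bar> > ereal x} = 0"
    using beyond_sets[of x] PM_sets[OF assms(2)] PM_space[OF assms(2)]
    by (subst AE_iff_measurable[where N="{y \<in> E. \<bar>y\<bar> > ereal x}"]) auto
  finally show ?thesis
    using CK_integral_nonneg[OF assms(2) ck] by (metis gr_zeroI order_less_le)
qed

lemma pms_beyond_eq:
  assumes "0 < x"
  shows "pms_beyond E x = {\<xi> \<in> point_measures E. 0 < (\<integral>y. excess x y \<partial>\<xi>)}"
  using beyond_pos_iff[OF assms] beyond_sets[of x]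
  by (auto simp: pms_beyond_def nonnull_pms_def)

lemma openin_pms_beyond: "0 < x \<Longrightarrow> openin (vague_topology E) (pms_beyond E x)"
  using continuous_map_lsc[OF CK_integral_continuous[OF excess_CK_plus], of x 0]
  by (simp add: pms_beyond_eq topspace_vague_topology)

lemma pms_beyond_subset: "pms_beyond E x \<subseteq> point_measures E"
  by (auto simp: pms_beyond_def nonnull_pms_def)

lemma pms_beyond_sets: "0 < x \<Longrightarrow> pms_beyond E x \<in> sets (borel_Mp E)"
  by (simp add: borel_Mp_eq openin_sets_borel_of openin_pms_beyond)

text \<open>The measures charging the closed region \<open>far x\<close> form a closed set, by
  \<open>openin_void\<close>, and this set contains \<open>pms_beyond E x\<close>. A frontier point
  thus charges \<open>far x\<close> but not the open region beyond \<open>x\<close>, and the two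
  regions differ only by the points \<open>x\<close> and \<open>- x\<close>.\<close>

lemma frontier_pms_beyond:
  assumes x: "0 < x"
  shows "vague_topology E frontier_of (pms_beyond E x) \<subseteq>
    {\<xi> \<in> point_measures E. 0 < emeasure \<xi> ({ereal x, - ereal x} \<inter> E)}"
proof
  fix \<xi> assume "\<xi> \<in> vague_topology E frontier_of (pms_beyond E x)"
  then have cl: "\<xi> \<in> vague_topology E closure_of (pms_beyond E x)" and nin: "\<xi> \<notin> pms_beyond E x"
    using openin_pms_beyond[OF x] by (auto simp: frontier_of_def interior_of_openin)
  let ?C = "{\<xi> \<in> point_measures E. emeasure \<xi> (far x) \<noteq> 0}"
  have "?C = topspace (vague_topology E) - {\<xi> \<in> point_measures E. emeasure \<xi> (far x) = 0}"
    by (auto simp: topspace_vague_topology)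
  moreover have "openin (vague_topology E) {\<xi> \<in> point_measures E. emeasure \<xi> (far x) = 0}"
    by (intro openin_void compact_far x) auto
  ultimately have C: "closedin (vague_topology E) ?C" by (simp only: closedin_diff closedin_topspace)
  have fs: "far x \<in> sets \<xi>" if "\<xi> \<in> point_measures E" for \<xi>
    using PM_sets[OF that] compact_sets[OF compact_far[OF x]] by auto
  have "pms_beyond E x \<subseteq> ?C"
  proof
    fix \<xi> assume \<xi>: "\<xi> \<in> pms_beyond E x"
    then have p: "\<xi> \<in> point_measures E" using pms_beyond_subset by blast
    have "emeasure \<xi> {y \<in> E. \<bar>y\<bar> > ereal x} \<le> emeasure \<xi> (far x)"
      using fs[OF p] by (intro emeasure_mono) auto
    then show "\<xi> \<in> ?C" using \<xi> p by (auto simp: pms_beyond_def)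
  qed
  then have "\<xi> \<in> ?C" using cl closure_of_minimal[OF _ C] by blast
  then have p: "\<xi> \<in> point_measures E" and pos: "emeasure \<xi> (far x) \<noteq> 0" by auto
  have null: "emeasure \<xi> {y \<in> E. \<bar>y\<bar> > ereal x} = 0"
    using nin p beyond_sets[of x] by (auto simp: pms_beyond_def nonnull_pms_def)
  have "y = ereal x \<or> y = - ereal x" if "\<bar>y\<bar> = ereal x" for y :: ereal
    using that by (cases y) (auto simp: abs_if split: if_splits)
  then have "far x = {y \<in> E. \<bar>y\<bar> > ereal x} \<union> ({ereal x, - ereal x} \<inter> E)"
    using x by (fastforce simp: order_le_less)
  moreover have "{ereal x, - ereal x} \<inter> E \<in> sets \<xi>" "{y \<in> E. \<bar>y\<bar> > ereal x} \<in> sets \<xi>"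
    using PM_sets[OF p] beyond_sets[of x] by (auto simp: sets_borel_on intro!: borel_closed finite_imp_closed)
  ultimately have "emeasure \<xi> (far x) \<le> emeasure \<xi> {y \<in> E. \<bar>y\<bar> > ereal x} + emeasure \<xi> ({ereal x, - ereal x} \<inter> E)"
    by (simp only: emeasure_subadditive)
  with null pos show "\<xi> \<in> {\<xi> \<in> point_measures E. 0 < emeasure \<xi> ({ereal x, - ereal x} \<inter> E)}"
    using p by (auto simp: zero_less_iff_neq_zero)
qed

section \<open>Sums of point masses\<close>

text \<open>The image of counting measure on the indices, not on the points, keeps multiplicities;
  as an image measure the sum inherits the rules for integrals.\<close>

lemma sum_diracs_eq:
  assumes "\<And>j. j \<in> {1..m} \<Longrightarrow> x j \<in> E"
  shows "sum_diracs E m x = distr (count_space {1..m}) (borel_on E) x"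
proof -
  let ?D = "distr (count_space {1..m}) (borel_on E) x"
  have m: "x \<in> measurable (count_space {1..m}) (borel_on E)" using assms by auto
  have e: "(\<Sum>j\<in>{1..m}. emeasure (return (borel_on E) (x j)) A) = emeasure ?D A"
    if A: "A \<in> sets (borel_on E)" for A
  proof -
    have "emeasure ?D A = of_nat (card (x -` A \<inter> {1..m}))"
      using m A by (subst emeasure_distr) (auto intro!: emeasure_count_space_finite)
    also have "\<dots> = (\<Sum>j\<in>{1..m}. indicator A (x j))"
      by (simp add: indicator_def sum.If_cases Int_def vimage_def conj_commute)
    finally show ?thesis using A by simp
  qed
  have "sum_diracs E m x = measure_of E (sets (borel_on E)) (emeasure ?D)"
    unfolding sum_diracs_def sum_measures_def
    using e by (intro measure_of_eq) (auto simp: sets.sigma_sets_eq[of "borel_on E", simplified] sets_borel_on)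
  also have "\<dots> = ?D"
    using measure_of_of_measure[of ?D] by simp
  finally show ?thesis .
qed

lemma sum_diracs_PM:
  assumes x: "\<And>j. j \<in> {1..m} \<Longrightarrow> x j \<in> E"
  shows "sum_diracs E m x \<in> point_measures E"
proof -
  have m: "x \<in> measurable (count_space {1..m}) (borel_on E)" using x by auto
  have "emeasure (sum_diracs E m x) B \<in> range of_nat" for B
  proof (cases "B \<in> sets (borel_on E)")
    case True
    then have "emeasure (sum_diracs E m x) B = of_nat (card (x -` B \<inter> {1..m}))"
      using m sum_diracs_eq[of m x] x
      by (simp add: emeasure_distr emeasure_count_space_finite)
    then show ?thesis by blast
  next
    case False
    then have "emeasure (sum_diracs E m x) B = of_nat 0"
      using sum_diracs_eq[of m x] x by (simp add: emeasure_notin_sets)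
    then show ?thesis by blast
  qed
  moreover from this have "emeasure (sum_diracs E m x) K < \<infinity>" for K
    by (metis ennreal_of_nat_eq_real_of_nat ennreal_less_top infinity_ennreal_def rangeE)
  ultimately show ?thesis
    unfolding point_measures_def radon_measure_on_def using sum_diracs_eq[of m x] x by auto
qed

lemma integral_sum_diracs:
  assumes "\<And>j. j \<in> {1..m} \<Longrightarrow> x j \<in> E" and "f \<in> CK_plus E"
  shows "(\<integral>y. f y \<partial>sum_diracs E m x) = (\<Sum>j=1..m. f (x j))"
proof -
  have "x \<in> measurable (count_space {1..m}) (borel_on E)" using assms by auto
  then show ?thesis
    using sum_diracs_eq[of m x] assms CK_plus_measurable[OF assms(2)]
    by (simp add: integral_distr lebesgue_integral_count_space_finite)
qed

lemma sum_diracs_measurable: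
  assumes "\<And>j. j \<in> {1..m} \<Longrightarrow> Y j \<in> measurable M (borel_on E)"
  shows "(\<lambda>\<omega>. sum_diracs E m (\<lambda>j. Y j \<omega>)) \<in> measurable M (borel_Mp E)"
proof -
  have YE: "Y j \<omega> \<in> E" if "j \<in> {1..m}" "\<omega> \<in> space M" for j \<omega>
    using measurable_space[OF assms[OF that(1)] that(2)] by simp
  show ?thesis
  proof (rule measurable_borel_Mp)
    fix f assume f: "f \<in> CK_plus E"
    have "(\<lambda>\<omega>. \<Sum>j=1..m. f (Y j \<omega>)) \<in> borel_measurable M"
      by (intro borel_measurable_sum measurable_compose[OF assms CK_plus_measurable[OF f]])
    then show "(\<lambda>\<omega>. \<integral>x. f x \<partial>sum_diracs E m (\<lambda>j. Y j \<omega>)) \<in> borel_measurable M"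
      by (rule measurable_cong[THEN iffD1, rotated]) (subst integral_sum_diracs; simp add: YE f)
  qed (rule sum_diracs_PM, rule YE)
qed

lemma sum_diracs_beyond:
  assumes x: "0 < x" and m: "m \<ge> 1" and Y: "\<And>j. j \<in> {1..m} \<Longrightarrow> Y j \<in> E"
  shows "sum_diracs E m Y \<in> pms_beyond E x \<longleftrightarrow> Max ((\<lambda>j. \<bar>Y j\<bar>) ` {1..m}) > ereal x"
proof -
  have "sum_diracs E m Y \<in> pms_beyond E x \<longleftrightarrow> 0 < (\<Sum>j=1..m. excess x (Y j))"
    using sum_diracs_PM[OF Y] integral_sum_diracs[OF Y excess_CK_plus[OF x]]
    by (simp add: pms_beyond_eq[OF x])
  also have "\<dots> \<longleftrightarrow> (\<exists>j\<in>{1..m}. 0 < excess x (Y j))"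
  proof -
    have "(\<Sum>j=1..m. excess x (Y j)) = 0 \<longleftrightarrow> (\<forall>j\<in>{1..m}. excess x (Y j) = 0)"
      by (intro sum_nonneg_eq_0_iff) (auto simp: excess_def)
    moreover have "(\<Sum>j=1..m. excess x (Y j)) \<ge> 0" by (intro sum_nonneg) (auto simp: excess_def)
    moreover have "excess x y \<ge> 0" for y by (auto simp: excess_def)
    ultimately show ?thesis by (metis order_less_le)
  qed
  also have "\<dots> \<longleftrightarrow> Max ((\<lambda>j. \<bar>Y j\<bar>) ` {1..m}) > ereal x"
    using m by (subst Max_gr_iff) (auto simp: excess_pos)
  finally show ?thesis .
qed

end

section \<open>Limits of powers and integrals over level sets\<close>

text \<open>The inequality \<open>ln t \<le> t - 1\<close> at \<open>t = a n\<close> and at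
  \<open>t = 1 / a n\<close> encloses \<open>k n * (1 - a n)\<close> between \<open>a n * b\<close>
  and \<open>b\<close>, where \<open>b = - (k n * ln (a n))\<close>. In either direction
  \<open>a n\<close> tends to 1, so the two bounds have the same limit.\<close>

lemma pow_tendsto_exp_iff:
  fixes a :: "nat \<Rightarrow> real" and k :: "nat \<Rightarrow> nat"
  assumes a: "\<And>n. 0 \<le> a n" "\<And>n. a n \<le> 1" and k: "filterlim k at_top sequentially"
  shows "(\<lambda>n. a n ^ k n) \<longlonglongrightarrow> exp (- c) \<longleftrightarrow> (\<lambda>n. real (k n) * (1 - a n)) \<longlonglongrightarrow> c"
proof -
  have kr: "filterlim (\<lambda>n. real (k n)) at_top sequentially"
    by (rule filterlim_compose[OF filterlim_real_sequentially k])
  have kinv: "(\<lambda>n. inverse (real (k n))) \<longlonglongrightarrow> 0"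
    by (rule tendsto_inverse_0_at_top[OF kr])
  have k1: "eventually (\<lambda>n. k n \<ge> 1) sequentially"
    using k by (simp add: filterlim_at_top)
  have bounds: "real (k n) * (1 - a n) \<le> - (real (k n) * ln (a n))"
    "a n * - (real (k n) * ln (a n)) \<le> real (k n) * (1 - a n)" if "a n > 0" for n
  proof -
    have "real (k n) * ln (a n) \<le> real (k n) * (a n - 1)"
      using ln_le_minus_one[OF that] by (intro mult_left_mono) auto
    then show "real (k n) * (1 - a n) \<le> - (real (k n) * ln (a n))" by (simp add: algebra_simps)
    have "- ln (a n) = ln (inverse (a n))" using that by (simp add: ln_inverse)
    also have "\<dots> \<le> inverse (a n) - 1" using that by (intro ln_le_minus_one) simp
    finally have "a n * - ln (a n) \<le> a n * (inverse (a n) - 1)"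
      using that by (intro mult_left_mono) auto
    also have "\<dots> = 1 - a n" using that by (simp add: field_simps)
    finally have "real (k n) * (a n * - ln (a n)) \<le> real (k n) * (1 - a n)"
      by (intro mult_left_mono) auto
    then show "a n * - (real (k n) * ln (a n)) \<le> real (k n) * (1 - a n)" by (simp add: mult_ac)
  qed
  have pow: "a n ^ k n = exp (real (k n) * ln (a n))" if "a n > 0" for n
    using that by (simp add: exp_of_nat_mult)
  show ?thesis
  proof
    assume L: "(\<lambda>n. a n ^ k n) \<longlonglongrightarrow> exp (- c)"
    have "eventually (\<lambda>n. a n ^ k n > 0) sequentially"
      by (rule order_tendstoD(1)[OF L]) simp
    \<comment> \<open>Since \<open>0 ^ 0 = 1\<close>, a positive power yields a positive base only
      where \<open>k n \<ge> 1\<close>.\<close>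
    with k1 have pos: "eventually (\<lambda>n. a n > 0) sequentially"
    proof eventually_elim
      case (elim n)
      then show ?case using a(1)[of n] by (cases "a n = 0") (auto simp: zero_power)
    qed
    have "(\<lambda>n. ln (a n ^ k n)) \<longlonglongrightarrow> ln (exp (- c))"
      by (intro tendsto_ln L) simp
    moreover have "eventually (\<lambda>n. ln (a n ^ k n) = real (k n) * ln (a n)) sequentially"
      using pos by eventually_elim (simp add: ln_realpow)
    ultimately have "(\<lambda>n. real (k n) * ln (a n)) \<longlonglongrightarrow> ln (exp (- c))"
      by (rule Lim_transform_eventually)
    from tendsto_minus[OF this] have l: "(\<lambda>n. - (real (k n) * ln (a n))) \<longlonglongrightarrow> c"
      by simp
    \<comment> \<open>Dividing the convergent sequence by \<open>k n\<close> shows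
      \<open>ln (a n)\<close> tends to 0, that is, \<open>a n\<close> tends to 1.\<close>
    have "(\<lambda>n. inverse (real (k n)) * - (real (k n) * ln (a n))) \<longlonglongrightarrow> 0 * c"
      by (intro tendsto_mult kinv l)
    moreover have "eventually (\<lambda>n. inverse (real (k n)) * - (real (k n) * ln (a n)) = - ln (a n)) sequentially"
      using k1 by eventually_elim (simp add: field_simps)
    ultimately have "(\<lambda>n. - ln (a n)) \<longlonglongrightarrow> 0 * c"
      by (rule Lim_transform_eventually)
    then have "(\<lambda>n. exp (- (- ln (a n)))) \<longlonglongrightarrow> exp (- (0 * c))"
      by (intro tendsto_intros)
    moreover have "eventually (\<lambda>n. exp (- (- ln (a n))) = a n) sequentially"
      using pos by eventually_elim simp
    ultimately have "a \<longlonglongrightarrow> exp (- (0 * c))"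
      by (rule Lim_transform_eventually)
    from tendsto_mult[OF this l] have lo: "(\<lambda>n. a n * - (real (k n) * ln (a n))) \<longlonglongrightarrow> c" by simp
    show "(\<lambda>n. real (k n) * (1 - a n)) \<longlonglongrightarrow> c"
    proof (rule tendsto_sandwich[OF _ _ lo l])
      show "eventually (\<lambda>n. a n * - (real (k n) * ln (a n)) \<le> real (k n) * (1 - a n)) sequentially"
        using pos by eventually_elim (rule bounds(2))
      show "eventually (\<lambda>n. real (k n) * (1 - a n) \<le> - (real (k n) * ln (a n))) sequentially"
        using pos by eventually_elim (rule bounds(1))
    qed
  next
    assume R: "(\<lambda>n. real (k n) * (1 - a n)) \<longlonglongrightarrow> c"
    have "(\<lambda>n. inverse (real (k n)) * (real (k n) * (1 - a n))) \<longlonglongrightarrow> 0 * c"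
      by (intro tendsto_mult kinv R)
    moreover have "eventually (\<lambda>n. inverse (real (k n)) * (real (k n) * (1 - a n)) = 1 - a n) sequentially"
      using k1 by eventually_elim (simp add: field_simps)
    ultimately have "(\<lambda>n. 1 - a n) \<longlonglongrightarrow> 0 * c"
      by (rule Lim_transform_eventually)
    then have "(\<lambda>n. 1 - (1 - a n)) \<longlonglongrightarrow> 1 - 0 * c" by (intro tendsto_intros)
    then have a1: "a \<longlonglongrightarrow> 1" by simp
    have pos: "eventually (\<lambda>n. a n > 0) sequentially"
      by (rule order_tendstoD(1)[OF a1]) simp
    have hi: "(\<lambda>n. real (k n) * (1 - a n) / a n) \<longlonglongrightarrow> c"
      using tendsto_divide[OF R a1] by simp
    have "eventually (\<lambda>n. - (real (k n) * ln (a n)) \<le> real (k n) * (1 - a n) / a n) sequentially"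
      using pos by eventually_elim (use bounds(2) in \<open>simp add: pos_le_divide_eq mult.commute\<close>)
    moreover have "eventually (\<lambda>n. real (k n) * (1 - a n) \<le> - (real (k n) * ln (a n))) sequentially"
      using pos by eventually_elim (rule bounds(1))
    ultimately have "(\<lambda>n. - (real (k n) * ln (a n))) \<longlonglongrightarrow> c"
      by (intro tendsto_sandwich[OF _ _ R hi])
    then have "(\<lambda>n. exp (- (- (real (k n) * ln (a n))))) \<longlonglongrightarrow> exp (- c)"
      by (intro tendsto_intros)
    moreover have "eventually (\<lambda>n. exp (- (- (real (k n) * ln (a n)))) = a n ^ k n) sequentially"
      using pos by eventually_elim (simp add: pow)
    ultimately show "(\<lambda>n. a n ^ k n) \<longlonglongrightarrow> exp (- c)"
      by (rule Lim_transform_eventually)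
  qed
qed

text \<open>Fubini for the region under the graph of \<open>F\<close>: integrating first over
  \<open>t\<close> gives \<open>F x\<close>, integrating first over \<open>x\<close> gives the mass
  of a level set. Measurability in the level \<open>t\<close> is part of the same theorem.\<close>

lemma layer_cake:
  fixes F :: "'a \<Rightarrow> real"
  assumes "finite_measure M" and F [measurable]: "F \<in> borel_measurable M"
    and F01: "\<And>x. x \<in> space M \<Longrightarrow> 0 \<le> F x" "\<And>x. x \<in> space M \<Longrightarrow> F x \<le> 1"
  shows "(\<lambda>t. indicator {0<..<1} t * measure M {x \<in> space M. t < F x}) \<in> borel_measurable lborel"
    "(\<integral>x. F x \<partial>M) = (\<integral>t. indicator {0<..<1} t * measure M {x \<in> space M. t < F x} \<partial>lborel)"
proof -
  interpret finite_measure M by fact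
  interpret pair_sigma_finite lborel M ..
  have [measurable]: "Measurable.pred (lborel \<Otimes>\<^sub>M M) (\<lambda>p. fst p < F (snd p))"
    by measurable
  have sec: "{x \<in> space M. t < F x} \<in> sets M" for t
    by measurable
  let ?G = "\<lambda>t x. indicator {0<..<1} t * indicator {p. fst p < F (snd p)} (t, x) :: ennreal"
  have G: "case_prod ?G \<in> borel_measurable (lborel \<Otimes>\<^sub>M M)"
    by (simp add: split_beta' indicator_def) 
  have inner_x: "(\<integral>\<^sup>+x. ?G t x \<partial>M) = ennreal (indicator {0<..<1} t * measure M {x \<in> space M. t < F x})" for t
  proof -
    have "(\<integral>\<^sup>+x. ?G t x \<partial>M) = (\<integral>\<^sup>+x. indicator {0<..<1} t * indicator {x \<in> space M. t < F x} x \<partial>M)"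
      by (intro nn_integral_cong) (auto simp: indicator_def)
    also have "\<dots> = indicator {0<..<1} t * emeasure M {x \<in> space M. t < F x}"
      using sec by (simp add: nn_integral_cmult)
    finally show ?thesis by (simp add: emeasure_eq_measure indicator_def)
  qed
  have inner_t: "(\<integral>\<^sup>+t. ?G t x \<partial>lborel) = ennreal (F x)" if x: "x \<in> space M" for x
  proof -
    have "(\<integral>\<^sup>+t. ?G t x \<partial>lborel) = (\<integral>\<^sup>+t. indicator {0<..<F x} t \<partial>lborel)"
      using F01[OF x] AE_lborel_singleton[of 1]
      by (intro nn_integral_cong_AE) (auto simp: indicator_def)
    then show ?thesis using F01[OF x] by simp
  qed
  have "(\<lambda>t. \<integral>\<^sup>+x. ?G t x \<partial>M) \<in> borel_measurable lborel"
    using sigma_finite_measure.borel_measurable_nn_integral[OF _ G] sigma_finite_measure_axioms by simp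
  then have "(\<lambda>t. enn2real (ennreal (indicator {0<..<1} t * measure M {x \<in> space M. t < F x}))) \<in> borel_measurable lborel"
    unfolding inner_x by measurable
  then show m: "(\<lambda>t. indicator {0<..<1} t * measure M {x \<in> space M. t < F x}) \<in> borel_measurable lborel"
    by (simp add: indicator_def)
  have "(\<integral>x. F x \<partial>M) = enn2real (\<integral>\<^sup>+x. ennreal (F x) \<partial>M)"
    using F01 by (intro integral_eq_nn_integral) auto
  also have "(\<integral>\<^sup>+x. ennreal (F x) \<partial>M) = (\<integral>\<^sup>+x. (\<integral>\<^sup>+t. ?G t x \<partial>lborel) \<partial>M)"
    using inner_t by (intro nn_integral_cong) simp
  also have "\<dots> = (\<integral>\<^sup>+t. (\<integral>\<^sup>+x. ?G t x \<partial>M) \<partial>lborel)"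
    using Fubini[OF G] by simp
  also have "enn2real \<dots> = (\<integral>t. indicator {0<..<1} t * measure M {x \<in> space M. t < F x} \<partial>lborel)"
    unfolding inner_x using m by (intro integral_eq_nn_integral[symmetric]) auto
  finally show "(\<integral>x. F x \<partial>M) = (\<integral>t. indicator {0<..<1} t * measure M {x \<in> space M. t < F x} \<partial>lborel)" .
qed

text \<open>By \<open>layer_cake\<close> both sides are integrals over the level \<open>t\<close> in
  \<open>(0,1)\<close>. Dominated convergence applies there: the masses are bounded because they
  converge, and the exceptional countable set of levels is Lebesgue null.\<close>

lemma tendsto_integral_level_sets:
  fixes F :: "'a \<Rightarrow> real" and Ms :: "nat \<Rightarrow> 'a measure"
  assumes fin: "\<And>n. finite_measure (Ms n)" "finite_measure M"
    and F: "\<And>n. F \<in> borel_measurable (Ms n)" "F \<in> borel_measurable M"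
    and sp: "\<And>n. space (Ms n) = S" "space M = S"
    and F01: "\<And>x. x \<in> S \<Longrightarrow> 0 \<le> F x" "\<And>x. x \<in> S \<Longrightarrow> F x \<le> 1"
    and mass: "(\<lambda>n. measure (Ms n) S) \<longlonglongrightarrow> measure M S"
    and D: "countable D"
    and level: "\<And>t. 0 < t \<Longrightarrow> t < 1 \<Longrightarrow> t \<notin> D \<Longrightarrow>
      (\<lambda>n. measure (Ms n) {x \<in> S. t < F x}) \<longlonglongrightarrow> measure M {x \<in> S. t < F x}"
  shows "(\<lambda>n. \<integral>x. F x \<partial>Ms n) \<longlonglongrightarrow> (\<integral>x. F x \<partial>M)"
proof -
  have "Bseq (\<lambda>n. measure (Ms n) S)"
    using mass by (intro convergent_imp_Bseq) (auto simp: convergent_def)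
  then obtain C where C: "\<And>n. measure (Ms n) S \<le> C"
    unfolding Bseq_def by auto
  let ?g = "\<lambda>M t. indicator {0<..<1} t * measure M {x \<in> S. t < F x}"
  have "(\<lambda>n. \<integral>t. ?g (Ms n) t \<partial>lborel) \<longlonglongrightarrow> (\<integral>t. ?g M t \<partial>lborel)"
  proof (rule integral_dominated_convergence[where w="\<lambda>t. C * indicator {0<..<1} t"])
    show "?g M \<in> borel_measurable lborel"
      using layer_cake(1)[OF fin(2) F(2)] F01 by (simp add: sp)
    show "?g (Ms n) \<in> borel_measurable lborel" for n
      using layer_cake(1)[OF fin(1) F(1), of n] F01 by (simp add: sp)
    show "AE t in lborel. (\<lambda>n. ?g (Ms n) t) \<longlonglongrightarrow> ?g M t"
      using AE_not_in[OF countable_imp_null_set_lborel[OF D]]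
    proof eventually_elim
      case (elim t)
      then show ?case using level[of t] by (cases "t \<in> {0<..<1}") auto
    qed
    have "measure (Ms n) {x \<in> S. t < F x} \<le> C" for n t
      using finite_measure.bounded_measure[OF fin(1)] C[of n] sp(1)[of n] by (metis order_trans)
    then show "AE t in lborel. norm (?g (Ms n) t) \<le> C * indicator {0<..<1} t" for n
      by (intro AE_I2) (auto simp: indicator_def)
  qed simp
  moreover have "(\<integral>x. F x \<partial>Ms n) = (\<integral>t. ?g (Ms n) t \<partial>lborel)" for n
    using layer_cake(2)[OF fin(1) F(1), of n] F01 by (simp add: sp)
  moreover have "(\<integral>x. F x \<partial>M) = (\<integral>t. ?g M t \<partial>lborel)"
    using layer_cake(2)[OF fin(2) F(2)] F01 by (simp add: sp)
  ultimately show ?thesis by simp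
qed

section \<open>Convergence of row laws to the canonical measure\<close>

context punctured
begin

text \<open>The integrand of the canonical representation. Unlike \<open>exp (- \<xi>(f))\<close> it
  vanishes at the null measure and stays integrable when \<open>\<Lambda>\<close> has infinite
  mass.\<close>

definition loss :: "(ereal \<Rightarrow> real) \<Rightarrow> ereal measure \<Rightarrow> real" where
  "loss f \<xi> = 1 - exp (- (\<integral>x. f x \<partial>\<xi>))"

lemma loss_bounds:
  "\<xi> \<in> point_measures E \<Longrightarrow> f \<in> CK_plus E \<Longrightarrow> 0 \<le> loss f \<xi>" "loss f \<xi> \<le> 1"
  by (simp_all add: loss_def CK_integral_nonneg)

lemma loss_continuous:
  "f \<in> CK_plus E \<Longrightarrow> continuous_map (vague_topology E) euclideanreal (loss f)"
  unfolding loss_def[abs_def] by (intro continuous_map_diff exp_integral_continuous) simp_all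

lemma loss_measurable:
  "f \<in> CK_plus E \<Longrightarrow> sets M = sets (borel_Mp E) \<Longrightarrow> loss f \<in> borel_measurable M"
  by (intro continuous_map_measurable[OF _ loss_continuous]) (simp_all add: borel_Mp_eq)

lemma space_eq_PM: "sets M = sets (borel_Mp E) \<Longrightarrow> space M = point_measures E"
  using sets_eq_imp_space_eq[of M "borel_Mp E"] by (simp add: space_borel_Mp)

text \<open>Laplace functionals are closed under multiplication: a monomial in the coordinates is
  the exponential for the sum of its probes, which again lies in \<open>CK_plus E\<close>.\<close>

lemma laplace_test_convergence:
  assumes "\<And>n. finite_measure (\<nu>s n)" "finite_measure \<nu>"
    and sets: "\<And>n. sets (\<nu>s n) = sets (borel_Mp E)" "sets \<nu> = sets (borel_Mp E)"
    and lap: "\<And>f. f \<in> CK_plus E \<Longrightarrow>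
      (\<lambda>n. \<integral>\<xi>. exp (- (\<integral>x. f x \<partial>\<xi>)) \<partial>\<nu>s n) \<longlonglongrightarrow> (\<integral>\<xi>. exp (- (\<integral>x. f x \<partial>\<xi>)) \<partial>\<nu>)"
  shows "test_convergence (vague_topology E) (\<lambda>\<xi> i. exp (- (\<integral>x. probe i x \<partial>\<xi>))) \<nu>s \<nu>"
proof (intro test_convergence.intro vague.test_family_axioms test_convergence_axioms.intro)
  fix l :: "nat list"
  have CK: "(\<lambda>x. \<Sum>i\<leftarrow>l. probe i x) \<in> CK_plus E"
    by (intro CK_plus_sum_list probe_CK_plus)
  have eq: "(\<integral>\<xi>. prod_list (map (\<lambda>i. exp (- (\<integral>x. probe i x \<partial>\<xi>))) l) \<partial>M) =
      (\<integral>\<xi>. exp (- (\<integral>x. (\<Sum>i\<leftarrow>l. probe i x) \<partial>\<xi>)) \<partial>M)" if "sets M = sets (borel_Mp E)" for M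
    by (intro Bochner_Integration.integral_cong refl) (simp add: prod_list_probe space_eq_PM[OF that])
  show "(\<lambda>n. \<integral>\<xi>. prod_list (map (\<lambda>i. exp (- (\<integral>x. probe i x \<partial>\<xi>))) l) \<partial>\<nu>s n) \<longlonglongrightarrow>
      (\<integral>\<xi>. prod_list (map (\<lambda>i. exp (- (\<integral>x. probe i x \<partial>\<xi>))) l) \<partial>\<nu>)"
    unfolding eq[OF sets(1)] eq[OF sets(2)] by (rule lap[OF CK])
qed (use assms in \<open>simp_all add: borel_Mp_eq\<close>)

lemma measure_ge_1:
  assumes "\<xi> \<in> point_measures E" "compact K" "K \<subseteq> E" "emeasure \<xi> K \<noteq> 0"
  shows "1 \<le> measure \<xi> K"
  using measure_compact_lt_1[OF assms(1-3)] assms(4) emeasure_compact[OF assms(1-3)] by force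

lemma pms_beyond_integral_ge_1:
  assumes x: "0 < x" and \<xi>: "\<xi> \<in> pms_beyond E x"
    and g: "g \<in> CK_plus E" "\<And>y. y \<in> E \<Longrightarrow> ereal x \<le> \<bar>y\<bar> \<Longrightarrow> 1 \<le> g y"
  shows "1 \<le> (\<integral>y. g y \<partial>\<xi>)"
proof -
  have p: "\<xi> \<in> point_measures E" using \<xi> pms_beyond_subset by blast
  have cf: "compact (far x)" by (rule compact_far[OF x])
  have fs: "far x \<in> sets \<xi>" using PM_sets[OF p] compact_sets[OF cf] by auto
  have "emeasure \<xi> {y \<in> E. \<bar>y\<bar> > ereal x} \<le> emeasure \<xi> (far x)"
    using fs by (intro emeasure_mono) auto
  then have "emeasure \<xi> (far x) \<noteq> 0" using \<xi> by (auto simp: pms_beyond_def)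
  then have "1 \<le> measure \<xi> (far x)" by (intro measure_ge_1[OF p cf]) auto
  also have "\<dots> = (\<integral>y. indicator (far x) y \<partial>\<xi>)" using fs by simp
  also have "\<dots> \<le> (\<integral>y. g y \<partial>\<xi>)"
    using fs PM_compact_finite[OF p cf] CK_integrable[OF p g(1)] g CK_plus_nonneg[OF g(1)]
    by (intro integral_mono integrable_real_indicator) (auto simp: indicator_def PM_space[OF p])
  finally show ?thesis .
qed

text \<open>Origin of the constant 1/2 used throughout; the sharp value would be
  \<open>exp (- 1)\<close>, but any bound below 1 serves.\<close>

lemma exp_minus_le_half: "1 \<le> t \<Longrightarrow> exp (- t) \<le> 1 / (2::real)"
proof -
  assume "1 \<le> t"
  then have "2 \<le> exp t" using exp_ge_add_one_self[of t] by linarith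
  then show ?thesis by (simp add: exp_minus field_simps)
qed

lemma loss_ge_half:
  assumes "0 < x" "\<xi> \<in> pms_beyond E x"
    and "g \<in> CK_plus E" "\<And>y. y \<in> E \<Longrightarrow> ereal x \<le> \<bar>y\<bar> \<Longrightarrow> 1 \<le> g y"
  shows "1 / 2 \<le> loss g \<xi>"
  using exp_minus_le_half[OF pms_beyond_integral_ge_1[OF assms]] by (simp add: loss_def)

lemma CK_integral_eq_0:
  assumes x: "0 < x" and f: "f \<in> CK_plus E" "\<And>y. y \<in> E \<Longrightarrow> f y \<noteq> 0 \<Longrightarrow> ereal x < \<bar>y\<bar>"
    and \<xi>: "\<xi> \<in> point_measures E" "\<xi> \<notin> pms_beyond E x"
  shows "(\<integral>y. f y \<partial>\<xi>) = 0"
proof -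
  have null: "emeasure \<xi> {y \<in> E. \<bar>y\<bar> > ereal x} = 0"
    using \<xi> beyond_pos_iff[OF x \<xi>(1)] by (simp add: pms_beyond_eq[OF x])
  have "{y \<in> E. \<bar>y\<bar> > ereal x} \<in> sets \<xi>"
    using beyond_sets[of x] PM_sets[OF \<xi>(1)] by simp
  then have "AE y in \<xi>. f y = 0"
    using null f(2) PM_space[OF \<xi>(1)]
    by (intro AE_I[where N="{y \<in> E. \<bar>y\<bar> > ereal x}"]) auto
  then show ?thesis by (rule integral_eq_zero_AE)
qed

end

section \<open>Comparing row laws with the canonical measure\<close>

text \<open>Integrability of all losses is the form in which local finiteness of the canonical
  measure enters the comparison with row laws; its Laplace formula enters separately, through
  \<open>canonical_laplace\<close> and \<open>frontier_beyond_null\<close>.\<close>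

locale canonical = punctured +
  fixes \<Lambda> :: "ereal measure measure"
  assumes sets_\<Lambda>: "sets \<Lambda> = sets (borel_Mp E)"
    and loss_integrable: "\<And>f. f \<in> CK_plus E \<Longrightarrow> integrable \<Lambda> (loss f)"
begin

lemma space_\<Lambda>: "space \<Lambda> = point_measures E"
  by (rule space_eq_PM[OF sets_\<Lambda>])

text \<open>Markov's inequality: the loss of a suitable \<open>bump m\<close> is integrable and at
  least 1/2 on \<open>pms_beyond E x\<close>.\<close>

lemma pms_beyond_finite:
  assumes x: "0 < x"
  shows "emeasure \<Lambda> (pms_beyond E x) < \<infinity>"
proof -
  obtain m where m: "\<And>y. ereal x \<le> \<bar>y\<bar> \<Longrightarrow> bump m y = 1" using bump_1_far[OF x] by blast
  have "emeasure \<Lambda> (pms_beyond E x) = (\<integral>\<^sup>+\<xi>. indicator (pms_beyond E x) \<xi> \<partial>\<Lambda>)"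
    using pms_beyond_sets[OF x] by (simp add: sets_\<Lambda>)
  also have "\<dots> \<le> (\<integral>\<^sup>+\<xi>. ennreal (2 * loss (bump m) \<xi>) \<partial>\<Lambda>)"
  proof (rule nn_integral_mono)
    fix \<xi> assume "\<xi> \<in> space \<Lambda>"
    show "indicator (pms_beyond E x) \<xi> \<le> ennreal (2 * loss (bump m) \<xi>)"
    proof (cases "\<xi> \<in> pms_beyond E x")
      case True
      have "1 \<le> 2 * loss (bump m) \<xi>"
        using loss_ge_half[OF x True bump_CK_plus, of m] m by simp
      then show ?thesis using True by simp
    qed simp
  qed
  also have "\<dots> < \<infinity>"
    using loss_integrable[OF bump_CK_plus, of m] loss_bounds(1)[OF _ bump_CK_plus]
    by (subst nn_integral_eq_integral) (auto simp: space_\<Lambda> intro!: AE_I2)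
  finally show ?thesis .
qed

end

locale row_laws = canonical +
  fixes L :: "nat \<Rightarrow> ereal measure measure" and k :: "nat \<Rightarrow> nat"
  assumes prob_L: "\<And>n. prob_space (L n)" and sets_L: "\<And>n. sets (L n) = sets (borel_Mp E)"
begin

lemma space_L: "space (L n) = point_measures E"
  by (rule space_eq_PM[OF sets_L])

lemma loss_integrable_L: "f \<in> CK_plus E \<Longrightarrow> integrable (L n) (loss f)"
proof -
  assume f: "f \<in> CK_plus E"
  interpret prob_space "L n" by (rule prob_L)
  show ?thesis
    using loss_bounds(1)[OF _ f] loss_bounds(2) loss_measurable[OF f sets_L]
    by (intro integrable_const_bound[where B=1]) (auto simp: space_L intro!: AE_I2)
qed

text \<open>The measures are first weighted by \<open>w\<close>, which makes them finite with
  convergent Laplace functionals; the portmanteau argument is then applied with the reciprocal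
  weight \<open>\<kappa>\<close>, so that on \<open>A\<close> both weights cancel and the unweighted
  masses reappear.\<close>

lemma set_limit:
  assumes lim: "\<And>f. f \<in> CK_plus E \<Longrightarrow>
      (\<lambda>n. real (k n) * (\<integral>\<xi>. loss f \<xi> \<partial>L n)) \<longlonglongrightarrow> (\<integral>\<xi>. loss f \<xi> \<partial>\<Lambda>)"
    and x: "0 < x" and A: "A \<in> sets (borel_Mp E)" "A \<subseteq> pms_beyond E x"
    and null: "emeasure \<Lambda> (vague_topology E frontier_of A) = 0"
  shows "(\<lambda>n. real (k n) * measure (L n) A) \<longlonglongrightarrow> measure \<Lambda> A"
proof -
  obtain m where m: "\<And>y. ereal x \<le> \<bar>y\<bar> \<Longrightarrow> bump m y = 1" using bump_1_far[OF x] by blast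
  note g = bump_CK_plus[of m]
  define w where "w = loss (bump m)"
  define \<nu>s where "\<nu>s n = density (L n) (\<lambda>\<xi>. ennreal (real (k n) * w \<xi>))" for n
  define \<nu> where "\<nu> = density \<Lambda> (\<lambda>\<xi>. ennreal (w \<xi>))"
  have w_meas: "w \<in> borel_measurable (L n)" "w \<in> borel_measurable \<Lambda>" for n
    unfolding w_def by (intro loss_measurable g sets_L sets_\<Lambda>)+
  have w_int: "integrable (L n) w" "integrable \<Lambda> w" for n
    unfolding w_def by (intro loss_integrable_L loss_integrable g)+
  have w_nn: "0 \<le> w \<xi>" if "\<xi> \<in> point_measures E" for \<xi>
    unfolding w_def by (rule loss_bounds(1)[OF that g])
  have AEw: "AE \<xi> in L n. 0 \<le> real (k n) * w \<xi>" "AE \<xi> in \<Lambda>. 0 \<le> w \<xi>" for n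
    using w_nn by (auto simp: space_L space_\<Lambda> intro!: AE_I2)
  have fin: "finite_measure (\<nu>s n)" "finite_measure \<nu>" for n
  proof -
    have "integrable (L n) (\<lambda>\<xi>. real (k n) * w \<xi>)" using w_int by simp
    from nn_integral_eq_integral[OF this AEw(1)]
    show "finite_measure (\<nu>s n)"
      unfolding \<nu>s_def using w_meas by (intro finite_measureI) (simp add: emeasure_density)
    from nn_integral_eq_integral[OF w_int(2) AEw(2)]
    show "finite_measure \<nu>"
      unfolding \<nu>_def using w_meas by (intro finite_measureI) (simp add: emeasure_density)
  qed
  have sets: "sets (\<nu>s n) = sets (borel_Mp E)" "sets \<nu> = sets (borel_Mp E)" for n
    by (simp_all add: \<nu>s_def \<nu>_def sets_L sets_\<Lambda>)
  have int_eq: "(\<integral>\<xi>. h \<xi> \<partial>\<nu>s n) = real (k n) * (\<integral>\<xi>. w \<xi> * h \<xi> \<partial>L n)"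
      "(\<integral>\<xi>. h \<xi> \<partial>\<nu>) = (\<integral>\<xi>. w \<xi> * h \<xi> \<partial>\<Lambda>)"
    if "h \<in> borel_measurable (borel_Mp E)" for h :: "ereal measure \<Rightarrow> real" and n
  proof -
    have h: "h \<in> borel_measurable (L n)" "h \<in> borel_measurable \<Lambda>"
      using that measurable_cong_sets[OF sets_L refl] measurable_cong_sets[OF sets_\<Lambda> refl] by blast+
    show "(\<integral>\<xi>. h \<xi> \<partial>\<nu>s n) = real (k n) * (\<integral>\<xi>. w \<xi> * h \<xi> \<partial>L n)"
      unfolding \<nu>s_def using h w_meas AEw by (subst integral_density) (auto simp: mult.assoc)
    show "(\<integral>\<xi>. h \<xi> \<partial>\<nu>) = (\<integral>\<xi>. w \<xi> * h \<xi> \<partial>\<Lambda>)"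
      unfolding \<nu>_def using h w_meas AEw by (subst integral_density) auto
  qed
  have expm: "(\<lambda>\<xi>. exp (- (\<integral>x. f x \<partial>\<xi>))) \<in> borel_measurable (borel_Mp E)" if "f \<in> CK_plus E" for f
    using CK_integral_measurable[OF that] by measurable
  have lap: "(\<lambda>n. \<integral>\<xi>. exp (- (\<integral>x. f x \<partial>\<xi>)) \<partial>\<nu>s n) \<longlonglongrightarrow> (\<integral>\<xi>. exp (- (\<integral>x. f x \<partial>\<xi>)) \<partial>\<nu>)"
    if f: "f \<in> CK_plus E" for f
  proof -
    let ?fg = "\<lambda>y. bump m y + f y"
    have fg: "?fg \<in> CK_plus E" by (rule CK_plus_add[OF g f])
    \<comment> \<open>With \<open>p = exp (- \<xi>(g))\<close> and
      \<open>q = exp (- \<xi>(f))\<close> this is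
      \<open>(1 - p) * q = (1 - p * q) - (1 - q)\<close>, so weighted Laplace functionals are
      differences of quantities whose limits are assumed.\<close>
    have split: "w \<xi> * exp (- (\<integral>x. f x \<partial>\<xi>)) = loss ?fg \<xi> - loss f \<xi>" if "\<xi> \<in> point_measures E" for \<xi>
      using CK_integrable[OF that f] CK_integrable[OF that g]
      by (simp add: w_def loss_def algebra_simps flip: exp_add)
    have "(\<integral>\<xi>. w \<xi> * exp (- (\<integral>x. f x \<partial>\<xi>)) \<partial>L n) = (\<integral>\<xi>. loss ?fg \<xi> - loss f \<xi> \<partial>L n)" for n
      by (intro Bochner_Integration.integral_cong refl split) (simp add: space_L)
    then have 1: "real (k n) * (\<integral>\<xi>. w \<xi> * exp (- (\<integral>x. f x \<partial>\<xi>)) \<partial>L n) =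
        real (k n) * (\<integral>\<xi>. loss ?fg \<xi> \<partial>L n) - real (k n) * (\<integral>\<xi>. loss f \<xi> \<partial>L n)" for n
      by (simp add: loss_integrable_L f fg right_diff_distrib)
    have "(\<integral>\<xi>. w \<xi> * exp (- (\<integral>x. f x \<partial>\<xi>)) \<partial>\<Lambda>) = (\<integral>\<xi>. loss ?fg \<xi> - loss f \<xi> \<partial>\<Lambda>)"
      by (intro Bochner_Integration.integral_cong refl split) (simp add: space_\<Lambda>)
    then have 2: "(\<integral>\<xi>. w \<xi> * exp (- (\<integral>x. f x \<partial>\<xi>)) \<partial>\<Lambda>) = (\<integral>\<xi>. loss ?fg \<xi> \<partial>\<Lambda>) - (\<integral>\<xi>. loss f \<xi> \<partial>\<Lambda>)"
      by (simp add: loss_integrable f fg)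
    show ?thesis
      unfolding int_eq[OF expm[OF f]] 1 2 by (intro tendsto_diff lim f fg)
  qed
  interpret tc: test_convergence "vague_topology E" "\<lambda>\<xi> i. exp (- (\<integral>x. probe i x \<partial>\<xi>))" \<nu>s \<nu>
    by (rule laplace_test_convergence[OF fin sets lap])
  \<comment> \<open>Truncating at 1/2 makes the reciprocal continuous and bounded by 2 on all point
    measures; on \<open>A\<close> the weight is at least 1/2, so there \<open>\<kappa>\<close> is
    exactly \<open>1 / w\<close>.\<close>
  define \<kappa> where "\<kappa> \<xi> = 1 / max (w \<xi>) (1/2)" for \<xi>
  have "continuous_on UNIV (\<lambda>t::real. 1 / max t (1/2))"
    by (intro continuous_intros) (auto simp: max_def)
  then have \<kappa>_cont: "continuous_map (vague_topology E) euclideanreal \<kappa>"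
    using continuous_map_compose[OF loss_continuous[OF g], of euclideanreal "\<lambda>t. 1 / max t (1/2)"]
    by (simp add: o_def \<kappa>_def[abs_def] w_def)
  have \<kappa>_bd: "0 \<le> \<kappa> \<xi>" "\<kappa> \<xi> \<le> 2" for \<xi>
    by (auto simp: \<kappa>_def max_def field_simps)
  have A_PM: "A \<subseteq> topspace (vague_topology E)"
    using A(2) pms_beyond_subset by (auto simp: topspace_vague_topology)
  have fr_sets: "vague_topology E frontier_of A \<in> sets \<Lambda>"
    by (simp add: sets_\<Lambda> borel_Mp_eq closedin_sets_borel_of closedin_frontier_of)
  have "emeasure \<nu> (vague_topology E frontier_of A) = 0"
    unfolding \<nu>_def using fr_sets null w_meas
    by (subst emeasure_density) (auto intro!: nn_integral_null_set simp: null_sets_def)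
  from tc.lim_continuity_set[OF \<kappa>_cont \<kappa>_bd A_PM _ this]
  have lim': "(\<lambda>n. \<integral>\<xi>. indicator A \<xi> * \<kappa> \<xi> \<partial>\<nu>s n) \<longlonglongrightarrow> (\<integral>\<xi>. indicator A \<xi> * \<kappa> \<xi> \<partial>\<nu>)"
    using A(1) by (simp add: borel_Mp_eq)
  have one: "w \<xi> * (indicator A \<xi> * \<kappa> \<xi>) = indicator A \<xi>" for \<xi>
  proof (cases "\<xi> \<in> A")
    case True
    then have "1 / 2 \<le> w \<xi>"
      unfolding w_def using A(2) m by (intro loss_ge_half[OF x _ g]) auto
    then show ?thesis using True by (simp add: \<kappa>_def max_def)
  qed simp
  have meas: "(\<lambda>\<xi>. indicator A \<xi> * \<kappa> \<xi>) \<in> borel_measurable (borel_Mp E)"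
    using A(1) continuous_map_measurable[OF _ \<kappa>_cont, of "borel_Mp E"] by (simp add: borel_Mp_eq)
  show ?thesis
    using lim' A(1) unfolding int_eq[OF meas] one by (simp add: sets_L sets_\<Lambda>)
qed

text \<open>Since \<open>f\<close> is supported beyond \<open>x\<close>, its loss vanishes off
  \<open>pms_beyond E x\<close>; everything takes place under the restrictions \<open>Ms n\<close>
  and \<open>M\<close>, which are finite. Level sets at \<open>t > 0\<close> lie in
  \<open>pms_beyond E x\<close>, and their frontiers lie in \<open>{loss f = t}\<close>.\<close>

lemma loss_limit:
  assumes x: "0 < x" and f: "f \<in> CK_plus E" "\<And>y. y \<in> E \<Longrightarrow> f y \<noteq> 0 \<Longrightarrow> ereal x < \<bar>y\<bar>"
    and mass: "(\<lambda>n. real (k n) * measure (L n) (pms_beyond E x)) \<longlonglongrightarrow> measure \<Lambda> (pms_beyond E x)"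
    and level: "\<And>A. A \<in> sets (borel_Mp E) \<Longrightarrow> A \<subseteq> pms_beyond E x \<Longrightarrow>
      emeasure \<Lambda> (vague_topology E frontier_of A \<inter> pms_beyond E x) = 0 \<Longrightarrow>
      (\<lambda>n. real (k n) * measure (L n) A) \<longlonglongrightarrow> measure \<Lambda> A"
  shows "(\<lambda>n. real (k n) * (\<integral>\<xi>. loss f \<xi> \<partial>L n)) \<longlonglongrightarrow> (\<integral>\<xi>. loss f \<xi> \<partial>\<Lambda>)"
proof -
  let ?B = "pms_beyond E x"
  have B: "?B \<in> sets (borel_Mp E)" by (rule pms_beyond_sets[OF x])
  define Ms where "Ms n = density (L n) (\<lambda>\<xi>. ennreal (real (k n) * indicator ?B \<xi>))" for n
  define M where "M = density \<Lambda> (\<lambda>\<xi>. ennreal (indicator ?B \<xi>))"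
  have Bs: "?B \<in> sets (L n)" "?B \<in> sets \<Lambda>" for n
    using B by (simp_all add: sets_L sets_\<Lambda>)
  have em: "emeasure (Ms n) S = ennreal (real (k n) * measure (L n) (S \<inter> ?B))"
      "emeasure M S = emeasure \<Lambda> (S \<inter> ?B)" if "S \<in> sets (borel_Mp E)" for S n
  proof -
    interpret prob_space "L n" by (rule prob_L)
    have S: "S \<in> sets (L n)" "S \<in> sets \<Lambda>" using that by (simp_all add: sets_L sets_\<Lambda>)
    have "emeasure (Ms n) S = (\<integral>\<^sup>+\<xi>. ennreal (real (k n)) * indicator (S \<inter> ?B) \<xi> \<partial>L n)"
      unfolding Ms_def using S Bs by (subst emeasure_density) (auto intro!: nn_integral_cong simp: indicator_def)
    also have "\<dots> = ennreal (real (k n)) * emeasure (L n) (S \<inter> ?B)"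
      using S Bs by (intro nn_integral_cmult_indicator) auto
    finally show "emeasure (Ms n) S = ennreal (real (k n) * measure (L n) (S \<inter> ?B))"
      by (simp add: emeasure_eq_measure ennreal_mult')
    have "emeasure M S = (\<integral>\<^sup>+\<xi>. indicator (S \<inter> ?B) \<xi> \<partial>\<Lambda>)"
      unfolding M_def using S(2) Bs(2)
      by (subst emeasure_density) (auto intro!: nn_integral_cong simp: indicator_def simp del: nn_integral_indicator)
    then show "emeasure M S = emeasure \<Lambda> (S \<inter> ?B)" using S Bs by simp
  qed
  have me: "measure (Ms n) S = real (k n) * measure (L n) (S \<inter> ?B)"
      "measure M S = measure \<Lambda> (S \<inter> ?B)" if "S \<in> sets (borel_Mp E)" for S n
    using em[OF that] by (simp_all add: measure_def)
  have PMs: "point_measures E \<in> sets (borel_Mp E)"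
    using sets.top[of "borel_Mp E"] by (simp add: space_borel_Mp)
  have PMB: "point_measures E \<inter> ?B = ?B" using pms_beyond_subset by blast
  have sp: "space (Ms n) = point_measures E" "space M = point_measures E" for n
    by (simp_all add: Ms_def M_def space_L space_\<Lambda>)
  have fin: "finite_measure (Ms n)" "finite_measure M" for n
    using em[OF PMs] pms_beyond_finite[OF x]
    by (auto intro!: finite_measureI simp: sp PMB less_top)
  have sM: "sets (Ms n) = sets (borel_Mp E)" "sets M = sets (borel_Mp E)" for n
    by (simp_all add: Ms_def M_def sets_L sets_\<Lambda>)
  have F0: "loss f \<xi> = 0" if "\<xi> \<in> point_measures E" "\<xi> \<notin> ?B" for \<xi>
    using CK_integral_eq_0[OF x f that] by (simp add: loss_def)
  have F_sets: "{\<xi> \<in> point_measures E. t < loss f \<xi>} \<in> sets (borel_Mp E)" for t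
    using continuous_map_lsc[OF loss_continuous[OF f(1)], of t]
    by (simp add: topspace_vague_topology borel_Mp_eq openin_sets_borel_of)
  interpret D: finite_measure "distr M borel (loss f)"
    by (intro finite_measure.finite_measure_distr fin loss_measurable f sM)
  \<comment> \<open>The atoms of the law of \<open>loss f\<close> under the finite measure
    \<open>M\<close>: for every other level the set \<open>{loss f = t}\<close> is null.\<close>
  define D where "D = {t. measure (distr M borel (loss f)) {t} \<noteq> 0}"
  have "(\<lambda>n. \<integral>\<xi>. loss f \<xi> \<partial>Ms n) \<longlonglongrightarrow> (\<integral>\<xi>. loss f \<xi> \<partial>M)"
  proof (rule tendsto_integral_level_sets[where D=D, OF fin _ _ sp])
    show "countable D" unfolding D_def by (rule D.countable_support)
    show "(\<lambda>n. measure (Ms n) (point_measures E)) \<longlonglongrightarrow> measure M (point_measures E)"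
      using mass by (simp add: me[OF PMs] PMB)
    fix t :: real assume t: "0 < t" "t \<notin> D"
    let ?A = "{\<xi> \<in> point_measures E. t < loss f \<xi>}"
    have AB: "?A \<subseteq> ?B" using F0 t(1) by force
    let ?Q = "{\<xi> \<in> topspace (vague_topology E). loss f \<xi> \<in> {t..}}"
    have "closedin (vague_topology E) ?Q"
      by (rule closedin_continuous_map_preimage[OF loss_continuous[OF f(1)]]) simp
    moreover have "?A \<subseteq> ?Q" by (auto simp: topspace_vague_topology)
    ultimately have cl: "vague_topology E closure_of ?A \<subseteq> ?Q" by (rule closure_of_minimal[rotated])
    have "openin (vague_topology E) ?A"
      using continuous_map_lsc[OF loss_continuous[OF f(1)], of t] by (simp add: topspace_vague_topology)
    then have fr: "vague_topology E frontier_of ?A \<subseteq> {\<xi> \<in> point_measures E. loss f \<xi> = t}"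
      using cl by (auto simp: frontier_of_def interior_of_openin topspace_vague_topology)
    have Z: "{\<xi> \<in> point_measures E. loss f \<xi> = t} \<in> sets (borel_Mp E)"
      using measurable_sets[OF loss_measurable[OF f(1) refl], of "{t}"]
      by (simp add: space_borel_Mp vimage_def Int_def conj_commute)
    have "measure (distr M borel (loss f)) {t} = 0" using t(2) by (simp add: D_def)
    then have "measure M {\<xi> \<in> point_measures E. loss f \<xi> = t} = 0"
      using loss_measurable[OF f(1) sM(2)]
      by (simp add: measure_distr sp vimage_def Int_def conj_commute)
    then have "emeasure \<Lambda> ({\<xi> \<in> point_measures E. loss f \<xi> = t} \<inter> ?B) = 0"
      using em(2)[OF Z] finite_measure.emeasure_eq_measure[OF fin(2)] by simp
    moreover have "emeasure \<Lambda> (vague_topology E frontier_of ?A \<inter> ?B) \<le>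
        emeasure \<Lambda> ({\<xi> \<in> point_measures E. loss f \<xi> = t} \<inter> ?B)"
      using fr Z Bs by (intro emeasure_mono) (auto simp: sets_\<Lambda>)
    ultimately have "emeasure \<Lambda> (vague_topology E frontier_of ?A \<inter> ?B) = 0" by simp
    from level[OF F_sets AB this]
    show "(\<lambda>n. measure (Ms n) ?A) \<longlonglongrightarrow> measure M ?A"
      using AB by (simp add: me[OF F_sets] Int_absorb2)
  qed (use loss_measurable[OF f(1)] sM loss_bounds(1)[OF _ f(1)] loss_bounds(2) in auto)
  moreover have "(\<integral>\<xi>. loss f \<xi> \<partial>Ms n) = real (k n) * (\<integral>\<xi>. loss f \<xi> \<partial>L n)" for n
  proof -
    have "(\<integral>\<xi>. loss f \<xi> \<partial>Ms n) = (\<integral>\<xi>. (real (k n) * indicator ?B \<xi>) * loss f \<xi> \<partial>L n)"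
      unfolding Ms_def using Bs loss_measurable[OF f(1) sets_L] by (subst integral_density) auto
    also have "\<dots> = (\<integral>\<xi>. real (k n) * loss f \<xi> \<partial>L n)"
      using F0 by (intro Bochner_Integration.integral_cong refl) (auto simp: space_L indicator_def)
    finally show ?thesis by simp
  qed
  moreover have "(\<integral>\<xi>. loss f \<xi> \<partial>M) = (\<integral>\<xi>. loss f \<xi> \<partial>\<Lambda>)"
  proof -
    have "(\<integral>\<xi>. loss f \<xi> \<partial>M) = (\<integral>\<xi>. indicator ?B \<xi> * loss f \<xi> \<partial>\<Lambda>)"
      unfolding M_def using Bs loss_measurable[OF f(1) sets_\<Lambda>] by (subst integral_density) auto
    also have "\<dots> = (\<integral>\<xi>. loss f \<xi> \<partial>\<Lambda>)"
      using F0 by (intro Bochner_Integration.integral_cong refl) (auto simp: space_\<Lambda> indicator_def)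
    finally show ?thesis .
  qed
  ultimately show ?thesis by simp
qed

end

section \<open>The canonical measure and fixed atoms\<close>

lemma exp_neg_ennreal: "0 \<le> t \<Longrightarrow> exp_neg (ennreal t) = exp (- t)"
  by (simp add: exp_neg_def)

lemma exp_neg_le_1: "exp_neg t \<le> 1"
  by (simp add: exp_neg_def)

lemma exp_neg_eq_1: "exp_neg t = 1 \<Longrightarrow> t = 0"
  by (auto simp: exp_neg_def enn2real_eq_0_iff split: if_splits)

lemma point_process_PM:
  "point_process E Q N \<Longrightarrow> \<omega> \<in> space Q \<Longrightarrow> N \<omega> \<in> point_measures E"
  unfolding point_process_def using measurable_space[of N Q "borel_Mp E" \<omega>] by (simp add: space_borel_Mp)

context punctured
begin

lemma half_le_exp_neg:
  assumes "\<xi> \<in> point_measures E" "compact K" "K \<subseteq> E" "emeasure \<xi> K \<noteq> 0"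
  shows "1 / 2 \<le> 1 - exp_neg (emeasure \<xi> K)"
  using exp_minus_le_half[OF measure_ge_1[OF assms]]
  by (simp add: emeasure_compact[OF assms(1-3)] exp_neg_ennreal)

text \<open>Integrability passes from sets to functions by a dichotomy. If \<open>\<xi>\<close> does
  not charge \<open>far x\<close>, which carries \<open>f\<close>, then the loss is 0; otherwise
  integrality makes \<open>2 * (1 - exp_neg (emeasure \<xi> (far x)))\<close> at least 1, hence at
  least the loss.\<close>

lemma canonical_measure_canonical:
  assumes can: "canonical_measure E Q N \<Lambda>"
  shows "canonical E \<Lambda>"
proof
  show s: "sets \<Lambda> = sets (borel_Mp E)" using can by (simp add: canonical_measure_def)
  fix f assume f: "f \<in> CK_plus E"
  obtain x where x: "0 < x" "\<And>y. y \<in> E \<Longrightarrow> f y \<noteq> 0 \<Longrightarrow> ereal x \<le> \<bar>y\<bar>"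
    using f unfolding CK_plus_iff by blast
  have cf: "compact (far x)" by (rule compact_far[OF x(1)])
  have le: "loss f \<xi> \<le> 2 * (1 - exp_neg (emeasure \<xi> (far x)))" if \<xi>: "\<xi> \<in> point_measures E" for \<xi>
  proof (cases "emeasure \<xi> (far x) = 0")
    case True
    have "far x \<in> sets \<xi>" using PM_sets[OF \<xi>] compact_sets[OF cf] by auto
    then have "AE y in \<xi>. f y = 0"
      using True x(2) PM_space[OF \<xi>] by (intro AE_I[where N="far x"]) auto
    then have "(\<integral>y. f y \<partial>\<xi>) = 0" by (rule integral_eq_zero_AE)
    then show ?thesis using exp_neg_le_1[of "emeasure \<xi> (far x)"] by (simp add: loss_def)
  next
    case False
    then show ?thesis
      using half_le_exp_neg[OF \<xi> cf _ False] loss_bounds(2)[of f \<xi>] by simp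
  qed
  have "(\<integral>\<^sup>+\<xi>. ennreal (norm (loss f \<xi>)) \<partial>\<Lambda>) \<le> (\<integral>\<^sup>+\<xi>. 2 * ennreal (1 - exp_neg (emeasure \<xi> (far x))) \<partial>\<Lambda>)"
  proof (rule nn_integral_mono)
    fix \<xi> assume "\<xi> \<in> space \<Lambda>"
    then have \<xi>: "\<xi> \<in> point_measures E" by (simp add: space_eq_PM[OF s])
    have "ennreal (loss f \<xi>) \<le> ennreal (2 * (1 - exp_neg (emeasure \<xi> (far x))))"
      by (intro ennreal_leI le \<xi>)
    also have "\<dots> = 2 * ennreal (1 - exp_neg (emeasure \<xi> (far x)))"
      by (subst ennreal_mult') simp_all
    finally show "ennreal (norm (loss f \<xi>)) \<le> 2 * ennreal (1 - exp_neg (emeasure \<xi> (far x)))"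
      using loss_bounds(1)[OF \<xi> f] by simp
  qed
  also have "\<dots> = 2 * (\<integral>\<^sup>+\<xi>. ennreal (1 - exp_neg (emeasure \<xi> (far x))) \<partial>\<Lambda>)"
  proof (rule nn_integral_cmult)
    have "(\<lambda>\<xi>. measure \<xi> (far x)) \<in> borel_measurable \<Lambda>"
      using measure_compact_measurable[OF cf] measurable_cong_sets[OF s refl] by blast
    then have "(\<lambda>\<xi>. ennreal (1 - exp (- measure \<xi> (far x)))) \<in> borel_measurable \<Lambda>" by measurable
    then show "(\<lambda>\<xi>. ennreal (1 - exp_neg (emeasure \<xi> (far x)))) \<in> borel_measurable \<Lambda>"
      by (rule measurable_cong[THEN iffD1, rotated])
        (subst emeasure_compact[OF _ cf]; auto simp: space_eq_PM[OF s] exp_neg_ennreal)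
  qed
  also have "\<dots> < \<infinity>"
    using can compact_relcompact[OF cf] by (auto simp: canonical_measure_def ennreal_mult_less_top)
  finally show "integrable \<Lambda> (loss f)"
    by (intro integrableI_bounded loss_measurable f s)
qed

lemma canonical_laplace:
  assumes can: "canonical_measure E Q N \<Lambda>" and pp: "point_process E Q N" and f: "f \<in> CK_plus E"
  shows "(\<integral>\<omega>. exp (- (\<integral>x. f x \<partial>N \<omega>)) \<partial>Q) = exp (- (\<integral>\<xi>. loss f \<xi> \<partial>\<Lambda>))"
proof -
  interpret canonical E \<Lambda> by (rule canonical_measure_canonical[OF can])
  have "(\<integral>\<omega>. exp (- (\<integral>x. f x \<partial>N \<omega>)) \<partial>Q) = (\<integral>\<omega>. exp_neg (\<integral>\<^sup>+x. ennreal (f x) \<partial>N \<omega>) \<partial>Q)"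
    using CK_exp_neg[OF point_process_PM[OF pp] f]
    by (intro Bochner_Integration.integral_cong refl) simp
  also have "\<dots> = exp_neg (\<integral>\<^sup>+\<mu>. ennreal (1 - exp_neg (\<integral>\<^sup>+x. ennreal (f x) \<partial>\<mu>)) \<partial>\<Lambda>)"
    using can CK_plus_measurable[OF f] CK_plus_nonneg[OF f] by (simp add: canonical_measure_def)
  also have "(\<integral>\<^sup>+\<mu>. ennreal (1 - exp_neg (\<integral>\<^sup>+x. ennreal (f x) \<partial>\<mu>)) \<partial>\<Lambda>) = (\<integral>\<^sup>+\<mu>. ennreal (loss f \<mu>) \<partial>\<Lambda>)"
    using CK_exp_neg[OF _ f] by (intro nn_integral_cong) (simp add: space_\<Lambda> loss_def)
  also have "\<dots> = ennreal (\<integral>\<xi>. loss f \<xi> \<partial>\<Lambda>)"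
    using loss_bounds(1)[OF _ f] loss_integrable[OF f]
    by (intro nn_integral_eq_integral AE_I2) (auto simp: space_\<Lambda>)
  also have "exp_neg \<dots> = exp (- (\<integral>\<xi>. loss f \<xi> \<partial>\<Lambda>))"
    using loss_bounds(1)[OF _ f] by (intro exp_neg_ennreal integral_nonneg_AE AE_I2) (simp add: space_\<Lambda>)
  finally show ?thesis .
qed

lemma null_compact_sets:
  assumes pp: "point_process E Q N" and K: "compact K" "K \<subseteq> E"
  shows "{\<omega> \<in> space Q. emeasure (N \<omega>) K > 0} \<in> sets Q"
proof -
  have "N \<in> measurable Q (borel_Mp E)" using pp by (simp add: point_process_def)
  from measurable_compose[OF this measure_compact_measurable[OF K]]
  have "(\<lambda>\<omega>. measure (N \<omega>) K) \<in> borel_measurable Q" .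
  then have "{\<omega> \<in> space Q. 0 < measure (N \<omega>) K} \<in> sets Q" by measurable
  also have "{\<omega> \<in> space Q. 0 < measure (N \<omega>) K} = {\<omega> \<in> space Q. emeasure (N \<omega>) K > 0}"
    using emeasure_compact[OF point_process_PM[OF pp] K] by auto
  finally show ?thesis .
qed

text \<open>The canonical formula is applied to the indicator of the points \<open>x\<close> and
  \<open>- x\<close> in \<open>E\<close>, a measurable function that need not be continuous. As
  these are not fixed atoms, the left side is 1, so the exponent on the right is 0 and
  \<open>\<Lambda>\<close>-almost no measure charges them. The frontier consists of measures that
  do.\<close>

lemma frontier_beyond_null:
  assumes can: "canonical_measure E Q N \<Lambda>" and pp: "point_process E Q N"
    and x: "0 < x" "x \<notin> fixed_atom_radii E Q N"
  shows "emeasure \<Lambda> (vague_topology E frontier_of (pms_beyond E x)) = 0"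
proof -
  interpret canonical E \<Lambda> by (rule canonical_measure_canonical[OF can])
  interpret Q: prob_space Q using pp by (simp add: point_process_def)
  let ?S = "{ereal x, - ereal x} \<inter> E"
  have cS: "compact ?S" by (intro finite_imp_compact) simp
  have S: "?S \<in> sets (borel_on E)" by (intro compact_sets cS) simp
  have single: "AE \<omega> in Q. emeasure (N \<omega>) {y} = 0" if y: "y \<in> ?S" for y
  proof -
    have "measure Q {\<omega> \<in> space Q. emeasure (N \<omega>) {y} > 0} = 0"
      using x y by (auto simp: fixed_atom_radii_def fixed_atoms_def less_le)
    moreover have "{\<omega> \<in> space Q. emeasure (N \<omega>) {y} > 0} \<in> sets Q"
      using y by (intro null_compact_sets[OF pp]) auto
    ultimately show ?thesis
      by (intro AE_I[where N="{\<omega> \<in> space Q. emeasure (N \<omega>) {y} > 0}"])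
        (auto simp: Q.emeasure_eq_measure zero_less_iff_neq_zero)
  qed
  have "AE \<omega> in Q. \<forall>y\<in>?S. emeasure (N \<omega>) {y} = 0"
    using single by (intro AE_finite_allI) auto
  then have AE0: "AE \<omega> in Q. emeasure (N \<omega>) ?S = 0"
    using AE_space
  proof eventually_elim
    case (elim \<omega>)
    have "emeasure (N \<omega>) ?S = (\<Sum>y\<in>?S. emeasure (N \<omega>) {y})"
      using PM_sets[OF point_process_PM[OF pp elim(2)]]
      by (intro emeasure_eq_sum_singleton) (auto simp: sets_borel_on)
    then show ?case using elim(1) by simp
  qed
  have ind: "(\<integral>\<^sup>+y. ennreal (indicator ?S y) \<partial>\<mu>) = emeasure \<mu> ?S" if "\<mu> \<in> point_measures E" for \<mu>
    using PM_sets[OF that] S by (subst nn_integral_indicator[symmetric]) (auto simp: ennreal_indicator)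
  have "(\<lambda>y. indicator ?S y :: real) \<in> borel_measurable (borel_on E)"
    using S by simp
  with can have "(\<integral>\<omega>. exp_neg (\<integral>\<^sup>+y. ennreal (indicator ?S y) \<partial>N \<omega>) \<partial>Q) =
      exp_neg (\<integral>\<^sup>+\<mu>. ennreal (1 - exp_neg (\<integral>\<^sup>+y. ennreal (indicator ?S y) \<partial>\<mu>)) \<partial>\<Lambda>)"
    by (simp add: canonical_measure_def)
  also have "(\<integral>\<omega>. exp_neg (\<integral>\<^sup>+y. ennreal (indicator ?S y) \<partial>N \<omega>) \<partial>Q) = (\<integral>\<omega>. exp_neg (emeasure (N \<omega>) ?S) \<partial>Q)"
    using ind[OF point_process_PM[OF pp]] by (intro Bochner_Integration.integral_cong refl) simp
  also have "\<dots> = (\<integral>\<omega>. 1 \<partial>Q)"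
  proof (rule integral_cong_AE)
    have "(\<lambda>\<omega>. exp (- measure (N \<omega>) ?S)) \<in> borel_measurable Q"
      using measurable_compose[OF _ measure_compact_measurable[OF cS], of N Q] pp
      by (auto simp: point_process_def)
    then show "(\<lambda>\<omega>. exp_neg (emeasure (N \<omega>) ?S)) \<in> borel_measurable Q"
      by (rule measurable_cong[THEN iffD1, rotated])
        (subst emeasure_compact[OF point_process_PM[OF pp] cS]; simp add: exp_neg_ennreal)
    show "AE \<omega> in Q. exp_neg (emeasure (N \<omega>) ?S) = 1"
      using AE0 by eventually_elim (simp add: exp_neg_def)
  qed simp
  also have "\<dots> = 1" by (simp add: Q.prob_space)
  also have "(\<integral>\<^sup>+\<mu>. ennreal (1 - exp_neg (\<integral>\<^sup>+y. ennreal (indicator ?S y) \<partial>\<mu>)) \<partial>\<Lambda>) =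
      (\<integral>\<^sup>+\<mu>. ennreal (1 - exp_neg (emeasure \<mu> ?S)) \<partial>\<Lambda>)"
    using ind by (intro nn_integral_cong) (simp add: space_\<Lambda>)
  finally have zero: "(\<integral>\<^sup>+\<mu>. ennreal (1 - exp_neg (emeasure \<mu> ?S)) \<partial>\<Lambda>) = 0"
    by (metis exp_neg_eq_1)
  let ?F = "vague_topology E frontier_of (pms_beyond E x)"
  have F: "?F \<in> sets \<Lambda>"
    by (simp add: sets_\<Lambda> borel_Mp_eq closedin_sets_borel_of closedin_frontier_of)
  have "ennreal (1/2) * emeasure \<Lambda> ?F = (\<integral>\<^sup>+\<mu>. ennreal (1/2) * indicator ?F \<mu> \<partial>\<Lambda>)"
    using F by (simp add: nn_integral_cmult_indicator)
  also have "\<dots> \<le> (\<integral>\<^sup>+\<mu>. ennreal (1 - exp_neg (emeasure \<mu> ?S)) \<partial>\<Lambda>)"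
  proof (rule nn_integral_mono)
    fix \<mu> assume "\<mu> \<in> space \<Lambda>"
    show "ennreal (1/2) * indicator ?F \<mu> \<le> ennreal (1 - exp_neg (emeasure \<mu> ?S))"
    proof (cases "\<mu> \<in> ?F")
      case True
      then have "\<mu> \<in> point_measures E" "emeasure \<mu> ?S \<noteq> 0"
        using frontier_pms_beyond[OF x(1)] by auto
      then have "1 / 2 \<le> 1 - exp_neg (emeasure \<mu> ?S)"
        by (intro half_le_exp_neg cS) auto
      from ennreal_leI[OF this] show ?thesis using True by (simp only: indicator_simps mult_1_right)
    qed simp
  qed
  finally have "ennreal (1/2) * emeasure \<Lambda> ?F = 0" using zero by simp
  then show ?thesis by simp
qed

text \<open>The monotone function is \<open>G x = E (exp (- N (far x)))\<close>; the exponential is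
  taken because the expectation of \<open>N (far x)\<close> may be infinite. At a fixed atom
  \<open>x\<close> or \<open>- x\<close> the point leaves \<open>far y\<close> as soon as
  \<open>y > x\<close>, so \<open>G\<close> jumps to the right of \<open>x\<close>.\<close>

lemma countable_fixed_atom_radii:
  assumes pp: "point_process E Q N"
  shows "countable (fixed_atom_radii E Q N)"
proof -
  interpret Q: prob_space Q using pp by (simp add: point_process_def)
  define T where "T x \<omega> = measure (N \<omega>) (far x)" for x \<omega>
  define G where "G x = (\<integral>\<omega>. exp (- T x \<omega>) \<partial>Q)" for x
  have T_meas: "T x \<in> borel_measurable Q" if "0 < x" for x
    unfolding T_def using measurable_compose[OF _ measure_compact_measurable[OF compact_far[OF that]], of N Q] pp
    by (auto simp: point_process_def)
  have T_nn: "0 \<le> T x \<omega>" for x \<omega> by (simp add: T_def)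
  have int: "integrable Q (\<lambda>\<omega>. exp (- T x \<omega>))" if "0 < x" for x
    using T_meas[OF that] T_nn by (intro Q.integrable_const_bound[where B=1]) auto
  have fsets: "far x \<in> sets (N \<omega>)" if "0 < x" "\<omega> \<in> space Q" for x \<omega>
    using PM_sets[OF point_process_PM[OF pp that(2)]] compact_sets[OF compact_far[OF that(1)]] by auto
  have ffm: "far x \<in> fmeasurable (N \<omega>)" if "0 < x" "\<omega> \<in> space Q" for x \<omega>
    using PM_compact_finite[OF point_process_PM[OF pp that(2)] compact_far[OF that(1)]] fsets[OF that]
    by (intro fmeasurableI) auto
  have T_mono: "T y \<omega> \<le> T x \<omega>" if "0 < x" "x \<le> y" "\<omega> \<in> space Q" for x y \<omega>
    unfolding T_def using that
    by (intro measure_mono_fmeasurable ffm fsets) (auto intro: order_trans[of "ereal x" "ereal y"])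
  have mono: "mono_on {0<..} G"
    unfolding G_def by (intro mono_onI integral_mono int) (auto intro: T_mono)
  have "\<not> isCont G x" if rad: "x \<in> fixed_atom_radii E Q N" for x
  proof
    assume cont: "isCont G x"
    have x: "0 < x" using rad by (simp add: fixed_atom_radii_def)
    obtain z where z: "z \<in> {ereal x, - ereal x}" "z \<in> E"
        "0 < measure Q {\<omega> \<in> space Q. emeasure (N \<omega>) {z} > 0}"
      using rad by (auto simp: fixed_atom_radii_def fixed_atoms_def)
    let ?Z = "{\<omega> \<in> space Q. emeasure (N \<omega>) {z} > 0}"
    have Z: "?Z \<in> sets Q" using z by (intro null_compact_sets[OF pp]) auto
    \<comment> \<open>A lower bound for the jump of \<open>G\<close> at \<open>x\<close>, positive
      because the atom \<open>z\<close> is present with positive probability and the exponential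
      never vanishes.\<close>
    define c where "c = (\<integral>\<omega>. indicator ?Z \<omega> * exp (- T x \<omega>) \<partial>Q)"
    have ci: "integrable Q (\<lambda>\<omega>. indicator ?Z \<omega> * exp (- T x \<omega>))"
      using integrable_real_mult_indicator[OF Z int[OF x]] by (simp only: mult.commute)
    have "c \<noteq> 0"
    proof
      assume "c = 0"
      then have "AE \<omega> in Q. indicator ?Z \<omega> * exp (- T x \<omega>) = 0"
        unfolding c_def using ci by (subst (asm) integral_nonneg_eq_0_iff_AE) auto
      then have "AE \<omega> in Q. \<omega> \<notin> ?Z" by eventually_elim (auto simp: indicator_def split: if_splits)
      then have "emeasure Q ?Z = 0"
        by (subst (asm) AE_iff_measurable[OF Z]) blast+
      then have "measure Q ?Z = 0" by (simp add: measure_def)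
      then show False using z(3) by simp
    qed
    moreover have "0 \<le> c" unfolding c_def by (intro integral_nonneg_AE) auto
    ultimately have c: "0 < c" by simp
    have step: "G x + c \<le> G y" if y: "x < y" for y
    proof -
      have "G x + c = (\<integral>\<omega>. exp (- T x \<omega>) + indicator ?Z \<omega> * exp (- T x \<omega>) \<partial>Q)"
        unfolding G_def c_def using int[OF x] ci by simp
      also have "\<dots> \<le> G y"
        unfolding G_def
      proof (rule integral_mono)
        show "integrable Q (\<lambda>\<omega>. exp (- T y \<omega>))" using x y by (intro int) simp
        fix \<omega> assume \<omega>: "\<omega> \<in> space Q"
        note p = point_process_PM[OF pp \<omega>]
        show "exp (- T x \<omega>) + indicator ?Z \<omega> * exp (- T x \<omega>) \<le> exp (- T y \<omega>)"
        proof (cases "\<omega> \<in> ?Z")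
          case True
          have "1 \<le> measure (N \<omega>) {z}"
            using True z(2) by (intro measure_ge_1[OF p]) auto
          moreover have "measure (N \<omega>) (far y \<union> {z}) = measure (N \<omega>) (far y) + measure (N \<omega>) {z}"
          proof (rule measure_Un_AE)
            show "far y \<in> fmeasurable (N \<omega>)"
              using x y \<omega> by (intro ffm) auto
            show "{z} \<in> fmeasurable (N \<omega>)"
              using PM_compact_finite[OF p, of "{z}"] z(2) PM_sets[OF p]
              by (intro fmeasurableI) (auto simp: sets_borel_on)
            show "AE u in N \<omega>. u \<notin> far y \<or> u \<notin> {z}" using z(1) x y by (intro AE_I2) auto
          qed
          moreover have "measure (N \<omega>) (far y \<union> {z}) \<le> measure (N \<omega>) (far x)"
          proof (rule measure_mono_fmeasurable)
            show "far y \<union> {z} \<subseteq> far x"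
              using z x y by (auto intro: order_trans[of "ereal x" "ereal y"])
            show "far y \<union> {z} \<in> sets (N \<omega>)"
              using fsets[of y \<omega>] x y \<omega> z(2) PM_sets[OF p] by (auto simp: sets_borel_on)
            show "far x \<in> fmeasurable (N \<omega>)"
              by (rule ffm[OF x \<omega>])
          qed
          ultimately have "T y \<omega> + 1 \<le> T x \<omega>" by (simp add: T_def)
          \<comment> \<open>Losing a unit of mass multiplies the exponential by at least
            \<open>exp 1\<close>, more than 2; this pays for the additional copy of
            \<open>exp (- T x \<omega>)\<close> whose expectation is \<open>c\<close>.\<close>
          then have "exp (- T x \<omega>) \<le> exp (- T y \<omega>) * exp (- 1)" by (simp flip: exp_add)
          also have "\<dots> \<le> exp (- T y \<omega>) * (1 / 2)"
            using exp_minus_le_half[of 1] by (intro mult_left_mono) auto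
          finally show ?thesis using True by simp
        next
          case False
          then show ?thesis using T_mono[of x y \<omega>] x y \<omega> by simp
        qed
      qed (use int[OF x] ci in simp)
      finally show ?thesis .
    qed
    have "(G \<longlongrightarrow> G x) (at_right x)"
      using cont by (auto simp: isCont_def intro: tendsto_mono at_le)
    moreover have "eventually (\<lambda>y. G x + c \<le> G y) (at_right x)"
      using step by (auto simp: eventually_at_filter)
    ultimately have "G x + c \<le> G x"
      by (intro tendsto_lowerbound) auto
    then show False using c by simp
  qed
  then have "fixed_atom_radii E Q N \<subseteq> {x \<in> {0<..}. \<not> isCont G x}"
    by (auto simp: fixed_atom_radii_def)
  then show ?thesis
    by (rule countable_subset) (rule mono_on_ctble_discont_open[OF open_greaterThan mono])
qed

end

section \<open>The convergence criterion\<close>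

lemma state_space_abs_gt:
  assumes "0 \<le> a" "ereal a < b"
    and "E \<in> {{-b ..< - ereal a} \<union> {ereal a <.. b}, {ereal a <.. b}, {-b ..< - ereal a}}"
    and "y \<in> E"
  shows "ereal a < \<bar>y\<bar>"
  using assms by (cases y) (auto simp: abs_if)

text \<open>Each such \<open>E\<close> is a closed interval with 0 removed, and \<open>far x\<close>
  does not see the missing point; hence \<open>far x\<close> is closed in the compact extended
  line.\<close>

lemma punctured_state_space:
  assumes b: "0 < b"
    and E: "E \<in> {{-b ..< 0} \<union> {0 <.. b}, {0 <.. b}, {-b ..< (0::ereal)}}"
  shows "punctured E"
proof
  show "0 \<notin> E" using E by auto
  fix x :: real assume x: "0 < x"
  let ?C = "{y::ereal. ereal x \<le> \<bar>y\<bar>}"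
  have "closed ?C" by (intro closed_Collect_le continuous_on_const continuous_on_abs_ereal)
  moreover have "\<exists>F. closed F \<and> {y \<in> E. ereal x \<le> \<bar>y\<bar>} = F \<inter> ?C"
  proof -
    have "{y \<in> E. ereal x \<le> \<bar>y\<bar>} = F \<inter> ?C"
      if "F - {0} = E" for F
      using that x by auto
    moreover have "\<exists>F. closed F \<and> F - {0} = E"
    proof -
      have nb: "-b \<le> 0" using b by simp
      have "{-b..b} - {0} = {-b ..< 0} \<union> {0 <.. b}" "{0..b} - {0} = {0 <.. b}" "{-b..0} - {0} = {-b ..< 0}"
        using b nb less_imp_le order_trans[OF nb] order_trans[OF _ less_imp_le[OF b]] by auto
      with E have "{-b..b} - {0} = E \<or> {0..b} - {0} = E \<or> {-b..0} - {0} = E" by auto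
      then show ?thesis using closed_atLeastAtMost[of "-b" b] closed_atLeastAtMost[of 0 b] closed_atLeastAtMost[of "-b" 0]
        by metis
    qed
    ultimately show ?thesis by blast
  qed
  ultimately show "compact {y \<in> E. ereal x \<le> \<bar>y\<bar>}"
    using compact_Int_closed[OF compact_UNIV closed_Int] by (metis Int_UNIV_left)
qed

text \<open>For \<open>a > 0\<close> all mass lies beyond \<open>a\<close>, so the tail condition forces \<open>a = 0\<close>.\<close>

lemma state_space_tails_punctured:
  assumes E: "state_space E"
    and P: "\<And>n. n \<ge> 1 \<Longrightarrow> prob_space (P n)"
    and X: "\<And>n \<omega>. n \<ge> 1 \<Longrightarrow> \<omega> \<in> space (P n) \<Longrightarrow> X n \<omega> \<in> E"
    and tails: "\<And>\<epsilon>::real. \<epsilon> > 0 \<Longrightarrow>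
      limsup (\<lambda>n. ereal (real n * measure (P n) {\<omega> \<in> space (P n). \<bar>X n \<omega>\<bar> > ereal \<epsilon>})) < \<infinity>"
  shows "punctured E"
proof -
  obtain a :: real and b :: ereal where ab: "0 \<le> a" "ereal a < b"
    "E \<in> {{-b ..< - ereal a} \<union> {ereal a <.. b}, {ereal a <.. b}, {-b ..< - ereal a}}"
    using E unfolding state_space_def by blast
  have "a = 0"
  proof (rule ccontr)
    assume "a \<noteq> 0"
    with ab have "0 < a" by simp
    have all: "real n * measure (P n) {\<omega> \<in> space (P n). \<bar>X n \<omega>\<bar> > ereal a} = real n" for n
    proof (cases "n \<ge> 1")
      case True
      have "{\<omega> \<in> space (P n). \<bar>X n \<omega>\<bar> > ereal a} = space (P n)"
        using state_space_abs_gt[OF ab] X[OF True] by auto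
      then show ?thesis using prob_space.prob_space[OF P[OF True]] by simp
    qed simp
    have "limsup (\<lambda>n. ereal (real n)) < \<infinity>" using tails[OF \<open>0 < a\<close>] by (simp only: all)
    moreover have "limsup (\<lambda>n. ereal (real n)) = \<infinity>"
      by (intro lim_imp_Limsup) (auto simp: tendsto_PInfty_eq_at_top filterlim_real_sequentially)
    ultimately show False by simp
  qed
  then show ?thesis
    using ab by (intro punctured_state_space[of b]) (auto simp: zero_ereal_def)
qed

lemma LIMSEQ_shift_iff: "(\<lambda>n. f (n + m)) \<longlonglongrightarrow> l \<longleftrightarrow> f \<longlonglongrightarrow> l"
  by (blast intro: LIMSEQ_offset LIMSEQ_ignore_initial_segment)

section \<open>Limits of losses against limits of set probabilities\<close>

context row_laws
begin

text \<open>The conditions of the theorem are limits in \<open>ennreal\<close>; a finite limit mass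
  lets the analysis take place in the reals.\<close>

lemma emeasure_tendsto_iff:
  assumes "emeasure \<Lambda> A < \<infinity>"
  shows "(\<lambda>n. of_nat (k n) * emeasure (L n) A) \<longlonglongrightarrow> emeasure \<Lambda> A \<longleftrightarrow>
    (\<lambda>n. real (k n) * measure (L n) A) \<longlonglongrightarrow> measure \<Lambda> A"
proof -
  have "of_nat (k n) * emeasure (L n) A = ennreal (real (k n) * measure (L n) A)" for n
  proof -
    interpret prob_space "L n" by (rule prob_L)
    show ?thesis
      by (simp add: emeasure_eq_measure ennreal_mult' ennreal_of_nat_eq_real_of_nat)
  qed
  moreover have "emeasure \<Lambda> A = ennreal (measure \<Lambda> A)"
    using assms by (intro emeasure_eq_ennreal_measure) auto
  ultimately show ?thesis by simp
qed

lemma beyond_subset_finite: "0 < x \<Longrightarrow> A \<subseteq> pms_beyond E x \<Longrightarrow> emeasure \<Lambda> A < \<infinity>"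
  using pms_beyond_finite[of x] emeasure_mono[of A "pms_beyond E x" \<Lambda>] pms_beyond_sets[of x]
  by (simp add: sets_\<Lambda> le_less_trans)

text \<open>The set \<open>R\<close> contains the radii at which \<open>pms_beyond E x\<close> may
  fail to be a continuity set; here it will be \<open>fixed_atom_radii\<close>. Countability leaves
  admissible radii in every interval \<open>(0,s)\<close>, which the converse direction
  requires.\<close>

theorem loss_tendsto_iff:
  assumes R: "\<And>x. 0 < x \<Longrightarrow> x \<notin> R \<Longrightarrow> emeasure \<Lambda> (vague_topology E frontier_of (pms_beyond E x)) = 0"
    and R_countable: "countable R"
  shows "(\<forall>f\<in>CK_plus E. (\<lambda>n. real (k n) * (\<integral>\<xi>. loss f \<xi> \<partial>L n)) \<longlonglongrightarrow> (\<integral>\<xi>. loss f \<xi> \<partial>\<Lambda>)) \<longleftrightarrow>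
    (\<forall>x::real. 0 < x \<and> x \<notin> R \<longrightarrow>
      (\<lambda>n. of_nat (k n) * emeasure (L n) (pms_beyond E x)) \<longlonglongrightarrow> emeasure \<Lambda> (pms_beyond E x)) \<and>
    (\<forall>(x::real) M. 0 < x \<and> x \<notin> R \<and> emeasure \<Lambda> (pms_beyond E x) > 0 \<and>
        M \<in> sets (borel_Mp E) \<and> M \<subseteq> nonnull_pms E \<and>
        emeasure \<Lambda> (vague_topology E frontier_of M \<inter> pms_beyond E x) = 0 \<longrightarrow>
      (\<lambda>n. of_nat (k n) * emeasure (L n) (M \<inter> pms_beyond E x)) \<longlonglongrightarrow> emeasure \<Lambda> (M \<inter> pms_beyond E x))"
    (is "?loss \<longleftrightarrow> ?a \<and> ?b")
proof (intro iffI conjI allI impI; (elim conjE)?)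
  fix x :: real assume H: ?loss and x: "0 < x" "x \<notin> R"
  show "(\<lambda>n. of_nat (k n) * emeasure (L n) (pms_beyond E x)) \<longlonglongrightarrow> emeasure \<Lambda> (pms_beyond E x)"
    using H unfolding emeasure_tendsto_iff[OF pms_beyond_finite[OF x(1)]]
    by (intro set_limit[OF _ x(1)] pms_beyond_sets R x) auto
next
  fix x :: real and M
  assume H: ?loss and x: "0 < x" "x \<notin> R" and M: "M \<in> sets (borel_Mp E)" "M \<subseteq> nonnull_pms E"
    and null: "emeasure \<Lambda> (vague_topology E frontier_of M \<inter> pms_beyond E x) = 0"
  let ?B = "pms_beyond E x" and ?fr = "\<lambda>S. vague_topology E frontier_of S"
  have frs: "?fr S \<in> sets \<Lambda>" for S
    by (simp add: sets_\<Lambda> borel_Mp_eq closedin_sets_borel_of closedin_frontier_of)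
  have Bs: "?B \<in> sets \<Lambda>" using pms_beyond_sets[OF x(1)] by (simp add: sets_\<Lambda>)
  \<comment> \<open>Since \<open>?B\<close> is open, a frontier point of
    \<open>M \<inter> ?B\<close> inside \<open>?B\<close> is a frontier point of \<open>M\<close>,
    and one outside \<open>?B\<close> is a frontier point of \<open>?B\<close>. The second set is
    null by the choice of the radius.\<close>
  have "?fr (M \<inter> ?B) \<subseteq> (?fr M \<inter> ?B) \<union> ?fr ?B"
  proof
    fix \<xi> assume \<xi>: "\<xi> \<in> ?fr (M \<inter> ?B)"
    then have clB: "\<xi> \<in> vague_topology E closure_of ?B" and clM: "\<xi> \<in> vague_topology E closure_of M"
      using closure_of_mono[of "M \<inter> ?B" ?B "vague_topology E"] closure_of_mono[of "M \<inter> ?B" M "vague_topology E"]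
      by (auto simp: frontier_of_def)
    show "\<xi> \<in> (?fr M \<inter> ?B) \<union> ?fr ?B"
      using \<xi> clB clM openin_pms_beyond[OF x(1)]
      by (auto simp: frontier_of_def interior_of_openin interior_of_Int)
  qed
  then have "emeasure \<Lambda> (?fr (M \<inter> ?B)) \<le> emeasure \<Lambda> ((?fr M \<inter> ?B) \<union> ?fr ?B)"
    using frs Bs by (intro emeasure_mono) auto
  also have "\<dots> \<le> emeasure \<Lambda> (?fr M \<inter> ?B) + emeasure \<Lambda> (?fr ?B)"
    using frs Bs by (intro emeasure_subadditive) auto
  also have "\<dots> = 0" using null R[OF x] by simp
  finally have "emeasure \<Lambda> (?fr (M \<inter> ?B)) = 0" by simp
  moreover have "emeasure \<Lambda> (M \<inter> ?B) < \<infinity>" by (rule beyond_subset_finite[OF x(1)]) simp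
  ultimately show "(\<lambda>n. of_nat (k n) * emeasure (L n) (M \<inter> ?B)) \<longlonglongrightarrow> emeasure \<Lambda> (M \<inter> ?B)"
    using H M(1) pms_beyond_sets[OF x(1)] unfolding emeasure_tendsto_iff[OF \<open>emeasure \<Lambda> (M \<inter> ?B) < \<infinity>\<close>]
    by (intro set_limit[OF _ x(1)]) auto
next
  assume a: ?a and b: ?b
  show ?loss
  proof
    fix f assume f: "f \<in> CK_plus E"
    obtain s where s: "0 < s" "\<And>y. y \<in> E \<Longrightarrow> f y \<noteq> 0 \<Longrightarrow> ereal s \<le> \<bar>y\<bar>"
      using f unfolding CK_plus_iff by blast
    \<comment> \<open>An admissible radius strictly below \<open>s\<close> puts the support of
      \<open>f\<close>, where \<bar>y\<bar> \<ge> s, strictly beyond \<open>x\<close>.\<close>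
    have "uncountable ({0<..<s} - R)"
      using R_countable s(1) by (simp add: uncountable_minus_countable uncountable_open_interval)
    then obtain x where x: "0 < x" "x < s" "x \<notin> R"
      by (metis Diff_iff countable_empty equals0I greaterThanLessThan_iff)
    let ?B = "pms_beyond E x"
    have mass: "(\<lambda>n. real (k n) * measure (L n) ?B) \<longlonglongrightarrow> measure \<Lambda> ?B"
      using a x emeasure_tendsto_iff[OF pms_beyond_finite[OF x(1)]] by blast
    show "(\<lambda>n. real (k n) * (\<integral>\<xi>. loss f \<xi> \<partial>L n)) \<longlonglongrightarrow> (\<integral>\<xi>. loss f \<xi> \<partial>\<Lambda>)"
    proof (rule loss_limit[OF x(1) f _ mass])
      show "ereal x < \<bar>y\<bar>" if "y \<in> E" "f y \<noteq> 0" for y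
        using s(2)[OF that] x(2) by (metis ereal_less_eq(3) less_le_trans linorder_not_le)
      fix A assume A: "A \<in> sets (borel_Mp E)" "A \<subseteq> ?B"
        and null: "emeasure \<Lambda> (vague_topology E frontier_of A \<inter> ?B) = 0"
      have fA: "emeasure \<Lambda> A < \<infinity>" by (rule beyond_subset_finite[OF x(1) A(2)])
      show "(\<lambda>n. real (k n) * measure (L n) A) \<longlonglongrightarrow> measure \<Lambda> A"
      proof (cases "emeasure \<Lambda> ?B = 0")
        \<comment> \<open>Condition (b) says nothing when \<open>\<Lambda>\<close> does not charge
          \<open>?B\<close>; there (a) drives the rescaled mass of \<open>?B\<close>, and with it
          that of \<open>A\<close>, to 0.\<close>
        case True
        then have B0: "measure \<Lambda> ?B = 0" by (simp add: measure_def)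
        have "emeasure \<Lambda> A \<le> emeasure \<Lambda> ?B"
          using A pms_beyond_sets[OF x(1)] by (intro emeasure_mono) (auto simp: sets_\<Lambda>)
        then have "measure \<Lambda> A = 0" using True by (simp add: measure_def)
        moreover have "measure (L n) A \<le> measure (L n) ?B" for n
        proof -
          interpret prob_space "L n" by (rule prob_L)
          show ?thesis using A pms_beyond_sets[OF x(1)] by (intro finite_measure_mono) (auto simp: sets_L)
        qed
        then have "(\<lambda>n. real (k n) * measure (L n) A) \<longlonglongrightarrow> 0"
          using mass unfolding B0
          by (intro tendsto_sandwich[OF _ _ tendsto_const mass[unfolded B0]] always_eventually allI mult_left_mono) auto
        ultimately show ?thesis by simp
      next
        case False
        have "A \<subseteq> nonnull_pms E" using A(2) by (auto simp: pms_beyond_def)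
        then have "(\<lambda>n. of_nat (k n) * emeasure (L n) (A \<inter> ?B)) \<longlonglongrightarrow> emeasure \<Lambda> (A \<inter> ?B)"
          using b x A(1) null False by (simp add: zero_less_iff_neq_zero)
        then show ?thesis
          using emeasure_tendsto_iff[OF fA] A(2) by (simp add: Int_absorb2)
      qed
    qed
  qed
qed

end

section \<open>Convergence in distribution through Laplace functionals\<close>

context punctured
begin

text \<open>\<open>test_convergence\<close> asks for a finite measure at every index, while the
  processes are only assumed to be point processes from \<open>m\<close> on; the shifted sequence
  has the same limits.\<close>

lemma pp_conv_in_dist_iff_laplace:
  assumes pp: "\<And>n. m \<le> n \<Longrightarrow> point_process E (P n) (Ns n)" and ppQ: "point_process E Q N"
  shows "pp_conv_in_dist E P Ns Q N \<longleftrightarrow>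
    (\<forall>f\<in>CK_plus E. (\<lambda>n. \<integral>\<omega>. exp (- (\<integral>x. f x \<partial>Ns n \<omega>)) \<partial>P n) \<longlonglongrightarrow> (\<integral>\<omega>. exp (- (\<integral>x. f x \<partial>N \<omega>)) \<partial>Q))"
proof -
  define L where "L n = distr (P (n + m)) (borel_Mp E) (Ns (n + m))" for n
  define L0 where "L0 = distr Q (borel_Mp E) N"
  have meas: "Ns (n + m) \<in> measurable (P (n + m)) (borel_Mp E)" "N \<in> measurable Q (borel_Mp E)" for n
    using pp[of "n + m"] ppQ by (simp_all add: point_process_def)
  have fin: "finite_measure (L n)" "finite_measure L0" for n
    unfolding L_def L0_def using pp[of "n + m"] ppQ
    by (auto simp: point_process_def intro!: prob_space.finite_measure prob_space.prob_space_distr)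
  have sets: "sets (L n) = sets (borel_Mp E)" "sets L0 = sets (borel_Mp E)" for n
    by (simp_all add: L_def L0_def)
  have int: "(\<integral>\<xi>. exp (- (\<integral>x. f x \<partial>\<xi>)) \<partial>L n) = (\<integral>\<omega>. exp (- (\<integral>x. f x \<partial>Ns (n + m) \<omega>)) \<partial>P (n + m))"
      "(\<integral>\<xi>. exp (- (\<integral>x. f x \<partial>\<xi>)) \<partial>L0) = (\<integral>\<omega>. exp (- (\<integral>x. f x \<partial>N \<omega>)) \<partial>Q)"
    if f: "f \<in> CK_plus E" for f n
  proof -
    have "(\<lambda>\<xi>. exp (- (\<integral>x. f x \<partial>\<xi>))) \<in> borel_measurable (borel_Mp E)"
      using CK_integral_measurable[OF f] by measurable
    then show "(\<integral>\<xi>. exp (- (\<integral>x. f x \<partial>\<xi>)) \<partial>L n) = (\<integral>\<omega>. exp (- (\<integral>x. f x \<partial>Ns (n + m) \<omega>)) \<partial>P (n + m))"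
      "(\<integral>\<xi>. exp (- (\<integral>x. f x \<partial>\<xi>)) \<partial>L0) = (\<integral>\<omega>. exp (- (\<integral>x. f x \<partial>N \<omega>)) \<partial>Q)"
      unfolding L_def L0_def using meas by (simp_all add: integral_distr)
  qed
  show ?thesis
  proof (intro iffI ballI)
    fix f assume conv: "pp_conv_in_dist E P Ns Q N" and f: "f \<in> CK_plus E"
    have "bounded ((\<lambda>\<xi>. exp (- (\<integral>x. f x \<partial>\<xi>))) ` point_measures E)"
      using CK_integral_nonneg[OF _ f] by (intro boundedI[of _ 1]) auto
    with conv exp_integral_continuous[OF f]
    have "(\<lambda>n. \<integral>\<xi>. exp (- (\<integral>x. f x \<partial>\<xi>)) \<partial>distr (P n) (borel_Mp E) (Ns n)) \<longlonglongrightarrow> (\<integral>\<xi>. exp (- (\<integral>x. f x \<partial>\<xi>)) \<partial>L0)"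
      unfolding pp_conv_in_dist_def L0_def by blast
    from LIMSEQ_ignore_initial_segment[OF this, of m]
    have "(\<lambda>n. \<integral>\<xi>. exp (- (\<integral>x. f x \<partial>\<xi>)) \<partial>L n) \<longlonglongrightarrow> (\<integral>\<xi>. exp (- (\<integral>x. f x \<partial>\<xi>)) \<partial>L0)"
      by (simp add: L_def)
    then show "(\<lambda>n. \<integral>\<omega>. exp (- (\<integral>x. f x \<partial>Ns n \<omega>)) \<partial>P n) \<longlonglongrightarrow> (\<integral>\<omega>. exp (- (\<integral>x. f x \<partial>N \<omega>)) \<partial>Q)"
      unfolding int[OF f] by (rule LIMSEQ_offset)
  next
    assume lap: "\<forall>f\<in>CK_plus E. (\<lambda>n. \<integral>\<omega>. exp (- (\<integral>x. f x \<partial>Ns n \<omega>)) \<partial>P n) \<longlonglongrightarrow> (\<integral>\<omega>. exp (- (\<integral>x. f x \<partial>N \<omega>)) \<partial>Q)"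
    interpret tc: test_convergence "vague_topology E" "\<lambda>\<xi> i. exp (- (\<integral>x. probe i x \<partial>\<xi>))" L L0
    proof (rule laplace_test_convergence[OF fin sets])
      fix f assume f: "f \<in> CK_plus E"
      show "(\<lambda>n. \<integral>\<xi>. exp (- (\<integral>x. f x \<partial>\<xi>)) \<partial>L n) \<longlonglongrightarrow> (\<integral>\<xi>. exp (- (\<integral>x. f x \<partial>\<xi>)) \<partial>L0)"
        unfolding int[OF f] using bspec[OF lap f] by (rule LIMSEQ_ignore_initial_segment)
    qed
    show "pp_conv_in_dist E P Ns Q N"
      unfolding pp_conv_in_dist_def
    proof (intro allI impI, elim conjE)
      fix g :: "ereal measure \<Rightarrow> real"
      assume g: "continuous_map (vague_topology E) euclideanreal g" and "bounded (g ` point_measures E)"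
      then obtain B where "\<And>\<xi>. \<xi> \<in> point_measures E \<Longrightarrow> \<bar>g \<xi>\<bar> \<le> B"
        by (auto simp: bounded_iff)
      then have "(\<lambda>n. \<integral>\<mu>. g \<mu> \<partial>L n) \<longlonglongrightarrow> (\<integral>\<mu>. g \<mu> \<partial>L0)"
        by (intro tc.lim_continuous[OF g]) (simp add: topspace_vague_topology)
      then show "(\<lambda>n. \<integral>\<mu>. g \<mu> \<partial>distr (P n) (borel_Mp E) (Ns n)) \<longlonglongrightarrow> (\<integral>\<mu>. g \<mu> \<partial>distr Q (borel_Mp E) N)"
        unfolding L_def L0_def by (rule LIMSEQ_offset)
    qed
  qed
qed

end

theorem proposition2p4:
  fixes E :: "ereal set"
    and P :: "nat \<Rightarrow> 'a measure" and X :: "nat \<Rightarrow> nat \<Rightarrow> 'a \<Rightarrow> ereal"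
    and r k :: "nat \<Rightarrow> nat"
    and Q :: "'b measure" and N :: "'b \<Rightarrow> ereal measure" and \<Lambda> :: "ereal measure measure"
  assumes E: "state_space E"
    and P: "\<And>n. n \<ge> 1 \<Longrightarrow> prob_space (P n)"
    and X: "\<And>n. n \<ge> 1 \<Longrightarrow> strictly_stationary (P n) (borel_on E) n (X n)"
    and tails: "\<And>\<epsilon>::real. \<epsilon> > 0 \<Longrightarrow>
      limsup (\<lambda>n. ereal (real n * measure (P n) {\<omega> \<in> space (P n). \<bar>X n 1 \<omega>\<bar> > ereal \<epsilon>})) < \<infinity>"
    and r: "\<And>n. r n \<ge> 1"
    and k_def: "\<And>n. k n = n div r n"
    and k: "filterlim k at_top sequentially"
    and mixing: "\<And>f. f \<in> CK_plus E \<Longrightarrow>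
      (\<lambda>n. \<bar>(\<integral>\<omega>. exp (- (\<Sum>j=1..n. f (X n j \<omega>))) \<partial>P n)
          - (\<integral>\<omega>. exp (- (\<Sum>j=1..r n. f (X n j \<omega>))) \<partial>P n) ^ k n\<bar>) \<longlonglongrightarrow> 0"
    and N: "infinitely_divisible E Q N"
    and \<Lambda>: "canonical_measure E Q N \<Lambda>"
    and N_inf: "AE \<omega> in Q. emeasure (N \<omega>) (E \<inter> {-\<infinity>, \<infinity>}) = 0"
  shows "pp_conv_in_dist E P (\<lambda>n \<omega>. sum_diracs E n (\<lambda>j. X n j \<omega>)) Q N \<longleftrightarrow>
    (\<forall>x::real. 0 < x \<and> x \<notin> fixed_atom_radii E Q N \<longrightarrow>
      (\<lambda>n. of_nat (k n) *
          emeasure (P n) {\<omega> \<in> space (P n). Max ((\<lambda>j. \<bar>X n j \<omega>\<bar>) ` {1..r n}) > ereal x})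
        \<longlonglongrightarrow> emeasure \<Lambda> (pms_beyond E x)) \<and>
    (\<forall>(x::real) M. 0 < x \<and> x \<notin> fixed_atom_radii E Q N \<and> emeasure \<Lambda> (pms_beyond E x) > 0 \<and>
        M \<in> sets (borel_Mp E) \<and> M \<subseteq> nonnull_pms E \<and>
        emeasure \<Lambda> (vague_topology E frontier_of M \<inter> pms_beyond E x) = 0 \<longrightarrow>
      (\<lambda>n. of_nat (k n) *
          emeasure (P n) {\<omega> \<in> space (P n). Max ((\<lambda>j. \<bar>X n j \<omega>\<bar>) ` {1..r n}) > ereal x \<and>
            sum_diracs E (r n) (\<lambda>j. X n j \<omega>) \<in> M})
        \<longlonglongrightarrow> emeasure \<Lambda> (M \<inter> pms_beyond E x))"
proof -
  have X_meas: "X n j \<in> measurable (P n) (borel_on E)" if "j \<in> {1..n}" for n j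
    using X[of n] that by (auto simp: strictly_stationary_def)
  have X_E: "X n j \<omega> \<in> E" if "j \<in> {1..n}" "\<omega> \<in> space (P n)" for n j \<omega>
    using measurable_space[OF X_meas[OF that(1)] that(2)] by (simp add: space_restrict_space)
  interpret punctured E
    by (rule state_space_tails_punctured[OF E P _ tails]) (auto intro: X_E)
  have ppN: "point_process E Q N" using N by (simp add: infinitely_divisible_def)
  interpret canonical E \<Lambda> by (rule canonical_measure_canonical[OF \<Lambda>])
  have "eventually (\<lambda>n. 1 \<le> k n) sequentially" using k by (simp add: filterlim_at_top)
  \<comment> \<open>From \<open>k n \<ge> 1\<close> it follows that \<open>r n \<le> n\<close>, so
    the block sum uses only variables of the row, which are known to be measurable with values in
    \<open>E\<close>.\<close>
  then obtain m where m: "\<And>n. m \<le> n \<Longrightarrow> 1 \<le> k n" by (auto simp: eventually_sequentially)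
  have rn: "r n \<le> n" and n1: "1 \<le> n" if "m \<le> n" for n
    using m[OF that] r[of n] by (auto simp: k_def div_greater_zero_iff Suc_le_eq)
  let ?N = "\<lambda>n l \<omega>. sum_diracs E l (\<lambda>j. X n j \<omega>)"
  have N_meas: "?N n l \<in> measurable (P n) (borel_Mp E)" if "l \<le> n" for n l
    using that X_meas by (intro sum_diracs_measurable) auto
  have N_int: "(\<integral>x. f x \<partial>?N n l \<omega>) = (\<Sum>j=1..l. f (X n j \<omega>))"
    if "f \<in> CK_plus E" "l \<le> n" "\<omega> \<in> space (P n)" for f n l \<omega>
    using that X_E by (intro integral_sum_diracs) auto
  define L where "L n = distr (P (n + m)) (borel_Mp E) (?N (n + m) (r (n + m)))" for n
  have L_meas: "?N (n + m) (r (n + m)) \<in> measurable (P (n + m)) (borel_Mp E)" for n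
    by (intro N_meas rn) simp
  have prob: "prob_space (P (n + m))" for n by (intro P n1) simp
  interpret row_laws E \<Lambda> L "\<lambda>n. k (n + m)"
  proof (intro row_laws.intro row_laws_axioms.intro canonical_axioms)
    show "prob_space (L n)" for n
      unfolding L_def by (rule prob_space.prob_space_distr[OF prob L_meas])
    show "sets (L n) = sets (borel_Mp E)" for n
      by (simp add: L_def)
  qed
  let ?a = "\<lambda>f n. \<integral>\<omega>. exp (- (\<Sum>j=1..r n. f (X n j \<omega>))) \<partial>P n"
  have a_eq: "?a f (n + m) = 1 - (\<integral>\<xi>. loss f \<xi> \<partial>L n)" if f: "f \<in> CK_plus E" for f n
  proof -
    interpret Ln: prob_space "L n" by (rule prob_L)
    have ex: "(\<lambda>\<xi>. exp (- (\<integral>x. f x \<partial>\<xi>))) = (\<lambda>\<xi>. 1 - loss f \<xi>)" by (simp add: loss_def)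
    have "(\<integral>\<xi>. exp (- (\<integral>x. f x \<partial>\<xi>)) \<partial>L n) = (\<integral>\<omega>. exp (- (\<integral>x. f x \<partial>?N (n + m) (r (n + m)) \<omega>)) \<partial>P (n + m))"
      unfolding L_def
      by (intro integral_distr L_meas) (use CK_integral_measurable[OF f] in measurable)
    also have "\<dots> = ?a f (n + m)"
      by (intro Bochner_Integration.integral_cong refl) (simp add: N_int[OF f rn])
    finally show ?thesis
      using loss_integrable_L[OF f, of n] by (simp add: ex Ln.prob_space)
  qed
  have a01: "0 \<le> ?a f (n + m)" "?a f (n + m) \<le> 1" if f: "f \<in> CK_plus E" for f n
  proof -
    show "0 \<le> ?a f (n + m)" by (intro integral_nonneg_AE) simp
    have "0 \<le> (\<integral>\<xi>. loss f \<xi> \<partial>L n)"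
      using loss_bounds(1)[OF _ f] by (intro integral_nonneg_AE AE_I2) (simp add: space_L)
    then show "?a f (n + m) \<le> 1" using a_eq[OF f] by simp
  qed
  have conv_iff: "pp_conv_in_dist E P (\<lambda>n. ?N n n) Q N \<longleftrightarrow>
      (\<forall>f\<in>CK_plus E. (\<lambda>n. real (k (n + m)) * (\<integral>\<xi>. loss f \<xi> \<partial>L n)) \<longlonglongrightarrow> (\<integral>\<xi>. loss f \<xi> \<partial>\<Lambda>))"
  proof -
    have "pp_conv_in_dist E P (\<lambda>n. ?N n n) Q N \<longleftrightarrow>
        (\<forall>f\<in>CK_plus E. (\<lambda>n. \<integral>\<omega>. exp (- (\<integral>x. f x \<partial>?N n n \<omega>)) \<partial>P n) \<longlonglongrightarrow> (\<integral>\<omega>. exp (- (\<integral>x. f x \<partial>N \<omega>)) \<partial>Q))"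
      by (rule pp_conv_in_dist_iff_laplace[OF _ ppN, of m])
        (use P n1 N_meas in \<open>unfold point_process_def, blast\<close>)
    also have "\<dots> \<longleftrightarrow> (\<forall>f\<in>CK_plus E. (\<lambda>n. real (k (n + m)) * (\<integral>\<xi>. loss f \<xi> \<partial>L n)) \<longlonglongrightarrow> (\<integral>\<xi>. loss f \<xi> \<partial>\<Lambda>))"
    proof (rule ball_cong[OF refl])
      fix f assume f: "f \<in> CK_plus E"
      let ?c = "\<integral>\<xi>. loss f \<xi> \<partial>\<Lambda>" and ?S = "\<lambda>n. \<integral>\<omega>. exp (- (\<Sum>j=1..n. f (X n j \<omega>))) \<partial>P n"
      have "(\<integral>\<omega>. exp (- (\<integral>x. f x \<partial>?N n n \<omega>)) \<partial>P n) = ?S n" for n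
        by (intro Bochner_Integration.integral_cong refl) (simp add: N_int[OF f])
      then have "(\<lambda>n. \<integral>\<omega>. exp (- (\<integral>x. f x \<partial>?N n n \<omega>)) \<partial>P n) \<longlonglongrightarrow> (\<integral>\<omega>. exp (- (\<integral>x. f x \<partial>N \<omega>)) \<partial>Q) \<longleftrightarrow>
          ?S \<longlonglongrightarrow> exp (- ?c)"
        by (simp add: canonical_laplace[OF \<Lambda> ppN f])
      also have "\<dots> \<longleftrightarrow> (\<lambda>n. ?a f n ^ k n) \<longlonglongrightarrow> exp (- ?c)"
      proof -
        \<comment> \<open>The mixing condition makes the Laplace functional of the full row and the
          \<open>k n\<close>-th power of the block functional interchangeable in the limit.\<close>
        have d: "(\<lambda>n. ?S n - ?a f n ^ k n) \<longlonglongrightarrow> 0"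
          using mixing[OF f] by (simp add: tendsto_rabs_zero_iff)
        show ?thesis
          using Lim_transform[OF _ d] Lim_transform2[OF _ d] by blast
      qed
      also have "\<dots> \<longleftrightarrow> (\<lambda>n. ?a f (n + m) ^ k (n + m)) \<longlonglongrightarrow> exp (- ?c)"
        by (rule LIMSEQ_shift_iff[symmetric])
      also have "\<dots> \<longleftrightarrow> (\<lambda>n. real (k (n + m)) * (1 - ?a f (n + m))) \<longlonglongrightarrow> ?c"
        using a01[OF f] filterlim_compose[OF k filterlim_add_const_nat_at_top[of m]]
        by (intro pow_tendsto_exp_iff) auto
      also have "\<dots> \<longleftrightarrow> (\<lambda>n. real (k (n + m)) * (\<integral>\<xi>. loss f \<xi> \<partial>L n)) \<longlonglongrightarrow> ?c"
        unfolding a_eq[OF f] by simp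
      finally show "(\<lambda>n. \<integral>\<omega>. exp (- (\<integral>x. f x \<partial>?N n n \<omega>)) \<partial>P n) \<longlonglongrightarrow> (\<integral>\<omega>. exp (- (\<integral>x. f x \<partial>N \<omega>)) \<partial>Q) \<longleftrightarrow>
        (\<lambda>n. real (k (n + m)) * (\<integral>\<xi>. loss f \<xi> \<partial>L n)) \<longlonglongrightarrow> ?c" .
    qed
    finally show ?thesis .
  qed
  let ?ev = "\<lambda>n x M. {\<omega> \<in> space (P n). Max ((\<lambda>j. \<bar>X n j \<omega>\<bar>) ` {1..r n}) > ereal x \<and> ?N n (r n) \<omega> \<in> M}"
  let ?max = "\<lambda>n x. {\<omega> \<in> space (P n). Max ((\<lambda>j. \<bar>X n j \<omega>\<bar>) ` {1..r n}) > ereal x}"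
  \<comment> \<open>The event that the block maximum exceeds \<open>x\<close> is the event that the
    block process lies in \<open>pms_beyond E x\<close>, so (a) and (b) become statements about the
    row laws \<open>L n\<close>.\<close>
  have beyond: "?N (n + m) (r (n + m)) \<omega> \<in> pms_beyond E x \<longleftrightarrow>
      Max ((\<lambda>j. \<bar>X (n + m) j \<omega>\<bar>) ` {1..r (n + m)}) > ereal x"
    if "0 < x" "\<omega> \<in> space (P (n + m))" for n x \<omega>
    using that rn[of "n + m"] r[of "n + m"] X_E[of _ "n + m"] by (intro sum_diracs_beyond) auto
  have em_max: "emeasure (L n) (pms_beyond E x) = emeasure (P (n + m)) (?max (n + m) x)" if "0 < x" for n x
    unfolding L_def using beyond[OF that] pms_beyond_sets[OF that]
    by (subst emeasure_distr[OF L_meas]) (auto intro!: arg_cong[where f="emeasure _"])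
  have em_ev: "emeasure (L n) (M \<inter> pms_beyond E x) = emeasure (P (n + m)) (?ev (n + m) x M)"
    if "0 < x" "M \<in> sets (borel_Mp E)" for n x M
    unfolding L_def using beyond[OF that(1)] pms_beyond_sets[OF that(1)] that(2)
    by (subst emeasure_distr[OF L_meas]) (auto intro!: arg_cong[where f="emeasure _"])
  have max_iff: "(\<lambda>n. of_nat (k (n + m)) * emeasure (L n) (pms_beyond E x)) \<longlonglongrightarrow> l \<longleftrightarrow>
      (\<lambda>n. of_nat (k n) * emeasure (P n) (?max n x)) \<longlonglongrightarrow> l" if "0 < x" for x l
    unfolding em_max[OF that] by (rule LIMSEQ_shift_iff)
  have ev_iff: "(\<lambda>n. of_nat (k (n + m)) * emeasure (L n) (M \<inter> pms_beyond E x)) \<longlonglongrightarrow> l \<longleftrightarrow>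
      (\<lambda>n. of_nat (k n) * emeasure (P n) (?ev n x M)) \<longlonglongrightarrow> l" if "0 < x" "M \<in> sets (borel_Mp E)" for x M l
    unfolding em_ev[OF that] by (rule LIMSEQ_shift_iff)
  show ?thesis
    unfolding conv_iff
    by (rule trans[OF loss_tendsto_iff[OF frontier_beyond_null[OF \<Lambda> ppN] countable_fixed_atom_radii[OF ppN]]],
        assumption, assumption)
      (intro arg_cong2[where f="(\<and>)"] all_cong1 imp_cong[OF refl]; elim conjE; rule max_iff ev_iff; assumption)
qed

end
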